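(* Let $X\subseteq\mathbb{R}^d$ be bounded and $1\leq k<d$ an integer. Then for all $V\in G(d,k)$ and all $\theta\in(0,1]$, \[ \underline{\dim}_\theta P_V(X)\leq\underline{\dim}_\theta^kX\quad\text{and}\quad\overline{\dim}_\theta P_V(X)\leq\overline{\dim}_\theta^kX. \] Moreover, for $\gamma_{d,k}$-almost all $V\in G(d,k)$, \[ \underline{\dim}_\theta P_V(X)=\underline{\dim}_\theta^kX\quad\text{and}\quad\overline{\dim}_\theta P_V(X)=\overline{\dim}_\theta^kX\quad\text{for all }\theta\in(0,1]. \]
   Context: Intermediate dimensions: for $Y\subseteq\mathbb{R}^m$ and $0<\theta\leq1$, $\underline{\dim}_\theta Y$ is the infimum of $s\geq0$ such that for all $\epsilon>0$ and all $r_0>0$ there exist $0<r\leq r_0$ and a cover $\{U_i\}$ of $Y$ with $r^{1/\theta}\leq|U_i|\leq r$ and $\sum_i|U_i|^s\leq\epsilon$; $\overline{\dim}_\theta Y$ is the infimum of $s\geq0$ such that for all $\epsilon>0$ there is $r_0>0$ such that for all $0<r\leq r_0$ there is a cover $\{U_i\}$ of $Y$ with $r^{1/\theta}\leq|U_i|\leq r$ and $\sum_i|U_i|^s\leq\epsilon$. Intermediate dimension profiles: for integer $1\leq k\leq d$, $0\leq s\leq k$, $0<r\leq1$, define on $\mathbb{R}^d$ the kernel $\phi_{r,\theta}^{s,k}(x)=1$ if $|x|<r$, $=(r/|x|)^s$ if $r\leq|x|<r^\theta$, and $=r^{\theta(k-s)+s}/|x|^k$ if $r^\theta\leq|x|$.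 For compact $X$, $C_{r,\theta}^{s,k}(X)=\big(\inf_\mu\iint\phi_{r,\theta}^{s,k}(x-y)\,d\mu(x)\,d\mu(y)\big)^{-1}$, infimum over Borel probability measures supported on $X$; for bounded $X$ use the closure. $\underline{\dim}_\theta^kX$ (resp. $\overline{\dim}_\theta^kX$) is the unique $s\in[0,k]$ with $\liminf_{r\to0}\frac{\log C_{r,\theta}^{s,k}(X)}{-\log r}=s$ (resp. with $\limsup$); such $s$ exists and is unique. $G(d,k)$ is the Grassmannian of $k$-dimensional subspaces of $\mathbb{R}^d$ with rotation-invariant probability measure $\gamma_{d,k}$; $P_V$ is orthogonal projection onto $V$, identified with $\mathbb{R}^k$. *)

theory Defs
  imports "HOL-Probability.Probability"
begin

text \<open>Admissible covers: a family of sets covering Y, each of diameter in [r^(1/theta), r],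
  with sum of s-th powers of diameters at most eps. Such a family is necessarily finite
  (each term is at least r^(s/theta) > 0), so finiteness is imposed explicitly.\<close>

definition good_cover :: "real \<Rightarrow> real \<Rightarrow> real \<Rightarrow> real \<Rightarrow> 'a::metric_space set \<Rightarrow> bool" where
  "good_cover \<theta> s \<epsilon> r Y \<longleftrightarrow>
     (\<exists>\<U>::'a set set. finite \<U> \<and> Y \<subseteq> \<Union>\<U> \<and>
        (\<forall>U\<in>\<U>. bounded U \<and> r powr (1/\<theta>) \<le> diameter U \<and> diameter U \<le> r) \<and>
        (\<Sum>U\<in>\<U>. diameter U powr s) \<le> \<epsilon>)"

definition lower_int_dim :: "real \<Rightarrow> 'a::metric_space set \<Rightarrow> real" where
  "lower_int_dim \<theta> Y = Inf {s. 0 \<le> s \<and>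
     (\<forall>\<epsilon>>0. \<forall>r0>0. \<exists>r. 0 < r \<and> r \<le> r0 \<and> good_cover \<theta> s \<epsilon> r Y)}"

definition upper_int_dim :: "real \<Rightarrow> 'a::metric_space set \<Rightarrow> real" where
  "upper_int_dim \<theta> Y = Inf {s. 0 \<le> s \<and>
     (\<forall>\<epsilon>>0. \<exists>r0>0. \<forall>r. 0 < r \<and> r \<le> r0 \<longrightarrow> good_cover \<theta> s \<epsilon> r Y)}"

definition phi_kernel :: "real \<Rightarrow> real \<Rightarrow> real \<Rightarrow> nat \<Rightarrow> 'a::real_normed_vector \<Rightarrow> real" where
  "phi_kernel r \<theta> s k x =
     (if norm x < r then 1
      else if norm x < r powr \<theta> then (r / norm x) powr s
      else r powr (\<theta> * (real k - s) + s) / norm x ^ k)"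

definition prob_on :: "'a::euclidean_space set \<Rightarrow> 'a measure \<Rightarrow> bool" where
  "prob_on X \<mu> \<longleftrightarrow> sets \<mu> = sets borel \<and> prob_space \<mu> \<and> emeasure \<mu> (closure X) = 1"

definition phi_energy :: "real \<Rightarrow> real \<Rightarrow> real \<Rightarrow> nat \<Rightarrow> 'a::euclidean_space measure \<Rightarrow> ennreal" where
  "phi_energy r \<theta> s k \<mu> =
     (\<integral>\<^sup>+ x. (\<integral>\<^sup>+ y. ennreal (phi_kernel r \<theta> s k (x - y)) \<partial>\<mu>) \<partial>\<mu>)"

definition phi_capacity :: "real \<Rightarrow> real \<Rightarrow> real \<Rightarrow> nat \<Rightarrow> 'a::euclidean_space set \<Rightarrow> real" where
  "phi_capacity r \<theta> s k X =
     1 / Inf {enn2real (phi_energy r \<theta> s k \<mu>) | \<mu>. prob_on X \<mu>}"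

definition lower_dim_profile :: "real \<Rightarrow> nat \<Rightarrow> 'a::euclidean_space set \<Rightarrow> real" where
  "lower_dim_profile \<theta> k X = (THE s. 0 \<le> s \<and> s \<le> real k \<and>
     Liminf (at_right 0) (\<lambda>r. ereal (ln (phi_capacity r \<theta> s k X) / - ln r)) = ereal s)"

definition upper_dim_profile :: "real \<Rightarrow> nat \<Rightarrow> 'a::euclidean_space set \<Rightarrow> real" where
  "upper_dim_profile \<theta> k X = (THE s. 0 \<le> s \<and> s \<le> real k \<and>
     Limsup (at_right 0) (\<lambda>r. ereal (ln (phi_capacity r \<theta> s k X) / - ln r)) = ereal s)"

definition grassmannian :: "nat \<Rightarrow> 'a::euclidean_space set set" where
  "grassmannian k = {V. subspace V \<and> dim V = k}"

definition proj_onto :: "'a::euclidean_space set \<Rightarrow> 'a \<Rightarrow> 'a" where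
  "proj_onto V x = (THE y. y \<in> V \<and> (\<forall>v\<in>V. (x - y) \<bullet> v = 0))"

definition grass_dist :: "'a::euclidean_space set \<Rightarrow> 'a set \<Rightarrow> real" where
  "grass_dist V W = onorm (\<lambda>x. proj_onto V x - proj_onto W x)"

definition grass_open :: "nat \<Rightarrow> 'a::euclidean_space set set \<Rightarrow> bool" where
  "grass_open k U \<longleftrightarrow> U \<subseteq> grassmannian k \<and>
     (\<forall>V\<in>U. \<exists>e>0. \<forall>W\<in>grassmannian k. grass_dist V W < e \<longrightarrow> W \<in> U)"

definition grass_borel :: "nat \<Rightarrow> 'a::euclidean_space set measure" where
  "grass_borel k = sigma (grassmannian k) {U. grass_open k U}"

text \<open>gamma is a rotation-invariant Borel probability measure on G(d,k)
  (such a measure exists and is unique: this is gamma_{d,k}).\<close>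
definition grassmann_measure :: "nat \<Rightarrow> 'a::euclidean_space set measure \<Rightarrow> bool" where
  "grassmann_measure k \<gamma> \<longleftrightarrow> sets \<gamma> = sets (grass_borel k) \<and> prob_space \<gamma> \<and>
     (\<forall>f. orthogonal_transformation f \<longrightarrow>
        (\<forall>A\<in>sets \<gamma>. emeasure \<gamma> {V \<in> space \<gamma>. f ` V \<in> A} = emeasure \<gamma> A))"

end

theory Submission
  imports Defs "HOL-Real_Asymp.Real_Asymp"
begin

text \<open>
  Upper bounds. A measure of nearly minimal energy on \<open>X\<close> has potential at least half the minimal energy
  at every point of \<open>X\<close>. The kernel is radially decreasing, so the same holds for the projected potential,
  and a dyadic pigeonhole argument finds around every point of \<open>P\<^sub>V X\<close> a ball of large projected measure.
  By Vitali's lemma disjoint balls of this kind suffice; cutting the large ones into pieces of diameter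
  \<open>r powr \<theta>\<close> inside the \<open>k\<close>-dimensional space \<open>V\<close> gives an admissible cover whose cost is the capacity times
  \<open>r powr s\<close>, up to a logarithm.

  Lower bounds. The invariant measure of \<open>{V. |P\<^sub>V x| \<le> t}\<close> is at most a multiple of \<open>(t / |x|) ^ k\<close>, so for \<open>s < k\<close>
  the average over \<open>V\<close> of the truncated Riesz kernel at \<open>P\<^sub>V x\<close> is bounded by the profile kernel at \<open>x\<close>.
  Applied along dyadic scales to near-minimisers, Borel-Cantelli shows that for almost every \<open>V\<close> the projected
  energies are eventually almost minimal, and by Cauchy-Schwarz a small energy forces every cover to be
  expensive. The exceptional set is made independent of \<open>\<theta>\<close> by using rational \<open>\<theta>\<close> only: the intermediate
  dimensions are monotone and the profiles continuous in \<open>\<theta>\<close>.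
\<close>

subsection \<open>The kernel\<close>

text \<open>The scale in \<open>good_cover\<close> is the largest allowed diameter, whereas the
  kernel is indexed by the smallest one. All estimates therefore use covers at scale
  \<open>r powr \<theta>\<close>, whose diameters lie between \<open>r\<close> and
  \<open>r powr \<theta>\<close>, exactly the two break points of the kernel.

  The exponent \<open>s\<close> enters both the kernel and the cost of a cover, and the profile is
  the value at which the capacity grows like \<open>r powr (- s)\<close>. Away from it the growth
  exponent misses \<open>s\<close> by a definite amount, and this slack pays for every loss: the
  logarithm from counting dyadic scales, the constants, and the factor
  \<open>r powr \<delta>\<close> that makes the exceptional events summable.

  Lower bounds concern only \<open>s\<close> below the profile, hence \<open>s < k\<close>; this
  strictness makes the geometric series over thinner and thinner slabs converge. For the upper
  profile the capacity is large only along some sequence of scales, which may miss the dyadic ones;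
  monotonicity of the kernel in \<open>r\<close> links the two. Intermediate dimensions increase
  with \<theta>, so a rational value slightly below \<theta> suffices and it is left continuity of
  the profiles that matters.\<close>

lemma le_powr_self:
  fixes r \<theta> :: real
  assumes "0 < r" "r \<le> 1" "\<theta> \<le> 1"
  shows "r \<le> r powr \<theta>"
  using powr_mono'[of \<theta> 1 r] assms by simp

lemma le_powr_minus_mult:
  fixes r a b e :: real
  assumes "0 < r" "r powr e * a \<le> b"
  shows "a \<le> r powr (- e) * b"
proof -
  have "r powr (- e) * (r powr e * a) \<le> r powr (- e) * b"
    using assms by (intro mult_left_mono) auto
  moreover have "r powr (- e) * (r powr e * a) = a"
    using assms by (simp add: mult.assoc[symmetric] powr_add[symmetric])
  ultimately show ?thesis by simp
qed

text \<open>
  With \<open>m = max r |x|\<close> and \<open>\<sigma> = min m (r powr \<theta>)\<close> the three branches of the kernel become the single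
  formula \<open>(r / \<sigma>) powr s * (\<sigma> / m) ^ k\<close>, from which all comparisons are read off.
\<close>

definition cutoff :: "real \<Rightarrow> real \<Rightarrow> real \<Rightarrow> real" where
  "cutoff r \<theta> m = min m (r powr \<theta>)"

lemma cutoff_bounds:
  assumes "0 < r" "r \<le> 1" "0 < \<theta>" "\<theta> \<le> 1" "r \<le> m"
  shows "0 < cutoff r \<theta> m" "r \<le> cutoff r \<theta> m" "cutoff r \<theta> m \<le> m"
    "cutoff r \<theta> m \<le> r powr \<theta>" "cutoff r \<theta> m \<le> 1"
proof -
  show 1: "r \<le> cutoff r \<theta> m" using assms le_powr_self[of r \<theta>] by (simp add: cutoff_def)
  show "0 < cutoff r \<theta> m" using 1 assms by linarith
  show "cutoff r \<theta> m \<le> m" "cutoff r \<theta> m \<le> r powr \<theta>" by (auto simp: cutoff_def)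
  moreover have "r powr \<theta> \<le> 1" using assms by (simp add: powr_le1)
  ultimately show "cutoff r \<theta> m \<le> 1" by linarith
qed

lemma phi_kernel_eq:
  fixes x :: "'a::real_normed_vector"
  assumes r: "0 < r" "r \<le> 1" "0 < \<theta>" "\<theta> \<le> 1"
  shows "phi_kernel r \<theta> s k x =
    (r / cutoff r \<theta> (max r (norm x))) powr s *
    (cutoff r \<theta> (max r (norm x)) / max r (norm x)) ^ k"
proof -
  have rt: "r \<le> r powr \<theta>" using assms le_powr_self by simp
  consider "norm x < r" | "r \<le> norm x" "norm x < r powr \<theta>" | "r powr \<theta> \<le> norm x" "r \<le> norm x"
    using rt by linarith
  then show ?thesis
  proof cases
    case 1
    then show ?thesis using rt r by (simp add: phi_kernel_def cutoff_def)
  next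
    case 2
    then show ?thesis using rt r by (simp add: phi_kernel_def cutoff_def max_def)
  next
    case 3
    have "r powr (\<theta> * (real k - s) + s) = (r / r powr \<theta>) powr s * (r powr \<theta>) ^ k"
      using r by (simp add: powr_divide powr_powr powr_add powr_diff powr_realpow[symmetric]
          right_diff_distrib)
    then show ?thesis using 3 r
      by (simp add: phi_kernel_def cutoff_def max_def min_def power_divide)
  qed
qed

lemma phi_kernel_minus_commute: "phi_kernel r \<theta> s k (x - y) = phi_kernel r \<theta> s k (y - x)"
  by (simp add: phi_kernel_def norm_minus_commute)

lemma phi_kernel_pos:
  assumes "0 < r" "r \<le> 1" "0 < \<theta>" "\<theta> \<le> 1"
  shows "0 < phi_kernel r \<theta> s k x"
proof -
  have "r \<le> max r (norm x)" by simp
  from cutoff_bounds[OF assms this] show ?thesis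
    using assms by (auto simp: phi_kernel_eq[OF assms] intro!: mult_pos_pos divide_pos_pos)
qed

text \<open>The first factor decreases because \<open>cutoff\<close> grows with \<open>m\<close>;
  the second because \<open>cutoff r \<theta> m / m\<close> is the minimum of 1 and
  \<open>r powr \<theta> / m\<close>. Since projections shorten vectors, a potential can only grow
  when its points are projected.\<close>

lemma phi_kernel_antimono:
  assumes r: "0 < r" "r \<le> 1" "0 < \<theta>" "\<theta> \<le> 1" "0 \<le> s" and "norm x \<le> norm y"
  shows "phi_kernel r \<theta> s k y \<le> phi_kernel r \<theta> s k x"
proof -
  define m n where "m = max r (norm x)" and "n = max r (norm y)"
  have mn: "r \<le> m" "m \<le> n" "r \<le> n" using assms by (auto simp: m_def n_def)
  note cm = cutoff_bounds[OF r(1-4) mn(1)] and cn = cutoff_bounds[OF r(1-4) mn(3)]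
  have c: "cutoff r \<theta> m \<le> cutoff r \<theta> n" using mn by (auto simp: cutoff_def)
  have d: "cutoff r \<theta> n / n \<le> cutoff r \<theta> m / m"
  proof -
    have "0 < m" "0 < n" using mn r by auto
    then show ?thesis using mn
      by (auto simp: cutoff_def min_def divide_simps intro: mult_left_mono)
  qed
  have "(r / cutoff r \<theta> n) powr s \<le> (r / cutoff r \<theta> m) powr s"
    using c cm cn r by (intro powr_mono2) (auto intro!: divide_left_mono)
  moreover have "(cutoff r \<theta> n / n) ^ k \<le> (cutoff r \<theta> m / m) ^ k"
    using d cn mn r by (intro power_mono) auto
  ultimately show ?thesis
    unfolding phi_kernel_eq[OF r(1-4)] m_def[symmetric] n_def[symmetric]
    using cn mn r by (intro mult_mono) auto
qed

lemma phi_kernel_le_1: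
  assumes r: "0 < r" "r \<le> 1" "0 < \<theta>" "\<theta> \<le> 1" "0 \<le> s"
  shows "phi_kernel r \<theta> s k (x::'a::real_normed_vector) \<le> 1"
  using phi_kernel_antimono[OF r, of "0::'a" x k] r by (simp add: phi_kernel_def)

text \<open>Each factor of the closed formula loses a bounded amount, the first
  \<open>2 powr s\<close> and the second \<open>2 ^ k\<close>. This allows a kernel value to be
  replaced by the value at a dyadic radius.\<close>

lemma phi_kernel_doubling:
  assumes r: "0 < r" "r \<le> 1" "0 < \<theta>" "\<theta> \<le> 1" "0 \<le> s" and "norm y \<le> 2 * norm x"
  shows "phi_kernel r \<theta> s k x \<le> 2 powr (s + k) * phi_kernel r \<theta> s k y"
proof -
  define m n where "m = max r (norm x)" and "n = max r (norm y)"
  have mn: "r \<le> m" "n \<le> 2 * m" "r \<le> n" using assms by (auto simp: m_def n_def)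
  note cm = cutoff_bounds[OF r(1-4) mn(1)] and cn = cutoff_bounds[OF r(1-4) mn(3)]
  have c: "cutoff r \<theta> n \<le> 2 * cutoff r \<theta> m" using mn r by (auto simp: cutoff_def min_def)
  have d: "cutoff r \<theta> m / m \<le> 2 * (cutoff r \<theta> n / n)"
  proof (cases "n \<le> r powr \<theta>")
    case True
    then show ?thesis using cm mn r by (simp add: cutoff_def divide_simps)
  next
    case False
    then have "cutoff r \<theta> n = r powr \<theta>" by (simp add: cutoff_def)
    then have "cutoff r \<theta> m * n \<le> (r powr \<theta>) * (2 * m)" using cm cn mn r by (intro mult_mono) auto
    then show ?thesis using mn r \<open>cutoff r \<theta> n = r powr \<theta>\<close>
      by (simp add: divide_simps mult_ac)
  qed
  have "(r / cutoff r \<theta> m) powr s \<le> (2 * (r / cutoff r \<theta> n)) powr s"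
    using c cm cn r by (intro powr_mono2) (auto simp: divide_simps mult_ac)
  also have "\<dots> = 2 powr s * (r / cutoff r \<theta> n) powr s"
    using cn r by (subst powr_mult) auto
  finally have 1: "(r / cutoff r \<theta> m) powr s \<le> 2 powr s * (r / cutoff r \<theta> n) powr s" .
  have "(cutoff r \<theta> m / m) ^ k \<le> (2 * (cutoff r \<theta> n / n)) ^ k"
    using d cm mn r by (intro power_mono) auto
  also have "\<dots> = 2 ^ k * (cutoff r \<theta> n / n) ^ k" by (simp add: power_divide)
  finally have "phi_kernel r \<theta> s k x \<le> 
      (2 powr s * (r / cutoff r \<theta> n) powr s) * (2 ^ k * (cutoff r \<theta> n / n) ^ k)"
    unfolding phi_kernel_eq[OF r(1-4)] m_def[symmetric] n_def[symmetric]
    using 1 cm mn r by (intro mult_mono) auto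
  also have "\<dots> = 2 powr (s + k) * phi_kernel r \<theta> s k y"
    unfolding phi_kernel_eq[OF r(1-4)] n_def[symmetric] by (simp add: powr_add powr_realpow)
  finally show ?thesis .
qed

text \<open>The two kernels differ by the factor
  \<open>(r / cutoff r \<theta> m) powr (s - t)\<close>, whose base lies between
  \<open>r powr (1 - \<theta>)\<close> and 1. The second bound is the origin of the Lipschitz
  constant \<open>1 - \<theta>\<close> of the growth exponents.\<close>

lemma phi_kernel_exponent_mono:
  assumes r: "0 < r" "r \<le> 1" "0 < \<theta>" "\<theta> \<le> 1" and "t \<le> s"
  shows "phi_kernel r \<theta> s k x \<le> phi_kernel r \<theta> t k x"
    and "phi_kernel r \<theta> t k x \<le> r powr (- (1 - \<theta>) * (s - t)) * phi_kernel r \<theta> s k x"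
proof -
  define m where "m = max r (norm x)"
  have m: "r \<le> m" by (simp add: m_def)
  note c = cutoff_bounds[OF r m]
  let ?q = "r / cutoff r \<theta> m"
  have eq: "phi_kernel r \<theta> s k x = ?q powr (s - t) * phi_kernel r \<theta> t k x"
    unfolding phi_kernel_eq[OF r] m_def[symmetric] by (simp add: powr_add[symmetric])
  have pos: "0 < phi_kernel r \<theta> t k x" by (rule phi_kernel_pos[OF r])
  have "?q powr (s - t) \<le> 1" using c r assms by (intro powr_le1) auto
  then show "phi_kernel r \<theta> s k x \<le> phi_kernel r \<theta> t k x"
    unfolding eq using pos by (intro mult_left_le_one_le) auto
  have "r powr (1 - \<theta>) \<le> ?q"
    using c r by (simp add: powr_diff divide_left_mono)
  then have "(r powr (1 - \<theta>)) powr (s - t) \<le> ?q powr (s - t)"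
    using assms by (intro powr_mono2) auto
  then have "r powr ((1 - \<theta>) * (s - t)) * phi_kernel r \<theta> t k x \<le> phi_kernel r \<theta> s k x"
    unfolding eq using pos by (intro mult_right_mono) (auto simp: powr_powr)
  from le_powr_minus_mult[OF r(1) this]
  show "phi_kernel r \<theta> t k x \<le> r powr (- (1 - \<theta>) * (s - t)) * phi_kernel r \<theta> s k x"
    by (metis mult_minus_left)
qed

text \<open>For fixed \<open>r\<close> and \<open>x\<close> the kernel is proportional to
  \<open>cutoff powr (k - s)\<close>, and the ratio of the two cutoffs is at least
  \<open>r powr (\<theta> - q)\<close>. Enlarging the exponent \<open>k - s\<close> to
  \<open>k\<close> makes the bound uniform in \<open>s\<close>.\<close>

lemma phi_kernel_theta_mono:
  assumes r: "0 < r" "r \<le> 1" and q: "0 < q" "q \<le> \<theta>" "\<theta> \<le> 1" and s: "0 \<le> s" "s \<le> real k"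
  shows "phi_kernel r q s k x \<le> r powr (- (\<theta> - q) * real k) * phi_kernel r \<theta> s k x"
proof -
  define m where "m = max r (norm x)"
  have m: "r \<le> m" by (simp add: m_def)
  have t0: "0 < \<theta>" "q \<le> 1" using q by auto
  note c = cutoff_bounds[OF r t0(1) q(3) m] and d = cutoff_bounds[OF r q(1) t0(2) m]
  let ?a = "cutoff r \<theta> m" and ?b = "cutoff r q m"
  have "r powr (\<theta> - q) * ?b \<le> ?a"
  proof -
    have "r powr (\<theta> - q) \<le> 1" using r q by (simp add: powr_le1)
    then have "r powr (\<theta> - q) * ?b \<le> m"
      using d mult_left_le_one_le[of ?b "r powr (\<theta> - q)"] by (meson less_imp_le order_trans powr_ge_zero)
    moreover have "r powr (\<theta> - q) * ?b \<le> r powr (\<theta> - q) * r powr q" using d by (intro mult_left_mono) auto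
    then have "r powr (\<theta> - q) * ?b \<le> r powr \<theta>" by (simp add: powr_add[symmetric])
    ultimately show ?thesis by (simp add: cutoff_def)
  qed
  then have le: "r powr (\<theta> - q) \<le> ?a / ?b" using d by (simp add: field_simps)
  have eq: "phi_kernel r \<theta> s k x = (?a / ?b) powr (real k - s) * phi_kernel r q s k x"
    unfolding phi_kernel_eq[OF r t0(1) q(3)] phi_kernel_eq[OF r q(1) t0(2)] m_def[symmetric]
    using c d m r
    by (simp add: powr_divide powr_diff powr_realpow power_divide field_simps)
  have pos: "0 < phi_kernel r q s k x" by (rule phi_kernel_pos[OF r q(1) t0(2)])
  have "r powr ((\<theta> - q) * k) \<le> r powr ((\<theta> - q) * (k - s))"
    using r q s by (intro powr_mono') (auto intro!: mult_left_mono)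
  also have "\<dots> = (r powr (\<theta> - q)) powr (k - s)" by (simp add: powr_powr)
  also have "\<dots> \<le> (?a / ?b) powr (real k - s)" using le s by (intro powr_mono2) auto
  finally have "r powr ((\<theta> - q) * k) * phi_kernel r q s k x \<le> phi_kernel r \<theta> s k x"
    unfolding eq using pos by (intro mult_right_mono) auto
  from le_powr_minus_mult[OF r(1) this] show ?thesis by (metis mult_minus_left)
qed

text \<open>Up to radius \<open>r'\<close> the larger kernel equals 1. Beyond it the formula reads
  \<open>r powr s * cutoff powr (k - s) / m ^ k\<close>, and for \<open>0 \<le> s \<le> k\<close>
  both powers increase with \<open>r\<close>. Capacities at an arbitrary scale are compared with
  those at the dyadic scale below by means of this.\<close>

lemma phi_kernel_scale_mono:
  assumes r: "0 < r" "r \<le> r'" "r' \<le> 1" "0 < \<theta>" "\<theta> \<le> 1" and s: "0 \<le> s" "s \<le> real k"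
  shows "phi_kernel r \<theta> s k x \<le> phi_kernel r' \<theta> s k x"
proof (cases "norm x \<le> r'")
  case True
  then have "phi_kernel r' \<theta> s k x = 1"
    using r by (auto simp: phi_kernel_eq cutoff_def max_def min_def le_powr_self)
  then show ?thesis using phi_kernel_le_1[of r \<theta> s k x] r s by simp
next
  case False
  define m where "m = norm x"
  have m: "r \<le> m" "r' \<le> m" "max r (norm x) = m" "max r' (norm x) = m" using False r by (auto simp: m_def)
  have r': "0 < r'" "r \<le> 1" using r by auto
  note c = cutoff_bounds[OF r(1) r'(2) r(4,5) m(1)] and d = cutoff_bounds[OF r'(1) r(3-5) m(2)]
  have eq: "(u / a) powr s * (a / m) ^ k = u powr s * a powr (k - s) / m ^ k" if "0 < a" "0 < u" for u a
    using that by (simp add: powr_divide powr_diff powr_realpow power_divide)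
  have le: "cutoff r \<theta> m \<le> cutoff r' \<theta> m"
    using r powr_mono2[of \<theta> r r'] by (auto simp: cutoff_def min_def)
  have "phi_kernel r \<theta> s k x = r powr s * cutoff r \<theta> m powr (k - s) / m ^ k"
    using r r' m eq[OF c(1) r(1)] by (simp add: phi_kernel_eq)
  also have "\<dots> \<le> r' powr s * cutoff r' \<theta> m powr (k - s) / m ^ k"
    using r r' m s le c by (intro divide_right_mono mult_mono powr_mono2) auto
  also have "\<dots> = phi_kernel r' \<theta> s k x"
    using r r' m eq[OF d(1) r'(1)] by (simp add: phi_kernel_eq)
  finally show ?thesis .
qed

text \<open>The first bound is crude and serves to make minimal energies positive. In the second,
  \<open>s = k\<close> cancels the cutoff and leaves \<open>(r / m) ^ k\<close>, which limits the
  growth of the capacity at the endpoint \<open>k\<close>.\<close>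

lemma phi_kernel_lower_bound:
  assumes r: "0 < r" "r \<le> 1" "0 < \<theta>" "\<theta> \<le> 1" "0 \<le> s" and B: "norm x \<le> B" "1 \<le> B"
  shows "r powr s * (r / B) ^ k \<le> phi_kernel r \<theta> s k x"
    and "(r / B) ^ k \<le> phi_kernel r \<theta> (real k) k x"
proof -
  define m where "m = max r (norm x)"
  have m: "r \<le> m" "m \<le> B" using B r by (auto simp: m_def)
  note c = cutoff_bounds[OF r(1-4) m(1)]
  show "r powr s * (r / B) ^ k \<le> phi_kernel r \<theta> s k x"
    unfolding phi_kernel_eq[OF r(1-4)] m_def[symmetric]
    using c r B m by (intro mult_mono powr_mono2 power_mono frac_le) (auto simp: divide_simps)
  have "phi_kernel r \<theta> (real k) k x = (r / m) ^ k"
    unfolding phi_kernel_eq[OF r(1-4)] m_def[symmetric]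
    using c r m by (simp add: powr_realpow power_divide)
  also have "\<dots> \<ge> (r / B) ^ k"
    using c r B m by (intro power_mono frac_le) auto
  finally show "(r / B) ^ k \<le> phi_kernel r \<theta> (real k) k x" .
qed

lemma phi_kernel_measurable [measurable]:
  "(\<lambda>x::'a::euclidean_space. phi_kernel r \<theta> s k x) \<in> borel_measurable borel"
  unfolding phi_kernel_def by measurable

subsection \<open>Capacities and dimension profiles\<close>

definition min_energy :: "real \<Rightarrow> real \<Rightarrow> real \<Rightarrow> nat \<Rightarrow> 'a::euclidean_space set \<Rightarrow> real" where
  "min_energy r \<theta> s k X = Inf {enn2real (phi_energy r \<theta> s k \<mu>) | \<mu>. prob_on X \<mu>}"

lemma phi_capacity_eq: "phi_capacity r \<theta> s k X = 1 / min_energy r \<theta> s k X"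
  by (simp add: phi_capacity_def min_energy_def)

lemma prob_on_AE:
  assumes "prob_on X \<mu>"
  shows "AE x in \<mu>. x \<in> closure X"
proof -
  interpret prob_space \<mu> using assms by (simp add: prob_on_def)
  show ?thesis using assms by (intro AE_prob_1) (simp add: prob_on_def measure_def)
qed

lemma prob_on_return:
  assumes "x \<in> closure X"
  shows "prob_on X (return borel x)"
  using assms by (auto simp: prob_on_def intro!: prob_space_return)

lemma prob_on_ex: "X \<noteq> {} \<Longrightarrow> \<exists>\<mu>. prob_on X \<mu>"
  using prob_on_return closure_subset by blast

lemma phi_energy_le_1:
  assumes "prob_on X \<mu>" "0 < r" "r \<le> 1" "0 < \<theta>" "\<theta> \<le> 1" "0 \<le> s"
  shows "phi_energy r \<theta> s k \<mu> \<le> 1"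
proof -
  interpret prob_space \<mu> using assms by (simp add: prob_on_def)
  have "phi_energy r \<theta> s k \<mu> \<le> (\<integral>\<^sup>+x. \<integral>\<^sup>+y. 1 \<partial>\<mu> \<partial>\<mu>)"
    unfolding phi_energy_def using phi_kernel_le_1[OF assms(2-)] by (intro nn_integral_mono) auto
  then show ?thesis by (simp add: emeasure_space_1)
qed

lemma phi_energy_ge:
  assumes "prob_on X \<mu>" and c: "\<And>x y. x \<in> closure X \<Longrightarrow> y \<in> closure X \<Longrightarrow> c \<le> phi_kernel r \<theta> s k (x - y)"
  shows "ennreal c \<le> phi_energy r \<theta> s k \<mu>"
proof -
  interpret prob_space \<mu> using assms by (simp add: prob_on_def)
  note ae = prob_on_AE[OF assms(1)]
  have "ennreal c = (\<integral>\<^sup>+x. \<integral>\<^sup>+y. ennreal c \<partial>\<mu> \<partial>\<mu>)" by (simp add: emeasure_space_1)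
  also have "\<dots> \<le> phi_energy r \<theta> s k \<mu>"
    unfolding phi_energy_def
    by (rule nn_integral_mono_AE, use ae in eventually_elim, rule nn_integral_mono_AE, use ae in eventually_elim)
      (auto intro!: ennreal_leI c)
  finally show ?thesis .
qed

lemma bdd_below_energies: "bdd_below {enn2real (phi_energy r \<theta> s k \<mu>) | \<mu>. prob_on X \<mu>}"
  by (rule bdd_belowI[of _ 0]) auto

lemma min_energy_le:
  assumes "prob_on X \<mu>"
  shows "min_energy r \<theta> s k X \<le> enn2real (phi_energy r \<theta> s k \<mu>)"
  unfolding min_energy_def using assms by (intro cInf_lower bdd_below_energies) auto

text \<open>\<open>enn2real\<close> would turn an infinite energy into 0; the bound survives the
  passage to the reals because every energy is at most 1.\<close>

lemma min_energy_ge: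
  assumes "X \<noteq> {}" "0 < r" "r \<le> 1" "0 < \<theta>" "\<theta> \<le> 1" "0 \<le> s"
    and "\<And>\<mu>. prob_on X \<mu> \<Longrightarrow> ennreal c \<le> phi_energy r \<theta> s k \<mu>"
  shows "c \<le> min_energy r \<theta> s k X"
  unfolding min_energy_def
proof (rule cInf_greatest)
  show "{enn2real (phi_energy r \<theta> s k \<mu>) | \<mu>. prob_on X \<mu>} \<noteq> {}"
    using prob_on_ex[OF assms(1)] by auto
next
  fix e assume "e \<in> {enn2real (phi_energy r \<theta> s k \<mu>) | \<mu>. prob_on X \<mu>}"
  then obtain \<mu> where e: "e = enn2real (phi_energy r \<theta> s k \<mu>)" "prob_on X \<mu>" by auto
  have "phi_energy r \<theta> s k \<mu> < top"
    using phi_energy_le_1[OF e(2) assms(2-6), of k] by (simp add: ennreal_one_less_top order_le_less_trans)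
  then have "phi_energy r \<theta> s k \<mu> = ennreal e" using e by simp
  with assms(7)[OF e(2)] have "ennreal c \<le> ennreal e" by metis
  moreover have "0 \<le> e" unfolding e(1) by simp
  ultimately show "c \<le> e" by (simp add: ennreal_le_iff)
qed

lemma min_energy_le_1:
  assumes "X \<noteq> {}" "0 < r" "r \<le> 1" "0 < \<theta>" "\<theta> \<le> 1" "0 \<le> s"
  shows "min_energy r \<theta> s k X \<le> 1"
proof -
  obtain \<mu> where \<mu>: "prob_on X \<mu>" using prob_on_ex[OF assms(1)] by auto
  have "enn2real (phi_energy r \<theta> s k \<mu>) \<le> 1"
    using phi_energy_le_1[OF \<mu> assms(2-), of k] by (simp add: enn2real_leI)
  then show ?thesis using min_energy_le[OF \<mu>, of r \<theta> s k] by linarith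
qed

lemma bounded_closure_diff:
  fixes X :: "'a::euclidean_space set"
  assumes "bounded X"
  obtains B :: real where "1 \<le> B" "\<And>x y. x \<in> closure X \<Longrightarrow> y \<in> closure X \<Longrightarrow> norm (x - y) \<le> B"
proof -
  have b: "bounded (closure X)" using assms by (rule bounded_closure)
  show thesis
    by (rule that[of "max 1 (diameter (closure X))"])
      (use diameter_bounded_bound[OF b] in \<open>auto simp: dist_norm max.coboundedI2\<close>)
qed

lemma min_energy_pos:
  fixes X :: "'a::euclidean_space set"
  assumes "bounded X" "X \<noteq> {}" "0 < r" "r \<le> 1" "0 < \<theta>" "\<theta> \<le> 1" "0 \<le> s"
  shows "0 < min_energy r \<theta> s k X"
proof -
  obtain B where B: "1 \<le> B" "\<And>x y. x \<in> closure X \<Longrightarrow> y \<in> closure X \<Longrightarrow> norm (x - y) \<le> B"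
    using bounded_closure_diff[OF assms(1)] by blast
  have "r powr s * (r / B) ^ k \<le> min_energy r \<theta> s k X"
    using assms B by (intro min_energy_ge phi_energy_ge phi_kernel_lower_bound) auto
  moreover have "0 < r powr s * (r / B) ^ k" using assms B by auto
  ultimately show ?thesis by linarith
qed

lemma phi_capacity_ge_1:
  fixes X :: "'a::euclidean_space set"
  assumes "bounded X" "X \<noteq> {}" "0 < r" "r \<le> 1" "0 < \<theta>" "\<theta> \<le> 1" "0 \<le> s"
  shows "1 \<le> phi_capacity r \<theta> s k X"
  using min_energy_pos[OF assms, of k] min_energy_le_1[OF assms(2-), of k]
  by (simp add: phi_capacity_eq)

text \<open>A pointwise inequality between kernels integrates to one between energies. All three
  parameters vary independently, so that the same statement serves changes of \<open>s\<close>, of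
  \<theta> and of the scale.\<close>

lemma phi_capacity_compare:
  fixes X :: "'a::euclidean_space set"
  assumes "bounded X" "X \<noteq> {}" and r: "0 < r" "r \<le> 1" "0 < \<theta>" "\<theta> \<le> 1" "0 \<le> s"
    and r': "0 < r'" "r' \<le> 1" "0 < \<theta>'" "\<theta>' \<le> 1" "0 \<le> s'"
    and A: "0 < A" and le: "\<And>x::'a. phi_kernel r \<theta> s k x \<le> A * phi_kernel r' \<theta>' s' k x"
  shows "phi_capacity r' \<theta>' s' k X \<le> A * phi_capacity r \<theta> s k X"
proof -
  define I I' where "I = min_energy r \<theta> s k X" and "I' = min_energy r' \<theta>' s' k X"
  have pos: "0 < I" "0 < I'"
    unfolding I_def I'_def using assms by (auto intro!: min_energy_pos)
  have "I / A \<le> I'"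
    unfolding I'_def
  proof (rule min_energy_ge[OF assms(2) r'])
    fix \<mu> :: "'a measure" assume \<mu>: "prob_on X \<mu>"
    then have sets[measurable_cong]: "sets \<mu> = sets borel" by (simp add: prob_on_def)
    interpret prob_space \<mu> using \<mu> by (simp add: prob_on_def)
    have "phi_energy r \<theta> s k \<mu> \<le>
        (\<integral>\<^sup>+x. \<integral>\<^sup>+y. ennreal A * ennreal (phi_kernel r' \<theta>' s' k (x - y)) \<partial>\<mu> \<partial>\<mu>)"
      unfolding phi_energy_def
      using le A by (intro nn_integral_mono) (simp add: ennreal_mult'[symmetric] ennreal_leI)
    also have "\<dots> = ennreal A * phi_energy r' \<theta>' s' k \<mu>"
      unfolding phi_energy_def by (simp add: nn_integral_cmult)
    finally have E: "phi_energy r \<theta> s k \<mu> \<le> ennreal A * phi_energy r' \<theta>' s' k \<mu>" .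
    have "phi_energy r \<theta> s k \<mu> < top"
      using phi_energy_le_1[OF \<mu> r, of k] by (simp add: ennreal_one_less_top order_le_less_trans)
    then have "ennreal I \<le> phi_energy r \<theta> s k \<mu>"
      using min_energy_le[OF \<mu>, of r \<theta> s k] pos
      by (metis I_def ennreal_enn2real ennreal_leI)
    also note E
    finally have "ennreal (1 / A) * ennreal I \<le> ennreal (1 / A) * (ennreal A * phi_energy r' \<theta>' s' k \<mu>)"
      by (intro mult_left_mono) auto
    also have "\<dots> = phi_energy r' \<theta>' s' k \<mu>"
      using A by (simp add: mult.assoc[symmetric] ennreal_mult[symmetric])
    finally show "ennreal (I / A) \<le> phi_energy r' \<theta>' s' k \<mu>"
      using A pos by (simp add: ennreal_mult[symmetric])
  qed
  then show ?thesis using pos A unfolding phi_capacity_eq I_def[symmetric] I'_def[symmetric]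
    by (simp add: field_simps)
qed

section \<open>Growth exponents of capacities and their limits\<close>

definition cap_exponent :: "real \<Rightarrow> nat \<Rightarrow> 'a::euclidean_space set \<Rightarrow> real \<Rightarrow> real \<Rightarrow> real" where
  "cap_exponent \<theta> k X s r = ln (phi_capacity r \<theta> s k X) / - ln r"

context
  fixes X :: "'a::euclidean_space set"
  assumes X: "bounded X" "X \<noteq> {}"
begin

text \<open>Division by \<open>- ln r\<close> turns a power of \<open>r\<close> in a capacity
  comparison into an additive error. The bounds hold at each fixed \<open>r\<close>, so they pass to
  the lower and to the upper limit alike.\<close>

lemma cap_exponent_bounds:
  assumes r: "0 < r" "r < 1" and t: "0 < \<theta>" "\<theta> \<le> 1" and "0 \<le> t" "t \<le> s"
  shows "0 \<le> cap_exponent \<theta> k X t r" "cap_exponent \<theta> k X t r \<le> cap_exponent \<theta> k X s r"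
    "cap_exponent \<theta> k X s r \<le> cap_exponent \<theta> k X t r + (1 - \<theta>) * (s - t)"
proof -
  have r': "0 < r" "r \<le> 1" and s: "0 \<le> s" using assms by auto
  let ?C = "\<lambda>s. phi_capacity r \<theta> s k X"
  have C: "1 \<le> ?C t" "1 \<le> ?C s" using assms X by (auto intro!: phi_capacity_ge_1)
  have l: "0 < - ln r" using r by simp
  show "0 \<le> cap_exponent \<theta> k X t r"
    using C l by (simp add: cap_exponent_def divide_nonneg_neg divide_nonneg_pos zero_le_divide_iff)
  have "?C t \<le> 1 * ?C s"
    by (rule phi_capacity_compare[OF X r' t s r' t])
      (use assms phi_kernel_exponent_mono(1)[OF r' t] in auto)
  then have "ln (?C t) \<le> ln (?C s)" using C by simp
  then show "cap_exponent \<theta> k X t r \<le> cap_exponent \<theta> k X s r"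
    using l unfolding cap_exponent_def by (intro divide_right_mono) auto
  have "?C s \<le> r powr (- (1 - \<theta>) * (s - t)) * ?C t"
    by (rule phi_capacity_compare[OF X r' t assms(5) r' t s])
      (use assms phi_kernel_exponent_mono(2)[OF r' t] in auto)
  then have "ln (?C s) \<le> ln (r powr (- (1 - \<theta>) * (s - t)) * ?C t)" using C r by simp
  also have "\<dots> = - ln r * ((1 - \<theta>) * (s - t)) + ln (?C t)"
    using C r by (simp add: ln_mult ln_powr algebra_simps)
  finally have "ln (?C s) / - ln r \<le> (- ln r * ((1 - \<theta>) * (s - t)) + ln (?C t)) / - ln r"
    using l by (intro divide_right_mono) auto
  also have "\<dots> = ln (?C t) / - ln r + (1 - \<theta>) * (s - t)" using l by (simp add: field_simps)
  finally show "cap_exponent \<theta> k X s r \<le> cap_exponent \<theta> k X t r + (1 - \<theta>) * (s - t)"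
    unfolding cap_exponent_def .
qed

lemma cap_exponent_theta_le:
  assumes r: "0 < r" "r < 1" and q: "0 < q" "q \<le> \<theta>" "\<theta> \<le> 1" and s: "0 \<le> s" "s \<le> real k"
  shows "cap_exponent \<theta> k X s r \<le> cap_exponent q k X s r + (\<theta> - q) * k"
proof -
  have r': "0 < r" "r \<le> 1" and t: "0 < \<theta>" "q \<le> 1" using assms by auto
  have C: "1 \<le> phi_capacity r \<theta> s k X" "1 \<le> phi_capacity r q s k X" using assms X by (auto intro!: phi_capacity_ge_1)
  have l: "0 < - ln r" using r by simp
  have "phi_capacity r \<theta> s k X \<le> r powr (- (\<theta> - q) * k) * phi_capacity r q s k X"
    by (rule phi_capacity_compare[OF X r' q(1) t(2) s(1) r' t(1) q(3) s(1)])
      (use assms phi_kernel_theta_mono[OF r' q s] in auto)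
  then have "ln (phi_capacity r \<theta> s k X) \<le> ln (r powr (- (\<theta> - q) * k) * phi_capacity r q s k X)"
    using C r by simp
  also have "\<dots> = - ln r * ((\<theta> - q) * k) + ln (phi_capacity r q s k X)"
    using C r by (simp add: ln_mult ln_powr algebra_simps)
  finally have "ln (phi_capacity r \<theta> s k X) / - ln r \<le> (- ln r * ((\<theta> - q) * k) + ln (phi_capacity r q s k X)) / - ln r"
    using l by (intro divide_right_mono) auto
  also have "\<dots> = ln (phi_capacity r q s k X) / - ln r + (\<theta> - q) * k" using l by (simp add: field_simps)
  finally show ?thesis unfolding cap_exponent_def .
qed

text \<open>On the bounded set the kernel with \<open>s = k\<close> is at least
  \<open>(r / B) ^ k\<close>, so the capacity is at most \<open>(B / r) ^ k\<close> and the
  contribution of \<open>B\<close> vanishes in the limit. This places the fixed point below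
  \<open>k\<close>.\<close>

lemma cap_exponent_top:
  assumes t: "0 < \<theta>" "\<theta> \<le> 1" and "0 < e"
  shows "eventually (\<lambda>r. cap_exponent \<theta> k X (real k) r \<le> real k + e) (at_right 0)"
proof -
  obtain B where B: "1 \<le> B" "\<And>x y. x \<in> closure X \<Longrightarrow> y \<in> closure X \<Longrightarrow> norm (x - y) \<le> B"
    using bounded_closure_diff[OF X(1)] by blast
  have "eventually (\<lambda>r::real. r \<in> {0<..<1}) (at_right 0)"
    by (rule eventually_at_right_real) simp
  moreover have "((\<lambda>r::real. real k * ln B / - ln r) \<longlongrightarrow> 0) (at_right 0)" by real_asymp
  then have "eventually (\<lambda>r. real k * ln B / - ln r < e) (at_right 0)"
    using \<open>0 < e\<close> by (rule order_tendstoD)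
  ultimately show ?thesis
  proof eventually_elim
    case (elim r)
    then have r: "0 < r" "r \<le> 1" and l: "0 < - ln r" by auto
    have "(r / B) ^ k \<le> min_energy r \<theta> (real k) k X"
      using r t B X by (intro min_energy_ge phi_energy_ge phi_kernel_lower_bound(2)[where s=0]) auto
    moreover have p: "0 < (r / B) ^ k" using r B by auto
    ultimately have "phi_capacity r \<theta> (real k) k X \<le> 1 / (r / B) ^ k"
      unfolding phi_capacity_eq by (intro divide_left_mono) auto
    moreover have "1 \<le> phi_capacity r \<theta> (real k) k X" using X r t by (intro phi_capacity_ge_1) auto
    ultimately have "ln (phi_capacity r \<theta> (real k) k X) \<le> ln (1 / (r / B) ^ k)"
      using p by (subst ln_le_cancel_iff) auto
    also have "\<dots> = real k * ln B + - ln r * k" using r B p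
      by (simp add: ln_div ln_realpow algebra_simps)
    finally have "ln (phi_capacity r \<theta> (real k) k X) / - ln r \<le> (real k * ln B + - ln r * k) / - ln r"
      using l by (intro divide_right_mono) auto
    also have "\<dots> = real k * ln B / - ln r + k" using l by (simp add: field_simps)
    finally show ?case unfolding cap_exponent_def using elim by linarith
  qed
qed

end

text \<open>
  Since \<open>F\<close> is \<open>(1 - \<theta>)\<close>-Lipschitz with \<open>\<theta> > 0\<close>, the function \<open>s - F s\<close> is strictly increasing, with slope at
  least \<open>\<theta>\<close>; this is why the profile is well defined.
\<close>

lemma fixed_point_profile:
  fixes F :: "real \<Rightarrow> ereal" and \<theta> :: real and k :: nat
  assumes \<theta>: "0 < \<theta>" "\<theta> \<le> 1" and F0: "0 \<le> F 0" and Fk: "F k \<le> k"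
    and mono': "\<forall>t\<ge>0. \<forall>s\<ge>t. F t \<le> F s"
    and lip': "\<forall>t\<ge>0. \<forall>s\<ge>t. F s \<le> F t + ereal ((1 - \<theta>) * (s - t))"
    and D: "D = (THE s. 0 \<le> s \<and> s \<le> real k \<and> F s = ereal s)"
  shows "0 \<le> D" "D \<le> k" "\<And>s. D \<le> s \<Longrightarrow> F s \<le> ereal (s - \<theta> * (s - D))"
    "\<And>s. 0 \<le> s \<Longrightarrow> s \<le> D \<Longrightarrow> ereal (s + \<theta> * (D - s)) \<le> F s"
proof -
  note mono = mono'[rule_format] and lip = lip'[rule_format]
  define G where "G s = real_of_ereal (F s)" for s
  have F0k: "F 0 \<le> k" using mono[of 0 k] Fk by (auto intro: order_trans)
  have FG: "F s = ereal (G s)" if "0 \<le> s" for s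
  proof -
    have "F s \<le> ereal k + ereal ((1 - \<theta>) * (s - 0))"
      using lip[of 0 s] that F0k by (meson add_right_mono order.refl order_trans)
    then have "F s \<noteq> \<infinity>" by auto
    moreover have "F s \<noteq> -\<infinity>" using mono[of 0 s] that F0 by auto
    ultimately show ?thesis by (cases "F s") (auto simp: G_def)
  qed
  have Gm: "G t \<le> G s" "G s \<le> G t + (1 - \<theta>) * (s - t)" if "0 \<le> t" "t \<le> s" for s t
    using mono[OF that] lip[OF that] that FG[of s] FG[of t] by simp_all
  have cont: "continuous_on {0..real k} (\<lambda>s. s - G s)"
  proof (intro continuous_on_diff continuous_on_id)
    have le: "\<bar>G s - G t\<bar> \<le> \<bar>s - t\<bar>" if "0 \<le> t" "t \<le> s" for s t
      using Gm[OF that] that \<theta> mult_left_le_one_le[of "s - t" "1 - \<theta>"] by simp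
    have "1-lipschitz_on {0..real k} G"
    proof (rule lipschitz_onI)
      fix x y assume "x \<in> {0..real k}" "y \<in> {0..real k}"
      then show "dist (G x) (G y) \<le> 1 * dist x y"
        using le[of x y] le[of y x] by (cases "x \<le> y") (auto simp: dist_real_def abs_minus_commute)
    qed simp
    then show "continuous_on {0..real k} G" by (rule lipschitz_on_continuous_on)
  qed
  have "G k \<le> k" "0 \<le> G 0" using Fk F0 FG[of k] FG[of 0] by (auto simp: zero_ereal_def)
  then have "\<exists>s\<ge>0. s \<le> real k \<and> s - G s = 0"
    using IVT'[OF _ _ _ cont, of 0] by auto
  then obtain d :: real where d: "0 \<le> d" "d \<le> k" "G d = d" by auto
  have gap: "\<theta> * (s - t) \<le> (s - G s) - (t - G t)" if "0 \<le> t" "t \<le> s" for s t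
    using Gm(2)[OF that] by (simp add: algebra_simps)
  have "D = d"
    unfolding D
  proof (rule the_equality)
    show "0 \<le> d \<and> d \<le> real k \<and> F d = ereal d" using d FG by simp
  next
    fix s assume s: "0 \<le> s \<and> s \<le> real k \<and> F s = ereal s"
    then have "G s = s" using FG[of s] by simp
    then have "\<theta> * \<bar>s - d\<bar> \<le> 0" using gap[of d s] gap[of s d] s d by (cases "d \<le> s") auto
    then show "s = d" using \<theta> by (simp add: mult_le_0_iff)
  qed
  then have D': "0 \<le> D" "D \<le> k" "G D = D" using d by auto
  show "0 \<le> D" "D \<le> k" by fact+
  show "F s \<le> ereal (s - \<theta> * (s - D))" if "D \<le> s" for s
    using gap[of D s] that D' FG[of s] by auto
  show "ereal (s + \<theta> * (D - s)) \<le> F s" if "0 \<le> s" "s \<le> D" for s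
    using gap[of s D] that D' FG[of s] by (auto simp: algebra_simps)
qed

lemma eventually_less_1: "eventually (\<lambda>r::real. 0 < r \<and> r < 1) (at_right 0)"
  using eventually_at_right_real[of 0 1] by simp

text \<open>Abstracts \<open>Liminf\<close> and \<open>Limsup\<close> at \<open>0+\<close>, so that both profiles are treated at once.\<close>

locale limit_functional =
  fixes L :: "(real \<Rightarrow> ereal) \<Rightarrow> ereal"
  assumes L_mono: "\<And>f g. eventually (\<lambda>r. f r \<le> g r) (at_right 0) \<Longrightarrow> L f \<le> L g"
    and L_const: "\<And>c. L (\<lambda>_. c) = c"
    and L_add: "\<And>f c. L (\<lambda>r. f r + ereal c) = L f + ereal c"
begin

definition profile :: "real \<Rightarrow> nat \<Rightarrow> 'a::euclidean_space set \<Rightarrow> real" where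
  "profile \<theta> k X = (THE s. 0 \<le> s \<and> s \<le> real k \<and> L (\<lambda>r. ereal (cap_exponent \<theta> k X s r)) = ereal s)"

text \<open>Monotonicity, constants and translations are what \<open>L\<close> contributes: they
  carry the eventual bounds on \<open>cap_exponent\<close> over to its limit as a function of
  \<open>s\<close>, where the fixed point argument applies.\<close>

lemma
  fixes X :: "'a::euclidean_space set"
  assumes X: "bounded X" "X \<noteq> {}" and \<theta>: "0 < \<theta>" "\<theta> \<le> 1"
  shows profile_props: "0 \<le> profile \<theta> k X \<and> profile \<theta> k X \<le> k \<and>
    (\<forall>s\<ge>profile \<theta> k X. L (\<lambda>r. ereal (cap_exponent \<theta> k X s r)) \<le> ereal (s - \<theta> * (s - profile \<theta> k X))) \<and>
    (\<forall>s\<ge>0. s \<le> profile \<theta> k X \<longrightarrow>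
      ereal (s + \<theta> * (profile \<theta> k X - s)) \<le> L (\<lambda>r. ereal (cap_exponent \<theta> k X s r)))"
proof -
  define F where "F s = L (\<lambda>r. ereal (cap_exponent \<theta> k X s r))" for s
  define D where "D = profile \<theta> k X"
  have "L (\<lambda>_. 0) \<le> F 0" unfolding F_def
    by (rule L_mono, use eventually_less_1 in eventually_elim)
      (use cap_exponent_bounds(1)[OF X _ _ \<theta>, of _ 0 0] in auto)
  then have 1: "0 \<le> F 0" by (simp add: L_const)
  have 2: "F k \<le> k"
  proof (rule ereal_le_epsilon2)
    fix e :: real assume "0 < e"
    have "F k \<le> L (\<lambda>_. ereal (k + e))"
      unfolding F_def by (rule L_mono, use cap_exponent_top[OF X \<theta> \<open>0 < e\<close>] in eventually_elim) auto
    then show "F k \<le> ereal k + ereal e" by (simp add: L_const)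
  qed
  have 3: "F t \<le> F s" if "0 \<le> t" "t \<le> s" for s t
    unfolding F_def
    by (rule L_mono, use eventually_less_1 in eventually_elim)
      (use cap_exponent_bounds(2)[OF X _ _ \<theta> that] in auto)
  have 4: "F s \<le> F t + ereal ((1 - \<theta>) * (s - t))" if "0 \<le> t" "t \<le> s" for s t
    unfolding F_def L_add[symmetric]
    by (rule L_mono, use eventually_less_1 in eventually_elim)
      (use cap_exponent_bounds(3)[OF X _ _ \<theta> that] in auto)
  have D: "D = (THE s. 0 \<le> s \<and> s \<le> real k \<and> F s = ereal s)"
    unfolding D_def F_def profile_def ..
  have "\<forall>t\<ge>0. \<forall>s\<ge>t. F t \<le> F s" "\<forall>t\<ge>0. \<forall>s\<ge>t. F s \<le> F t + ereal ((1 - \<theta>) * (s - t))"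
    using 3 4 by blast+
  note fp = fixed_point_profile[of \<theta> F k D, OF \<theta> 1 2 this D]
  show ?thesis
    unfolding F_def[symmetric] D_def[symmetric] by (intro conjI allI impI fp)
qed

lemma
  fixes X :: "'a::euclidean_space set"
  assumes X: "bounded X" "X \<noteq> {}" and \<theta>: "0 < \<theta>" "\<theta> \<le> 1"
  shows profile_nonneg: "0 \<le> profile \<theta> k X" and profile_le: "profile \<theta> k X \<le> k"
    and profile_above: "profile \<theta> k X \<le> s \<Longrightarrow>
      L (\<lambda>r. ereal (cap_exponent \<theta> k X s r)) \<le> ereal (s - \<theta> * (s - profile \<theta> k X))"
    and profile_below: "0 \<le> s \<Longrightarrow> s \<le> profile \<theta> k X \<Longrightarrow>
      ereal (s + \<theta> * (profile \<theta> k X - s)) \<le> L (\<lambda>r. ereal (cap_exponent \<theta> k X s r))"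
  using profile_props[OF assms, of k] by simp_all

text \<open>Let \<open>D\<close> be the profile at \<theta> and evaluate both limits at
  \<open>s = D\<close>. At \<theta> the limit is at least \<open>D\<close>; passing to
  \<open>q\<close> costs at most \<open>(\<theta> - q) * k\<close>; but at \<open>q\<close> the
  limit lies below \<open>D\<close> by at least \<open>q\<close> times the distance from
  \<open>D\<close> to the profile at \<open>q\<close>.\<close>

lemma profile_theta:
  fixes X :: "'a::euclidean_space set"
  assumes X: "bounded X" "X \<noteq> {}" and q: "0 < q" "q \<le> \<theta>" "\<theta> \<le> 1"
  shows "q * (profile \<theta> k X - profile q k X) \<le> (\<theta> - q) * k"
proof (cases "profile q k X \<le> profile \<theta> k X")
  case True
  define D where "D = profile \<theta> k X"
  have \<theta>: "0 < \<theta>" "q \<le> 1" using q by auto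
  have D: "0 \<le> D" "D \<le> k" using profile_nonneg[OF X \<theta>(1) q(3)] profile_le[OF X \<theta>(1) q(3)] by (auto simp: D_def)
  have "ereal D \<le> L (\<lambda>r. ereal (cap_exponent \<theta> k X D r))"
    using profile_below[OF X \<theta>(1) q(3) D(1), of k] by (simp add: D_def)
  also have "\<dots> \<le> L (\<lambda>r. ereal (cap_exponent q k X D r)) + ereal ((\<theta> - q) * k)"
    unfolding L_add[symmetric]
    by (rule L_mono, use eventually_less_1 in eventually_elim)
      (use cap_exponent_theta_le[OF X _ _ q D] in auto)
  also have "\<dots> \<le> ereal (D - q * (D - profile q k X)) + ereal ((\<theta> - q) * k)"
    using profile_above[OF X q(1) \<theta>(2), of k D] True by (intro add_right_mono) (simp add: D_def)
  finally show ?thesis by (simp add: D_def)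
next
  case False
  then have "q * (profile \<theta> k X - profile q k X) \<le> 0" using q by (simp add: mult_le_0_iff)
  moreover have "0 \<le> (\<theta> - q) * k" using q by simp
  ultimately show ?thesis by linarith
qed

end

interpretation lower: limit_functional "Liminf (at_right 0)"
  rewrites "lower.profile = lower_dim_profile"
proof -
  show l: "limit_functional (Liminf (at_right 0))"
    by unfold_locales
      (rule Liminf_mono Liminf_const Liminf_add_ereal_right; simp)+
  show "limit_functional.profile (Liminf (at_right 0)) = lower_dim_profile"
    by (intro ext) (simp add: limit_functional.profile_def[OF l] lower_dim_profile_def cap_exponent_def)
qed

interpretation upper: limit_functional "Limsup (at_right 0)"
  rewrites "upper.profile = upper_dim_profile"
proof -
  show l: "limit_functional (Limsup (at_right 0))"
    by unfold_locales
      (rule Limsup_mono Limsup_const Limsup_add_ereal_right; simp)+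
  show "limit_functional.profile (Limsup (at_right 0)) = upper_dim_profile"
    by (intro ext) (simp add: limit_functional.profile_def[OF l] upper_dim_profile_def cap_exponent_def)
qed

lemma
  assumes r: "0 < r" "r < 1" and C: "1 \<le> phi_capacity r \<theta> s k X"
  shows cap_exponent_less_iff: "cap_exponent \<theta> k X s r < a \<longleftrightarrow> phi_capacity r \<theta> s k X < r powr (- a)"
    and cap_exponent_greater_iff: "a < cap_exponent \<theta> k X s r \<longleftrightarrow> r powr (- a) < phi_capacity r \<theta> s k X"
proof -
  have l: "0 < - ln r" using r by simp
  have e: "r powr (- a) = exp (a * - ln r)" using r by (simp add: powr_def)
  have "cap_exponent \<theta> k X s r < a \<longleftrightarrow> ln (phi_capacity r \<theta> s k X) < a * - ln r"
    unfolding cap_exponent_def by (rule pos_divide_less_eq[OF l])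
  also have "\<dots> \<longleftrightarrow> phi_capacity r \<theta> s k X < r powr (- a)"
    by (metis C e exp_less_cancel_iff exp_ln less_le_trans zero_less_one)
  finally show "cap_exponent \<theta> k X s r < a \<longleftrightarrow> phi_capacity r \<theta> s k X < r powr (- a)" .
  have "a < cap_exponent \<theta> k X s r \<longleftrightarrow> a * - ln r < ln (phi_capacity r \<theta> s k X)"
    unfolding cap_exponent_def by (rule pos_less_divide_eq[OF l])
  also have "\<dots> \<longleftrightarrow> r powr (- a) < phi_capacity r \<theta> s k X"
    by (metis C e exp_less_cancel_iff exp_ln less_le_trans zero_less_one)
  finally show "a < cap_exponent \<theta> k X s r \<longleftrightarrow> r powr (- a) < phi_capacity r \<theta> s k X" .
qed

text \<open>At distance \<open>d\<close> from the profile the limit of the growth exponents misses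
  \<open>s\<close> by at least \<open>\<theta> * d\<close>. Half of this gap is given away to obtain
  a bound at actual scales \<open>r\<close>; the other half remains as the strict inequality between
  \<open>a\<close> and \<open>s\<close>.\<close>

lemma
  fixes X :: "'a::euclidean_space set"
  assumes X: "bounded X" "X \<noteq> {}" and \<theta>: "0 < \<theta>" "\<theta> \<le> 1"
  shows lower_profile_less: "lower_dim_profile \<theta> k X < s \<Longrightarrow>
      \<exists>a<s. \<exists>\<^sub>F r in at_right 0. phi_capacity r \<theta> s k X < r powr (- a)"
    and upper_profile_less: "upper_dim_profile \<theta> k X < s \<Longrightarrow>
      \<exists>a<s. \<forall>\<^sub>F r in at_right 0. phi_capacity r \<theta> s k X < r powr (- a)"
    and lower_profile_greater: "0 \<le> s \<Longrightarrow> s < lower_dim_profile \<theta> k X \<Longrightarrow>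
      \<exists>a>s. \<forall>\<^sub>F r in at_right 0. r powr (- a) < phi_capacity r \<theta> s k X"
    and upper_profile_greater: "0 \<le> s \<Longrightarrow> s < upper_dim_profile \<theta> k X \<Longrightarrow>
      \<exists>a>s. \<exists>\<^sub>F r in at_right 0. r powr (- a) < phi_capacity r \<theta> s k X"
proof -
  let ?L = "lower_dim_profile \<theta> k X" and ?U = "upper_dim_profile \<theta> k X"
  have C: "1 \<le> phi_capacity r \<theta> s k X" if "0 < r \<and> r < 1" "0 \<le> s" for r s
    using phi_capacity_ge_1[OF X] \<theta> that by simp
  have mid: "x - \<theta> * (x - d) < x - \<theta> * (x - d) / 2" "x - \<theta> * (x - d) / 2 < x" if "d < x" for x d
    using mult_pos_pos[of \<theta> "x - d"] \<theta> that by auto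
  have mid': "x + \<theta> * (d - x) > x + \<theta> * (d - x) / 2" "x + \<theta> * (d - x) / 2 > x" if "x < d" for x d
    using mult_pos_pos[of \<theta> "d - x"] \<theta> that by auto
  {
    assume s: "?L < s"
    let ?a = "s - \<theta> * (s - ?L) / 2"
    have "0 \<le> s" using lower.profile_nonneg[OF X \<theta>, of k] s by linarith
    have "\<exists>\<^sub>F r in at_right 0. phi_capacity r \<theta> s k X < r powr (- ?a)"
    proof (rule ccontr)
      assume "\<not> ?thesis"
      then have "eventually (\<lambda>r. \<not> phi_capacity r \<theta> s k X < r powr (- ?a)) (at_right 0)"
        by (simp add: not_frequently)
      then have "eventually (\<lambda>r. ereal ?a \<le> ereal (cap_exponent \<theta> k X s r)) (at_right 0)"
        using eventually_less_1
        by eventually_elim (metis C[OF _ \<open>0 \<le> s\<close>] cap_exponent_less_iff ereal_less_eq(3) linorder_not_less)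
      then have "ereal ?a \<le> Liminf (at_right 0) (\<lambda>r. ereal (cap_exponent \<theta> k X s r))"
        by (rule Liminf_bounded)
      also have "\<dots> \<le> ereal (s - \<theta> * (s - ?L))" using lower.profile_above[OF X \<theta>, of k s] s by simp
      finally show False using mid(1)[OF s] by simp
    qed
    then show "\<exists>a<s. \<exists>\<^sub>F r in at_right 0. phi_capacity r \<theta> s k X < r powr (- a)"
      using mid(2)[OF s] by blast
  next
    assume s: "?U < s"
    let ?a = "s - \<theta> * (s - ?U) / 2"
    have "0 \<le> s" using upper.profile_nonneg[OF X \<theta>, of k] s by linarith
    have "Limsup (at_right 0) (\<lambda>r. ereal (cap_exponent \<theta> k X s r)) \<le> ereal (s - \<theta> * (s - ?U))"
      using upper.profile_above[OF X \<theta>, of k s] s by simp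
    then have "Limsup (at_right 0) (\<lambda>r. ereal (cap_exponent \<theta> k X s r)) < ereal ?a"
      using mid(1)[OF s] by (auto intro: order_le_less_trans)
    then have "eventually (\<lambda>r. ereal (cap_exponent \<theta> k X s r) < ereal ?a) (at_right 0)"
      by (rule Limsup_lessD)
    then have "\<forall>\<^sub>F r in at_right 0. phi_capacity r \<theta> s k X < r powr (- ?a)"
      using eventually_less_1
      by eventually_elim (metis C[OF _ \<open>0 \<le> s\<close>] cap_exponent_less_iff less_ereal.simps(1))
    then show "\<exists>a<s. \<forall>\<^sub>F r in at_right 0. phi_capacity r \<theta> s k X < r powr (- a)"
      using mid(2)[OF s] by blast
  next
    assume s: "0 \<le> s" "s < ?L"
    let ?a = "s + \<theta> * (?L - s) / 2"
    have "ereal (s + \<theta> * (?L - s)) \<le> Liminf (at_right 0) (\<lambda>r. ereal (cap_exponent \<theta> k X s r))"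
      using lower.profile_below[OF X \<theta> s(1), of k] s by simp
    then have "ereal ?a < Liminf (at_right 0) (\<lambda>r. ereal (cap_exponent \<theta> k X s r))"
      by (rule order_less_le_trans[rotated]) (use mid'(1)[OF s(2)] in simp)
    then have "eventually (\<lambda>r. ereal ?a < ereal (cap_exponent \<theta> k X s r)) (at_right 0)"
      by (rule less_LiminfD)
    then have "\<forall>\<^sub>F r in at_right 0. r powr (- ?a) < phi_capacity r \<theta> s k X"
      using eventually_less_1
      by eventually_elim (metis C[OF _ s(1)] cap_exponent_greater_iff less_ereal.simps(1))
    then show "\<exists>a>s. \<forall>\<^sub>F r in at_right 0. r powr (- a) < phi_capacity r \<theta> s k X"
      using mid'(2)[OF s(2)] by blast
  next
    assume s: "0 \<le> s" "s < ?U"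
    let ?a = "s + \<theta> * (?U - s) / 2"
    have "\<exists>\<^sub>F r in at_right 0. r powr (- ?a) < phi_capacity r \<theta> s k X"
    proof (rule ccontr)
      assume "\<not> ?thesis"
      then have "eventually (\<lambda>r. \<not> r powr (- ?a) < phi_capacity r \<theta> s k X) (at_right 0)"
        by (simp add: not_frequently)
      then have "eventually (\<lambda>r. ereal (cap_exponent \<theta> k X s r) \<le> ereal ?a) (at_right 0)"
        using eventually_less_1
        by eventually_elim (metis C[OF _ s(1)] cap_exponent_greater_iff ereal_less_eq(3) linorder_not_less)
      then have "Limsup (at_right 0) (\<lambda>r. ereal (cap_exponent \<theta> k X s r)) \<le> ereal ?a"
        by (rule Limsup_bounded)
      moreover have "ereal (s + \<theta> * (?U - s)) \<le> Limsup (at_right 0) (\<lambda>r. ereal (cap_exponent \<theta> k X s r))"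
        using upper.profile_below[OF X \<theta> s(1), of k] s by simp
      ultimately have "ereal (s + \<theta> * (?U - s)) \<le> ereal ?a" by (rule order_trans[rotated])
      then show False using mid'(1)[OF s(2)] by simp
    qed
    then show "\<exists>a>s. \<exists>\<^sub>F r in at_right 0. r powr (- a) < phi_capacity r \<theta> s k X"
      using mid'(2)[OF s(2)] by blast
  }
qed

subsection \<open>Potentials, projections and coverings\<close>

text \<open>
  An approximate minimiser replaces the equilibrium measure, so no weak compactness is needed: moving
  the mass \<open>t = I / 4\<close> to the point \<open>x\<close> cannot lower the energy below \<open>I\<close>, which bounds the potential
  at \<open>x\<close> from below.
\<close>

lemma near_equilibrium:
  fixes X :: "'a::euclidean_space set"
  assumes X: "bounded X" "X \<noteq> {}" and r: "0 < r" "r \<le> 1" "0 < \<theta>" "\<theta> \<le> 1" "0 \<le> s"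
  shows "\<exists>\<mu>. prob_on X \<mu> \<and> (\<forall>x\<in>closure X.
    ennreal (min_energy r \<theta> s k X / 2) \<le> (\<integral>\<^sup>+y. ennreal (phi_kernel r \<theta> s k (x - y)) \<partial>\<mu>))"
proof -
  define I where "I = min_energy r \<theta> s k X"
  have I: "0 < I" "I \<le> 1"
    unfolding I_def using min_energy_pos[OF X r] min_energy_le_1[OF X(2) r] by auto
  \<comment> \<open>The tolerance is tuned to the mass \<open>t = I / 4\<close>: the terms
    \<open>2 * t\<^sup>2\<close> and \<open>I\<^sup>2 / 8\<close> are equal and add up to
    \<open>2 * t * (I / 2)\<close>, which turns \<open>2 * t * (u - I)\<close> into
    \<open>2 * t * (u - I / 2)\<close>.\<close>
  have "I < I + I\<^sup>2 / 8" using I by simp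
  then obtain e where "e \<in> {enn2real (phi_energy r \<theta> s k \<mu>) | \<mu>. prob_on X \<mu>}" "e < I + I\<^sup>2 / 8"
    using prob_on_ex[OF X(2)] unfolding I_def min_energy_def
    by (subst (asm) cInf_less_iff[OF _ bdd_below_energies]) auto
  then obtain \<mu> where \<mu>: "prob_on X \<mu>" and e: "e = enn2real (phi_energy r \<theta> s k \<mu>)" "e < I + I\<^sup>2 / 8"
    by auto
  have sets[measurable_cong]: "sets \<mu> = sets borel" using \<mu> by (simp add: prob_on_def)
  interpret prob_space \<mu> using \<mu> by (simp add: prob_on_def)
  have E: "phi_energy r \<theta> s k \<mu> = ennreal e"
    using phi_energy_le_1[OF \<mu> r, of k] e(1)
    by (metis ennreal_enn2real ennreal_one_less_top order_le_less_trans)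
  define t where "t = I / 4"
  have t: "0 < t" "t \<le> 1" using I by (auto simp: t_def)
  show ?thesis
  proof (intro exI conjI ballI)
    show "prob_on X \<mu>" by (fact \<mu>)
  next
    fix a assume a: "a \<in> closure X"
    define N where "N = (\<lambda>b. if b then return borel a else \<mu>)"
    \<comment> \<open>The convex combination of the point mass at \<open>a\<close> and
      \<open>\<mu>\<close> with weights \<open>t\<close> and \<open>1 - t\<close>, realised by
      drawing one of the two measures with a biased coin.\<close>
    define \<nu> where "\<nu> = measure_pmf (bernoulli_pmf t) \<bind> N"
    have N: "N \<in> measurable (measure_pmf (bernoulli_pmf t)) (subprob_algebra borel)"
      using prob_space_axioms prob_space_return[of a borel]
      by (auto simp: N_def space_subprob_algebra sets prob_space_imp_subprob_space split: if_splits)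
    have int: "(\<integral>\<^sup>+x. f x \<partial>\<nu>) = ennreal t * f a + ennreal (1 - t) * (\<integral>\<^sup>+x. f x \<partial>\<mu>)"
      if [measurable]: "f \<in> borel_measurable borel" for f :: "'a \<Rightarrow> ennreal"
      unfolding \<nu>_def using t
      by (subst nn_integral_bind[OF that N])
        (simp add: N_def nn_integral_return mult.commute)
    have sets\<nu>[measurable_cong]: "sets \<nu> = sets borel"
      unfolding \<nu>_def by (rule sets_bind_measurable[OF N]) simp
    have em: "emeasure \<nu> A = ennreal t * indicator A a + ennreal (1 - t) * emeasure \<mu> A"
      if [measurable]: "A \<in> sets borel" for A
      using int[of "indicator A"] by (simp add: sets\<nu> sets)
    have sp: "space \<mu> = UNIV" "space \<nu> = UNIV" using sets_eq_imp_space_eq[OF sets] sets_eq_imp_space_eq[OF sets\<nu>] by auto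
    have one: "ennreal t + ennreal (1 - t) = 1" using t by (simp flip: ennreal_plus)
    have "prob_on X \<nu>"
      unfolding prob_on_def
    proof (intro conjI sets\<nu> prob_spaceI)
      show "emeasure \<nu> (space \<nu>) = 1" using emeasure_space_1 by (simp add: em sp one)
      show "emeasure \<nu> (closure X) = 1" using \<mu> a by (simp add: em one prob_on_def)
    qed
    let ?\<phi> = "\<lambda>x. ennreal (phi_kernel r \<theta> s k x)"
    define U where "U x = (\<integral>\<^sup>+y. ?\<phi> (x - y) \<partial>\<mu>)" for x
    have Um[measurable]: "U \<in> borel_measurable borel" unfolding U_def by measurable
    have EU: "(\<integral>\<^sup>+x. U x \<partial>\<mu>) = ennreal e" using E unfolding phi_energy_def U_def .
    have "U a \<le> (\<integral>\<^sup>+y. 1 \<partial>\<mu>)"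
      unfolding U_def using phi_kernel_le_1[OF r] by (intro nn_integral_mono) auto
    then have "U a \<le> 1" by (simp add: emeasure_space_1)
    then have "U a < top" by (simp add: ennreal_one_less_top order_le_less_trans)
    then obtain u where u: "U a = ennreal u" "0 \<le> u" by (cases "U a") auto
    have "phi_energy r \<theta> s k \<nu> = (\<integral>\<^sup>+x. ennreal t * ?\<phi> (x - a) + ennreal (1 - t) * U x \<partial>\<nu>)"
      unfolding phi_energy_def U_def by (subst int) simp_all
    also have "\<dots> = ennreal t * (ennreal t * ?\<phi> (0::'a) + ennreal (1 - t) * U a) +
        ennreal (1 - t) * (ennreal t * (\<integral>\<^sup>+x. ?\<phi> (x - a) \<partial>\<mu>) + ennreal (1 - t) * (\<integral>\<^sup>+x. U x \<partial>\<mu>))"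
      by (subst int) (simp_all add: nn_integral_add nn_integral_cmult)
    also have "(\<integral>\<^sup>+x. ?\<phi> (x - a) \<partial>\<mu>) = U a"
      unfolding U_def by (subst phi_kernel_minus_commute) (rule refl)
    also have "?\<phi> (0::'a) = 1" using r by (simp add: phi_kernel_def)
    also have "ennreal t * (ennreal t * 1 + ennreal (1 - t) * U a) +
        ennreal (1 - t) * (ennreal t * U a + ennreal (1 - t) * (\<integral>\<^sup>+x. U x \<partial>\<mu>)) =
        ennreal (t * (t + (1 - t) * u) + (1 - t) * (t * u + (1 - t) * e))"
      using t u e(1) by (simp add: EU ennreal_mult ennreal_plus)
    finally have W: "phi_energy r \<theta> s k \<nu> = ennreal (t * (t + (1 - t) * u) + (1 - t) * (t * u + (1 - t) * e))" .
    have "0 \<le> t * (t + (1 - t) * u) + (1 - t) * (t * u + (1 - t) * e)"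
      using t u e(1) by simp
    then have "enn2real (phi_energy r \<theta> s k \<nu>) = t * (t + (1 - t) * u) + (1 - t) * (t * u + (1 - t) * e)"
      unfolding W by (rule enn2real_ennreal)
    with min_energy_le[OF \<open>prob_on X \<nu>\<close>, of r \<theta> s k]
    have "I \<le> t * (t + (1 - t) * u) + (1 - t) * (t * u + (1 - t) * e)" by (simp add: I_def)
    also have "\<dots> = t\<^sup>2 + 2 * t * (1 - t) * u + (1 - t)\<^sup>2 * e" by (simp add: algebra_simps power2_eq_square)
    also have "\<dots> \<le> t\<^sup>2 + 2 * t * u + (1 - t)\<^sup>2 * (I + I\<^sup>2 / 8)"
      using t u e by (intro add_mono mult_left_mono mult_right_mono) auto
    also have "(1 - t)\<^sup>2 * (I + I\<^sup>2 / 8) \<le> (1 - 2 * t + t\<^sup>2) * I + I\<^sup>2 / 8"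
      using t I mult_right_mono[of "(1 - t)\<^sup>2" 1 "I\<^sup>2 / 8", OF power_le_one[of "1 - t" 2]]
      by (simp add: power2_diff algebra_simps)
    also have "t\<^sup>2 * I \<le> t\<^sup>2" using I by (simp add: mult_left_le)
    then have "t\<^sup>2 + 2 * t * u + ((1 - 2 * t + t\<^sup>2) * I + I\<^sup>2 / 8)
      \<le> 2 * t\<^sup>2 + 2 * t * u + (1 - 2 * t) * I + I\<^sup>2 / 8" by (simp add: algebra_simps)
    finally have "0 \<le> 2 * t\<^sup>2 + 2 * t * u - 2 * t * I + I\<^sup>2 / 8" by (simp add: algebra_simps)
    also have "\<dots> = 2 * t * (u - I / 2)" by (simp add: t_def field_simps power2_eq_square)
    finally have "I / 2 \<le> u" using t by (simp add: zero_le_mult_iff)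
    then show "ennreal (min_energy r \<theta> s k X / 2) \<le> (\<integral>\<^sup>+y. ?\<phi> (a - y) \<partial>\<mu>)"
      using u by (simp add: U_def[symmetric] I_def ennreal_leI)
  qed
qed

section \<open>Orthogonal projections in terms of an orthonormal basis\<close>

lemma grassmannian_basis:
  fixes V :: "'a::euclidean_space set"
  assumes "V \<in> grassmannian k"
  obtains B where "finite B" "card B = k" "B \<subseteq> V" "\<And>b. b \<in> B \<Longrightarrow> norm b = 1"
    "\<And>b c. b \<in> B \<Longrightarrow> c \<in> B \<Longrightarrow> b \<bullet> c = (if b = c then 1 else 0)"
    "\<And>x. proj_onto V x = (\<Sum>b\<in>B. (x \<bullet> b) *\<^sub>R b)"
proof -
  have V: "subspace V" "dim V = k" using assms by (auto simp: grassmannian_def)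
  obtain B where B: "B \<subseteq> V" "pairwise orthogonal B" "\<And>x. x \<in> B \<Longrightarrow> norm x = 1"
    "independent B" "card B = dim V" "span B = V"
    using orthonormal_basis_subspace[OF V(1)] by metis
  have fin: "finite B" using B(4) by (rule independent_imp_finite)
  have ortho: "b \<bullet> c = (if b = c then 1 else 0)" if "b \<in> B" "c \<in> B" for b c
    using B(2,3) that by (auto simp: pairwise_def orthogonal_def dot_square_norm)
  have coeff: "(\<Sum>b\<in>B. a b *\<^sub>R b) \<bullet> c = a c" if "c \<in> B" for a c
  proof -
    have "(\<Sum>b\<in>B. a b *\<^sub>R b) \<bullet> c = (\<Sum>b\<in>B. if b = c then a b else 0)"
      unfolding inner_sum_left using ortho that by (intro sum.cong) auto
    then show ?thesis using fin that by simp
  qed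
  have "proj_onto V x = (\<Sum>b\<in>B. (x \<bullet> b) *\<^sub>R b)" (is "_ = ?p") for x
    unfolding proj_onto_def
  proof (rule the_equality)
    have pV: "?p \<in> V" using B(1) V(1) by (auto intro!: subspace_sum subspace_scale)
    have po: "(x - ?p) \<bullet> v = 0" if "v \<in> V" for v
    proof -
      have "v \<in> span B" using that B(6) by simp
      moreover have "orthogonal (x - ?p) b" if "b \<in> B" for b
        using coeff[OF that] by (simp add: orthogonal_def inner_diff_left)
      ultimately have "orthogonal (x - ?p) v" by (rule orthogonal_to_span)
      then show ?thesis by (simp add: orthogonal_def)
    qed
    show "?p \<in> V \<and> (\<forall>v\<in>V. (x - ?p) \<bullet> v = 0)" using pV po by auto
    fix y assume y: "y \<in> V \<and> (\<forall>v\<in>V. (x - y) \<bullet> v = 0)"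
    \<comment> \<open>The difference of two candidates lies in \<open>V\<close> and is orthogonal to
      itself, so the definite description is determined.\<close>
    then have "y - ?p \<in> V" using pV V(1) by (auto intro: subspace_diff)
    then have "(x - ?p) \<bullet> (y - ?p) - (x - y) \<bullet> (y - ?p) = 0" using y po by auto
    then have "(y - ?p) \<bullet> (y - ?p) = 0" by (simp flip: inner_diff_left)
    then show "y = ?p" by simp
  qed
  then show thesis using that[OF fin _ B(1,3)] ortho B V by auto
qed

lemma proj_onto_in:
  assumes "V \<in> grassmannian k" shows "proj_onto V x \<in> V"
proof -
  have V: "subspace V" using assms by (simp add: grassmannian_def)
  obtain B where "B \<subseteq> V" "\<And>x. proj_onto V x = (\<Sum>b\<in>B. (x \<bullet> b) *\<^sub>R b)"
    using grassmannian_basis[OF assms] by metis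
  then show ?thesis using V by (auto intro!: subspace_sum subspace_scale)
qed

lemma proj_onto_orthogonal:
  assumes "V \<in> grassmannian k" "v \<in> V" shows "(x - proj_onto V x) \<bullet> v = 0"
proof -
  have V: "subspace V" using assms by (simp add: grassmannian_def)
  obtain y z where yz: "y \<in> span V" "\<And>w. w \<in> span V \<Longrightarrow> orthogonal z w" "x = y + z"
    using orthogonal_subspace_decomp_exists[of V x] by metis
  have sV: "span V = V" using V by (simp add: span_eq_iff)
  have "proj_onto V x = y"
    unfolding proj_onto_def
  proof (rule the_equality)
    show "y \<in> V \<and> (\<forall>v\<in>V. (x - y) \<bullet> v = 0)" using yz sV by (auto simp: orthogonal_def)
    fix y' assume y': "y' \<in> V \<and> (\<forall>v\<in>V. (x - y') \<bullet> v = 0)"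
    then have "y' - y \<in> V" using yz sV V by (auto intro: subspace_diff)
    then have "(x - y) \<bullet> (y' - y) - (x - y') \<bullet> (y' - y) = 0"
      using y' yz sV by (auto simp: orthogonal_def)
    then have "(y' - y) \<bullet> (y' - y) = 0" by (simp flip: inner_diff_left)
    then show "y' = y" by simp
  qed
  then show ?thesis using yz sV assms(2) by (simp add: orthogonal_def)
qed

lemma proj_onto_linear:
  fixes V :: "'a::euclidean_space set"
  assumes "V \<in> grassmannian k" shows "linear (proj_onto V)"
proof -
  obtain B where *: "\<And>x. proj_onto V x = (\<Sum>b\<in>B. (x \<bullet> b) *\<^sub>R b)"
    using grassmannian_basis[OF assms] by metis
  show ?thesis
    by (rule linearI) (simp_all add: * inner_add_left scaleR_add_left sum.distrib scaleR_sum_right)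
qed

lemma proj_onto_norm_le:
  fixes V :: "'a::euclidean_space set"
  assumes "V \<in> grassmannian k" shows "norm (proj_onto V x) \<le> norm x"
proof -
  let ?p = "proj_onto V x"
  have "(x - ?p) \<bullet> ?p = 0" using proj_onto_orthogonal[OF assms proj_onto_in[OF assms]] .
  then have "(norm ?p)\<^sup>2 = x \<bullet> ?p" by (simp add: inner_diff_left dot_square_norm)
  also have "\<dots> \<le> norm x * norm ?p" by (rule norm_cauchy_schwarz)
  finally show ?thesis by (cases "?p = 0") (auto simp: power2_eq_square)
qed

lemma proj_onto_diff:
  fixes V :: "'a::euclidean_space set"
  assumes "V \<in> grassmannian k"
  shows "proj_onto V x - proj_onto V y = proj_onto V (x - y)"
  using linear_diff[OF proj_onto_linear[OF assms]] by metis

lemma proj_onto_fixed: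
  fixes V :: "'a::euclidean_space set"
  assumes "V \<in> grassmannian k" "x \<in> V" shows "proj_onto V x = x"
proof -
  have V: "subspace V" using assms by (simp add: grassmannian_def)
  have "x - proj_onto V x \<in> V" using proj_onto_in[OF assms(1)] assms V by (auto intro: subspace_diff)
  then have "(x - proj_onto V x) \<bullet> (x - proj_onto V x) = 0" by (rule proj_onto_orthogonal[OF assms(1)])
  then show ?thesis by simp
qed

lemma proj_onto_measurable:
  fixes V :: "'a::euclidean_space set"
  assumes "V \<in> grassmannian k" shows "proj_onto V \<in> borel_measurable borel"
  using linear_continuous_on[of "proj_onto V" UNIV] proj_onto_linear[OF assms]
  by (auto intro!: borel_measurable_continuous_onI simp: linear_conv_bounded_linear)

text \<open>A cubic grid along an orthonormal basis of \<open>V\<close> makes the exponent the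
  dimension of \<open>V\<close> and not that of the ambient space. The radius
  \<open>5 * \<rho>\<close> is the enlargement in Vitali's lemma.\<close>

lemma subspace_ball_cover:
  fixes V :: "'a::euclidean_space set"
  assumes V: "V \<in> grassmannian k" and k: "1 \<le> k" and \<sigma>: "0 < \<sigma>" "\<sigma> \<le> \<rho>" and x: "x \<in> V"
  shows "\<exists>Z. finite Z \<and> real (card Z) \<le> ((20 * real k + 3) * (\<rho> / \<sigma>)) ^ k \<and>
    V \<inter> cball x (5 * \<rho>) \<subseteq> (\<Union>z\<in>Z. cball z (\<sigma> / 2))"
proof -
  obtain B where B: "finite B" "card B = k" "B \<subseteq> V" "\<And>b. b \<in> B \<Longrightarrow> norm b = 1"
    "\<And>x. proj_onto V x = (\<Sum>b\<in>B. (x \<bullet> b) *\<^sub>R b)"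
    using grassmannian_basis[OF V] by metis
  have sV: "subspace V" using V by (simp add: grassmannian_def)
  \<comment> \<open>Rounding down to mesh \<open>h\<close> moves each of the \<open>k\<close>
    coordinates by at most \<open>h\<close>, hence the point by at most \<open>\<sigma> / 2\<close>.
    A side of the grid has \<open>2 * N + 1\<close> points, at most
    \<open>10 * \<rho> / h + 3\<close>, which gives \<open>20 * k + 3\<close> because
    \<open>\<sigma> \<le> \<rho>\<close>.\<close>
  define h where "h = \<sigma> / (2 * real k)"
  have h: "0 < h" using \<sigma> k by (simp add: h_def)
  define N where "N = \<lceil>5 * \<rho> / h\<rceil>"
  have N: "0 \<le> N" "real_of_int N \<le> 5 * \<rho> / h + 1" "5 * \<rho> / h \<le> N"
  proof -
    have "0 \<le> 5 * \<rho> / h" using \<sigma> h by simp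
    then show "0 \<le> N" unfolding N_def by (simp add: order.strict_trans1[of "-1" 0] less_le_trans[of "-1" 0])
  qed (auto simp: N_def of_int_ceiling_le_add_one)
  define G where "G n = x + (\<Sum>b\<in>B. (h * real_of_int (n b)) *\<^sub>R b)" for n
  define F where "F = PiE B (\<lambda>_. {-N..N})"
  have finF: "finite F" unfolding F_def using B by (intro finite_PiE) auto
  have "card F = nat (2 * N + 1) ^ k"
    unfolding F_def using B N by (simp add: card_PiE)
  then have "real (card (G ` F)) \<le> real (nat (2 * N + 1)) ^ k"
    using card_image_le[OF finF, of G] by (simp flip: of_nat_power)
  also have "real (nat (2 * N + 1)) = 2 * real_of_int N + 1" using N by simp
  also have "(2 * real_of_int N + 1) ^ k \<le> ((20 * real k + 3) * (\<rho> / \<sigma>)) ^ k"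
  proof (rule power_mono)
    have "2 * real_of_int N + 1 \<le> 10 * \<rho> / h + 3" using N by simp
    also have "\<dots> = 20 * real k * (\<rho> / \<sigma>) + 3" using k by (simp add: h_def)
    also have "\<dots> \<le> 20 * real k * (\<rho> / \<sigma>) + 3 * (\<rho> / \<sigma>)"
      using \<sigma> by (simp add: field_simps)
    finally show "2 * real_of_int N + 1 \<le> (20 * real k + 3) * (\<rho> / \<sigma>)" by (simp add: algebra_simps)
  qed (use N in simp)
  finally have card: "real (card (G ` F)) \<le> ((20 * real k + 3) * (\<rho> / \<sigma>)) ^ k" .
  have "y \<in> (\<Union>z\<in>G ` F. cball z (\<sigma> / 2))" if y: "y \<in> V" "dist x y \<le> 5 * \<rho>" for y
  proof -
    define n where "n = restrict (\<lambda>b. \<lfloor>((y - x) \<bullet> b) / h\<rfloor>) B"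
    have "n \<in> F" unfolding F_def
    proof (rule PiE_I)
      fix b assume b: "b \<in> B"
      have "\<bar>(y - x) \<bullet> b\<bar> \<le> norm (y - x) * norm b" by (rule Cauchy_Schwarz_ineq2)
      also have "\<dots> \<le> 5 * \<rho>" using y B(4)[OF b] by (simp add: dist_norm norm_minus_commute)
      finally have "\<bar>((y - x) \<bullet> b) / h\<bar> \<le> 5 * \<rho> / h" using h by (simp add: abs_divide divide_right_mono)
      also have "\<dots> \<le> N" by (rule N)
      finally have "- real_of_int N \<le> (y - x) \<bullet> b / h" "(y - x) \<bullet> b / h \<le> real_of_int N" by linarith+
      then have "-N \<le> \<lfloor>(y - x) \<bullet> b / h\<rfloor>" "\<lfloor>(y - x) \<bullet> b / h\<rfloor> \<le> N"
        by (simp_all add: le_floor_iff floor_le_iff)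
      then show "n b \<in> {-N..N}" unfolding n_def using b by simp
    qed (simp add: n_def)
    have yx: "y - x \<in> V" using y x sV by (auto intro: subspace_diff)
    have "y - x = (\<Sum>b\<in>B. ((y - x) \<bullet> b) *\<^sub>R b)" using proj_onto_fixed[OF V yx] B(5) by metis
    then have "y - G n = (\<Sum>b\<in>B. ((y - x) \<bullet> b) *\<^sub>R b) - (\<Sum>b\<in>B. (h * real_of_int (n b)) *\<^sub>R b)"
      unfolding G_def by (simp add: algebra_simps)
    also have "\<dots> = (\<Sum>b\<in>B. ((y - x) \<bullet> b - h * real_of_int (n b)) *\<^sub>R b)"
      by (simp add: sum_subtractf scaleR_diff_left)
    finally have "norm (y - G n) \<le> (\<Sum>b\<in>B. norm (((y - x) \<bullet> b - h * real_of_int (n b)) *\<^sub>R b))"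
      by (simp only: norm_sum)
    also have "\<dots> \<le> (\<Sum>b\<in>B. h)"
    proof (rule sum_mono)
      fix b assume b: "b \<in> B"
      define q where "q = ((y - x) \<bullet> b) / h"
      have "(y - x) \<bullet> b = h * q" "n b = \<lfloor>q\<rfloor>" using h b by (simp_all add: q_def n_def)
      then have "(y - x) \<bullet> b - h * real_of_int (n b) = h * (q - \<lfloor>q\<rfloor>)"
        by (simp add: algebra_simps)
      moreover have "0 \<le> q - \<lfloor>q\<rfloor>" "q - \<lfloor>q\<rfloor> \<le> 1" by linarith+
      ultimately show "norm (((y - x) \<bullet> b - h * real_of_int (n b)) *\<^sub>R b) \<le> h"
        using h B(4)[OF b] by (simp add: abs_mult mult_left_le)
    qed
    also have "\<dots> = \<sigma> / 2" using B k by (simp add: h_def)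
    finally have "dist (G n) y \<le> \<sigma> / 2" by (simp add: dist_norm norm_minus_commute)
    then show ?thesis using \<open>n \<in> F\<close> by auto
  qed
  then show ?thesis using finF card by (intro exI[of _ "G ` F"]) auto
qed

section \<open>From large potentials to economical covers of the projection\<close>

lemma phi_kernel_dyadic_le:
  assumes r: "0 < r" "r \<le> 1" "0 < \<theta>" "\<theta> \<le> 1" "0 \<le> s" and "norm w \<le> 2 ^ M * r"
  shows "phi_kernel r \<theta> s k w \<le>
    (\<Sum>j\<le>M. 2 powr (s + k) * phi_kernel r \<theta> s k (2 ^ j * r :: real) * indicator {..2 ^ j * r} (norm w))"
proof -
  \<comment> \<open>For the least such \<open>j\<close>, either \<open>j = 0\<close> and the
    comparison value is the maximal value 1, or \<open>w\<close> is longer than half the radius and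
    the doubling property applies.\<close>
  define j where "j = (LEAST j. norm w \<le> 2 ^ j * r)"
  have j: "norm w \<le> 2 ^ j * r" unfolding j_def by (rule LeastI, rule assms)
  have jM: "j \<le> M" unfolding j_def by (rule Least_le, rule assms)
  have "phi_kernel r \<theta> s k w \<le> 2 powr (s + k) * phi_kernel r \<theta> s k (2 ^ j * r :: real)"
  proof (cases j)
    case 0
    have "phi_kernel r \<theta> s k (r::real) = 1" using r le_powr_self[of r \<theta>]
      by (simp add: phi_kernel_eq cutoff_def)
    moreover have "1 \<le> 2 powr (s + k)" using r by (simp add: ge_one_powr_ge_zero)
    ultimately show ?thesis using phi_kernel_le_1[OF r, of k w] 0 by simp
  next
    case (Suc i)
    then have "\<not> norm w \<le> 2 ^ i * r" using not_less_Least[of i "\<lambda>j. norm w \<le> 2 ^ j * r"] by (simp add: j_def)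
    then show ?thesis using r Suc by (intro phi_kernel_doubling) auto
  qed
  also have "\<dots> = 2 powr (s + k) * phi_kernel r \<theta> s k (2 ^ j * r :: real) * indicator {..2 ^ j * r} (norm w)"
    using j by simp
  also have "\<dots> \<le> (\<Sum>j\<le>M. 2 powr (s + k) * phi_kernel r \<theta> s k (2 ^ j * r :: real) * indicator {..2 ^ j * r} (norm w))"
    using jM less_imp_le[OF phi_kernel_pos[OF r(1-4)]]
    by (intro member_le_sum) (auto intro!: mult_nonneg_nonneg)
  finally show ?thesis .
qed

lemma good_cover_mono:
  assumes "good_cover \<theta> s \<epsilon> r Y" "\<epsilon> \<le> \<epsilon>'"
  shows "good_cover \<theta> s \<epsilon>' r Y"
  using assms unfolding good_cover_def by (meson order_trans)

text \<open>The projected potential is dominated by a sum over \<open>M + 1\<close> dyadic balls of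
  kernel value times measure, and some term is at least the average. The factor \<open>Suc M\<close>
  is the source of the logarithmic loss.\<close>

lemma potential_scale:
  fixes X :: "'a::euclidean_space set"
  assumes V: "V \<in> grassmannian k" and r: "0 < r" "r \<le> 1" "0 < \<theta>" "\<theta> \<le> 1" "0 \<le> s"
    and \<mu>: "prob_on X \<mu>" and x: "x \<in> X"
    and B: "\<And>y. y \<in> closure X \<Longrightarrow> norm (x - y) \<le> 2 ^ M * r"
    and c: "ennreal c \<le> (\<integral>\<^sup>+y. ennreal (phi_kernel r \<theta> s k (x - y)) \<partial>\<mu>)"
  shows "\<exists>j\<le>M. c \<le> real (Suc M) * (2 powr (s + k) * phi_kernel r \<theta> s k (2 ^ j * r :: real) *
    measure \<mu> (proj_onto V -` cball (proj_onto V x) (2 ^ j * r)))"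
proof -
  let ?P = "proj_onto V"
  have sets[measurable_cong]: "sets \<mu> = sets borel" using \<mu> by (simp add: prob_on_def)
  interpret prob_space \<mu> using \<mu> by (simp add: prob_on_def)
  have [measurable]: "?P \<in> borel_measurable borel" by (rule proj_onto_measurable[OF V])
  have sp: "space \<mu> = UNIV" using sets_eq_imp_space_eq[OF sets] by simp
  define a where "a j = 2 powr (s + k) * phi_kernel r \<theta> s k (2 ^ j * r :: real)" for j
  have a: "0 \<le> a j" for j unfolding a_def using phi_kernel_pos[OF r(1-4), of s k "2 ^ j * r"] by simp
  define A where "A j = ?P -` cball (?P x) (2 ^ j * r)" for j
  have A[measurable]: "A j \<in> sets borel" for j
    using measurable_sets[OF \<open>?P \<in> borel_measurable borel\<close>, of "cball (?P x) (2 ^ j * r)"] by (simp add: A_def)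
  have "(\<integral>\<^sup>+y. ennreal (phi_kernel r \<theta> s k (x - y)) \<partial>\<mu>) \<le> (\<integral>\<^sup>+y. (\<Sum>j\<le>M. ennreal (a j) * indicator (A j) y) \<partial>\<mu>)"
  proof (rule nn_integral_mono_AE, use prob_on_AE[OF \<mu>] in eventually_elim)
    fix y assume y: "y \<in> closure X"
    have le: "norm (?P x - ?P y) \<le> norm (x - y)"
      using proj_onto_norm_le[OF V, of "x - y"] by (simp add: proj_onto_diff[OF V])
    have "phi_kernel r \<theta> s k (x - y) \<le> phi_kernel r \<theta> s k (?P x - ?P y)"
      by (rule phi_kernel_antimono[OF r le])
    also have "\<dots> \<le> (\<Sum>j\<le>M. a j * indicator {..2 ^ j * r} (norm (?P x - ?P y)))"
      unfolding a_def using B[OF y] le by (intro phi_kernel_dyadic_le[OF r]) simp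
    also have "\<dots> = (\<Sum>j\<le>M. a j * indicator (A j) y)"
      by (intro sum.cong) (auto simp: A_def dist_norm indicator_def)
    finally have "ennreal (phi_kernel r \<theta> s k (x - y)) \<le> ennreal (\<Sum>j\<le>M. a j * indicator (A j) y)" by (rule ennreal_leI)
    also have "\<dots> = (\<Sum>j\<le>M. ennreal (a j) * indicator (A j) y)"
      using a by (subst sum_ennreal[symmetric]) (auto intro!: sum.cong simp: indicator_def)
    finally show "ennreal (phi_kernel r \<theta> s k (x - y)) \<le> (\<Sum>j\<le>M. ennreal (a j) * indicator (A j) y)" .
  qed
  also have "\<dots> = (\<Sum>j\<le>M. ennreal (a j) * emeasure \<mu> (A j))"
    by (subst nn_integral_sum) (auto simp: nn_integral_cmult sets)
  also have "\<dots> = ennreal (\<Sum>j\<le>M. a j * measure \<mu> (A j))"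
    using a by (subst sum_ennreal[symmetric]) (auto simp: emeasure_eq_measure ennreal_mult)
  finally have "ennreal c \<le> ennreal (\<Sum>j\<le>M. a j * measure \<mu> (A j))" using c by (rule order_trans[rotated])
  then have le: "c \<le> (\<Sum>j\<le>M. a j * measure \<mu> (A j))"
    using a by (subst (asm) ennreal_le_iff) (auto intro!: sum_nonneg)
  show ?thesis
  proof (rule ccontr)
    assume neg: "\<not> ?thesis"
    have "\<not> c \<le> real (Suc M) * (a j * measure \<mu> (A j))" if "j \<le> M" for j
      using neg that unfolding a_def A_def by blast
    then have "real (Suc M) * (a j * measure \<mu> (A j)) < c" if "j \<le> M" for j
      using that by (meson not_le)
    then have "(\<Sum>j\<le>M. real (Suc M) * (a j * measure \<mu> (A j))) < (\<Sum>j\<le>M. c)"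
      by (intro sum_strict_mono) auto
    then have "real (Suc M) * (\<Sum>j\<le>M. a j * measure \<mu> (A j)) < real (Suc M) * c"
      by (simp add: sum_distrib_left)
    then show False using le by (simp add: mult_less_cancel_left_pos del: of_nat_Suc)
  qed
qed

text \<open>Cutting a ball of radius \<open>\<rho>\<close> in \<open>V\<close> into pieces of
  diameter \<open>\<sigma> = cutoff r \<theta> \<rho>\<close> costs about
  \<open>(\<rho> / \<sigma>) ^ k * \<sigma> powr s\<close>, which is \<open>r powr s\<close> divided
  by the kernel at \<open>\<rho>\<close>. At the selected radius this is at most
  \<open>K * r powr s\<close> times the projected measure of the ball, so the total cost of disjoint
  balls is controlled by total mass 1.\<close>

lemma good_cover_capacity:
  fixes X :: "'a::euclidean_space set"
  assumes X: "bounded X" "X \<noteq> {}" and V: "V \<in> grassmannian k" "1 \<le> k"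
    and r: "0 < r" "r \<le> 1" "0 < \<theta>" "\<theta> \<le> 1" "0 \<le> s"
    and M: "\<And>x y. x \<in> closure X \<Longrightarrow> y \<in> closure X \<Longrightarrow> norm (x - y) \<le> 2 ^ M * r"
  shows "good_cover \<theta> s ((20 * real k + 3) ^ k * (2 * real (Suc M) * 2 powr (s + k)) *
    (r powr s * phi_capacity r \<theta> s k X)) (r powr \<theta>) (proj_onto V ` X)"
proof -
  let ?P = "proj_onto V"
  define I where "I = min_energy r \<theta> s k X"
  have I: "0 < I" unfolding I_def by (rule min_energy_pos[OF X r])
  obtain \<mu> where \<mu>: "prob_on X \<mu>"
    and pot: "\<And>x. x \<in> closure X \<Longrightarrow> ennreal (I / 2) \<le> (\<integral>\<^sup>+y. ennreal (phi_kernel r \<theta> s k (x - y)) \<partial>\<mu>)"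
    using near_equilibrium[OF X r, of k] unfolding I_def by blast
  have sets[measurable_cong]: "sets \<mu> = sets borel" using \<mu> by (simp add: prob_on_def)
  interpret prob_space \<mu> using \<mu> by (simp add: prob_on_def)
  have Pm[measurable]: "?P \<in> borel_measurable borel" by (rule proj_onto_measurable[OF V(1)])
  define m where "m z \<rho> = measure \<mu> (?P -` cball z \<rho>)" for z \<rho>
  define A where "A = 2 powr (s + k)"
  \<comment> \<open>The factor 2 comes from the potential bound \<open>I / 2\<close>,
    \<open>Suc M\<close> from the pigeonhole over scales, and \<open>A\<close> from the doubling of
    the kernel.\<close>
  define K where "K = 2 * real (Suc M) * A / I"
  have K: "0 < K" unfolding K_def A_def using I by (auto intro!: divide_pos_pos mult_pos_pos)
  define \<sigma> where "\<sigma> \<rho> = cutoff r \<theta> \<rho>" for \<rho>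
  have "\<exists>\<rho>. r \<le> \<rho> \<and> \<rho> \<le> 2 ^ M * r \<and> (\<rho> / \<sigma> \<rho>) ^ k * \<sigma> \<rho> powr s \<le> K * r powr s * m z \<rho>"
    if z: "z \<in> ?P ` X" for z
  proof -
    obtain x where x: "x \<in> X" "z = ?P x" using z by auto
    have xc: "x \<in> closure X" using x closure_subset by blast
    obtain j where j: "j \<le> M" "I / 2 \<le> real (Suc M) * (A * phi_kernel r \<theta> s k (2 ^ j * r :: real) * m z (2 ^ j * r))"
      using potential_scale[OF V(1) r \<mu> x(1) M[OF xc] pot[OF xc]] unfolding m_def x A_def by blast
    define \<rho> where "\<rho> = 2 ^ j * r"
    have \<rho>: "r \<le> \<rho>" "\<rho> \<le> 2 ^ M * r" using r j by (auto simp: \<rho>_def mult_le_cancel_right1)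
    note c = cutoff_bounds[OF r(1-4) \<rho>(1), folded \<sigma>_def]
    have "phi_kernel r \<theta> s k \<rho> = r powr s / ((\<rho> / \<sigma> \<rho>) ^ k * \<sigma> \<rho> powr s)"
      using \<rho> r c by (simp add: phi_kernel_eq max_def \<sigma>_def[symmetric] powr_divide power_divide field_simps)
    with j(2) have "I \<le> 2 * real (Suc M) * A * m z \<rho> * (r powr s / ((\<rho> / \<sigma> \<rho>) ^ k * \<sigma> \<rho> powr s))"
      by (simp add: \<rho>_def mult_ac del: of_nat_Suc)
    moreover have "0 < (\<rho> / \<sigma> \<rho>) ^ k * \<sigma> \<rho> powr s" using \<rho> r c by (auto intro!: mult_pos_pos divide_pos_pos)
    ultimately have "(\<rho> / \<sigma> \<rho>) ^ k * \<sigma> \<rho> powr s * I \<le> 2 * real (Suc M) * A * m z \<rho> * r powr s"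
      by (simp add: pos_le_divide_eq mult_ac)
    then have "(\<rho> / \<sigma> \<rho>) ^ k * \<sigma> \<rho> powr s \<le> K * r powr s * m z \<rho>"
      using I by (simp add: K_def pos_le_divide_eq mult_ac)
    then show ?thesis using \<rho> by blast
  qed
  then obtain \<rho> where \<rho>: "\<And>z. z \<in> ?P ` X \<Longrightarrow> r \<le> \<rho> z" "\<And>z. z \<in> ?P ` X \<Longrightarrow> \<rho> z \<le> 2 ^ M * r"
    "\<And>z. z \<in> ?P ` X \<Longrightarrow> (\<rho> z / \<sigma> (\<rho> z)) ^ k * \<sigma> (\<rho> z) powr s \<le> K * r powr s * m z (\<rho> z)"
    by metis
  note c = cutoff_bounds[OF r(1-4) \<rho>(1), folded \<sigma>_def]
  have rpos: "0 < \<rho> z" if "z \<in> ?P ` X" for z using \<rho>(1)[OF that] r by simp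
  have "?P ` X \<subseteq> (\<Union>z\<in>?P ` X. cball z (\<rho> z))" using rpos by (force simp: less_imp_le)
  moreover have "0 < \<rho> z \<and> \<rho> z \<le> 2 ^ M * r" if "z \<in> ?P ` X" for z
    using rpos[OF that] \<rho>(2)[OF that] by simp
  ultimately obtain C where C: "C \<subseteq> ?P ` X"
    "pairwise (\<lambda>i j. disjnt (cball i (\<rho> i)) (cball j (\<rho> j))) C"
    "?P ` X \<subseteq> (\<Union>i\<in>C. cball i (5 * \<rho> i))"
    by (rule Vitali_covering_lemma_cballs[where a = "\<lambda>z. z"])
  have sum_m: "(\<Sum>z\<in>G. m z (\<rho> z)) \<le> 1" if "G \<subseteq> C" "finite G" for G
  proof -
    have "(\<Sum>z\<in>G. m z (\<rho> z)) = measure \<mu> (\<Union>z\<in>G. ?P -` cball z (\<rho> z))"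
      unfolding m_def
    proof (rule finite_measure_finite_Union[symmetric])
      show "disjoint_family_on (\<lambda>z. ?P -` cball z (\<rho> z)) G"
        using C(2) that unfolding disjoint_family_on_def pairwise_def disjnt_def by blast
      show "(\<lambda>z. ?P -` cball z (\<rho> z)) ` G \<subseteq> sets \<mu>"
      proof (rule image_subsetI)
        fix z
        show "?P -` cball z (\<rho> z) \<in> sets \<mu>"
          using measurable_sets[OF Pm, of "cball z (\<rho> z)"] by (simp add: sets)
      qed
    qed (use that in simp)
    also have "\<dots> \<le> 1" by simp
    finally show ?thesis .
  qed
  \<comment> \<open>Covering one selected ball costs at least \<open>r powr s\<close>, since
    \<open>\<sigma>\<close> lies between \<open>r\<close> and the radius. Hence each has mass at
    least \<open>1 / K\<close>, and at most \<open>K\<close> of them can be disjoint.\<close>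
  define l where "l = 1 / K"
  have l: "0 < l" using K by (simp add: l_def)
  have m_ge: "l \<le> m z (\<rho> z)" if "z \<in> C" for z
  proof -
    have z: "z \<in> ?P ` X" using that C by auto
    have "r powr s \<le> 1 ^ k * \<sigma> (\<rho> z) powr s"
      using c[OF z] r by (simp add: powr_mono2)
    also have "\<dots> \<le> (\<rho> z / \<sigma> (\<rho> z)) ^ k * \<sigma> (\<rho> z) powr s"
      using c[OF z] by (intro mult_right_mono power_mono) auto
    also note \<rho>(3)[OF z]
    finally have "r powr s * 1 \<le> r powr s * (K * m z (\<rho> z))" by (simp only: mult_ac mult_1_right)
    then have "1 \<le> K * m z (\<rho> z)" by (rule mult_left_le_imp_le) (use r in simp)
    then show ?thesis unfolding l_def using K by (simp only: pos_divide_le_eq mult_ac)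
  qed
  have card_le: "real (card G) * l \<le> 1" if G: "G \<subseteq> C" "finite G" for G
  proof -
    have "(\<Sum>z\<in>G. l) \<le> (\<Sum>z\<in>G. m z (\<rho> z))"
      by (rule sum_mono) (use G(1) m_ge in blast)
    then show ?thesis using sum_m[OF G] by simp
  qed
  have "finite C"
  proof (rule ccontr)
    assume "infinite C"
    then obtain G where G: "G \<subseteq> C" "finite G" "card G = nat \<lceil>1 / l\<rceil> + 1"
      using infinite_arbitrarily_large by blast
    have "1 / l < real (card G)" unfolding G(3) using real_nat_ceiling_ge[of "1 / l"] by simp
    then show False using card_le[OF G(1,2)] l by (simp add: pos_divide_less_eq)
  qed
  have "\<exists>Z. finite Z \<and> real (card Z) \<le> ((20 * real k + 3) * (\<rho> z / \<sigma> (\<rho> z))) ^ k \<and>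
    V \<inter> cball z (5 * \<rho> z) \<subseteq> (\<Union>w\<in>Z. cball w (\<sigma> (\<rho> z) / 2))" if "z \<in> C" for z
  proof (rule subspace_ball_cover[OF V])
    have z: "z \<in> ?P ` X" using that C(1) by auto
    show "0 < \<sigma> (\<rho> z)" "\<sigma> (\<rho> z) \<le> \<rho> z" using c[OF z] by auto
    show "z \<in> V" using z proj_onto_in[OF V(1)] by auto
  qed
  then obtain Z where Z: "\<And>z. z \<in> C \<Longrightarrow> finite (Z z)"
    "\<And>z. z \<in> C \<Longrightarrow> real (card (Z z)) \<le> ((20 * real k + 3) * (\<rho> z / \<sigma> (\<rho> z))) ^ k"
    "\<And>z. z \<in> C \<Longrightarrow> V \<inter> cball z (5 * \<rho> z) \<subseteq> (\<Union>w\<in>Z z. cball w (\<sigma> (\<rho> z) / 2))"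
    by metis
  \<comment> \<open>Balls of the ambient space are used, so that the diameter is exactly
    \<open>\<sigma> (\<rho> z)\<close> and the lower bound on diameters holds. Different pairs may
    give the same ball, which only decreases the sum over the image.\<close>
  define U where "U = (\<lambda>(z::'a, w::'a). cball w (\<sigma> (\<rho> z) / 2))"
  have diamU: "diameter (U (z, w)) = \<sigma> (\<rho> z)" if "z \<in> C" for z w
    using c(1)[of z] that C(1) by (auto simp: U_def)
  define S where "S = Sigma C Z"
  have "finite S" unfolding S_def using \<open>finite C\<close> Z(1) by auto
  have "(\<Sum>u\<in>U ` S. diameter u powr s) \<le> (\<Sum>p\<in>S. diameter (U p) powr s)"
    using sum_image_le[OF \<open>finite S\<close>, of "\<lambda>u. diameter u powr s" U] by (simp add: o_def)
  also have "\<dots> = (\<Sum>z\<in>C. \<Sum>w\<in>Z z. diameter (U (z, w)) powr s)"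
    unfolding S_def using \<open>finite C\<close> Z(1) by (subst sum.Sigma) (auto intro!: sum.cong)
  also have "\<dots> = (\<Sum>z\<in>C. real (card (Z z)) * \<sigma> (\<rho> z) powr s)"
    by (intro sum.cong) (simp_all add: diamU)
  also have "\<dots> \<le> (\<Sum>z\<in>C. (20 * real k + 3) ^ k * (K * r powr s * m z (\<rho> z)))"
  proof (rule sum_mono)
    fix z assume z: "z \<in> C"
    have "real (card (Z z)) * \<sigma> (\<rho> z) powr s \<le> ((20 * real k + 3) * (\<rho> z / \<sigma> (\<rho> z))) ^ k * \<sigma> (\<rho> z) powr s"
      using Z(2)[OF z] by (intro mult_right_mono) auto
    also have "\<dots> = (20 * real k + 3) ^ k * ((\<rho> z / \<sigma> (\<rho> z)) ^ k * \<sigma> (\<rho> z) powr s)"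
      unfolding power_mult_distrib by simp
    also have "\<dots> \<le> (20 * real k + 3) ^ k * (K * r powr s * m z (\<rho> z))"
      using \<rho>(3) z C by (intro mult_left_mono) auto
    finally show "real (card (Z z)) * \<sigma> (\<rho> z) powr s \<le> (20 * real k + 3) ^ k * (K * r powr s * m z (\<rho> z))" .
  qed
  also have "\<dots> = (20 * real k + 3) ^ k * (K * r powr s) * (\<Sum>z\<in>C. m z (\<rho> z))"
    by (simp only: sum_distrib_left mult.assoc)
  also have "\<dots> \<le> (20 * real k + 3) ^ k * (K * r powr s) * 1"
    using K by (intro mult_left_mono sum_m \<open>finite C\<close>) auto
  also have "\<dots> = (20 * real k + 3) ^ k * (2 * real (Suc M) * 2 powr (s + k)) * (r powr s * phi_capacity r \<theta> s k X)"
    by (simp only: K_def phi_capacity_eq I_def[symmetric] A_def mult_1_right mult_1_left divide_inverse mult_ac)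
  finally have total: "(\<Sum>u\<in>U ` S. diameter u powr s) \<le> \<dots>" .
  have "?P ` X \<subseteq> \<Union>(U ` S)"
  proof
    fix y assume y: "y \<in> ?P ` X"
    then obtain z where z: "z \<in> C" "y \<in> cball z (5 * \<rho> z)" using C(3) by auto
    then have "y \<in> V \<inter> cball z (5 * \<rho> z)" using y proj_onto_in[OF V(1)] by auto
    then obtain w where "w \<in> Z z" "y \<in> cball w (\<sigma> (\<rho> z) / 2)" using Z(3)[OF z(1)] by blast
    then show "y \<in> \<Union>(U ` S)" using z by (auto simp: U_def S_def)
  qed
  moreover have "bounded u \<and> (r powr \<theta>) powr (1 / \<theta>) \<le> diameter u \<and> diameter u \<le> r powr \<theta>" if u: "u \<in> U ` S" for u
  proof -
    obtain z w where zw: "z \<in> C" "u = U (z, w)" using u by (auto simp: S_def)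
    have z: "z \<in> ?P ` X" using zw C by auto
    have "bounded u" unfolding zw U_def by simp
    moreover have "(r powr \<theta>) powr (1 / \<theta>) = r" using r by (simp add: powr_powr)
    ultimately show ?thesis using c[OF z] by (simp add: zw diamU)
  qed
  ultimately show ?thesis
    unfolding good_cover_def using \<open>finite S\<close> total by (intro exI[of _ "U ` S"]) auto
qed

text \<open>About \<open>log 2 (B / r)\<close> dyadic scales reach from \<open>r\<close> to the size
  \<open>B\<close> of the set. The form \<open>1 - ln r\<close> stays away from 0 as
  \<open>r\<close> approaches 1, so one constant \<open>L\<close> works on the whole
  interval.\<close>

lemma good_cover_asymptotic:
  fixes X :: "'a::euclidean_space set"
  assumes X: "bounded X" "X \<noteq> {}" and V: "V \<in> grassmannian k" "1 \<le> k"
    and \<theta>: "0 < \<theta>" "\<theta> \<le> 1" and s: "0 \<le> s"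
  obtains L where "0 < L" "\<And>r. 0 < r \<Longrightarrow> r < 1 \<Longrightarrow>
    good_cover \<theta> s (L * (1 - ln r) * (r powr s * phi_capacity r \<theta> s k X)) (r powr \<theta>) (proj_onto V ` X)"
proof -
  obtain B where B: "1 \<le> B" "\<And>x y. x \<in> closure X \<Longrightarrow> y \<in> closure X \<Longrightarrow> norm (x - y) \<le> B"
    using bounded_closure_diff[OF X(1)] by blast
  define E where "E = 2 + (ln B + 1) / ln 2"
  have E: "0 < E" unfolding E_def using B by (auto intro!: add_pos_nonneg)
  define D where "D = (20 * real k + 3) ^ k * (2 * 2 powr (s + k))"
  have D: "0 < D" by (simp add: D_def add_nonneg_pos)
  show thesis
  proof (rule that[of "D * E"])
    show "0 < D * E" using D E by simp
    fix r :: real assume r: "0 < r" "r < 1"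
    define M where "M = nat \<lceil>log 2 (B / r)\<rceil>"
    have Br: "1 \<le> B / r" using B r by simp
    then have l0: "0 \<le> log 2 (B / r)" by simp
    have "log 2 (B / r) \<le> real M" unfolding M_def by (simp add: real_nat_ceiling_ge)
    then have "B / r \<le> 2 powr real M" using Br by (subst (asm) log_le_iff) auto
    then have M: "B \<le> 2 ^ M * r" using r by (simp add: powr_realpow pos_divide_le_eq)
    have "real (Suc M) \<le> log 2 (B / r) + 2" unfolding M_def using l0 by linarith
    also have "\<dots> = (ln B - ln r) / ln 2 + 2" using r B by (simp add: log_def ln_div)
    also have "\<dots> \<le> E * (1 - ln r)"
    proof -
      have "0 \<le> - ln r" "0 \<le> ln B" using r B by auto
      then have "0 \<le> ln B * - ln r" by (rule mult_nonneg_nonneg[rotated])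
      have "(ln B - ln r) \<le> (ln B + 1) * (1 - ln r)"
        using \<open>0 \<le> ln B * - ln r\<close> by (simp add: algebra_simps)
      then have "(ln B - ln r) / ln 2 \<le> (ln B + 1) * (1 - ln r) / ln 2" by (intro divide_right_mono) auto
      moreover have "2 \<le> 2 * (1 - ln r)" using \<open>0 \<le> - ln r\<close> by simp
      ultimately have "(ln B - ln r) / ln 2 + 2 \<le> (ln B + 1) * (1 - ln r) / ln 2 + 2 * (1 - ln r)" by (rule add_mono)
      also have "\<dots> = E * (1 - ln r)" by (simp only: E_def distrib_right times_divide_eq_left add.commute)
      finally show ?thesis .
    qed
    finally have SM: "real (Suc M) \<le> E * (1 - ln r)" .
    have C: "1 \<le> phi_capacity r \<theta> s k X" using phi_capacity_ge_1[OF X] r \<theta> s by simp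
    have "good_cover \<theta> s ((20 * real k + 3) ^ k * (2 * real (Suc M) * 2 powr (s + k)) *
      (r powr s * phi_capacity r \<theta> s k X)) (r powr \<theta>) (proj_onto V ` X)"
    proof (rule good_cover_capacity[OF X V])
      show "norm (x - y) \<le> 2 ^ M * r" if "x \<in> closure X" "y \<in> closure X" for x y
        using B(2)[OF that] M by linarith
    qed (use r \<theta> s in \<open>simp_all\<close>)
    moreover have "(20 * real k + 3) ^ k * (2 * real (Suc M) * 2 powr (s + k)) = D * real (Suc M)"
      by (simp only: D_def mult_ac)
    ultimately have "good_cover \<theta> s (D * real (Suc M) * (r powr s * phi_capacity r \<theta> s k X)) (r powr \<theta>) (proj_onto V ` X)"
      by (simp only:)
    then show "good_cover \<theta> s (D * E * (1 - ln r) * (r powr s * phi_capacity r \<theta> s k X)) (r powr \<theta>) (proj_onto V ` X)"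
    proof (rule good_cover_mono)
      have "D * real (Suc M) * (r powr s * phi_capacity r \<theta> s k X) \<le>
        D * (E * (1 - ln r)) * (r powr s * phi_capacity r \<theta> s k X)"
      using SM D C by (intro mult_right_mono mult_left_mono) auto
      then show "D * real (Suc M) * (r powr s * phi_capacity r \<theta> s k X) \<le>
          D * E * (1 - ln r) * (r powr s * phi_capacity r \<theta> s k X)"
        by (simp only: mult.assoc)
    qed
  qed
qed

subsection \<open>Upper bounds for every subspace\<close>

text \<open>This and \<open>upper_coverable\<close> are the conditions under the two infima, named
  so that they can be compared across exponents and across values of \<theta>.\<close>

definition lower_coverable :: "real \<Rightarrow> real \<Rightarrow> 'a::metric_space set \<Rightarrow> bool" where
  "lower_coverable \<theta> s Y \<longleftrightarrow> (\<forall>\<epsilon>>0. \<forall>r0>0. \<exists>r. 0 < r \<and> r \<le> r0 \<and> good_cover \<theta> s \<epsilon> r Y)"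

definition upper_coverable :: "real \<Rightarrow> real \<Rightarrow> 'a::metric_space set \<Rightarrow> bool" where
  "upper_coverable \<theta> s Y \<longleftrightarrow> (\<forall>\<epsilon>>0. \<exists>r0>0. \<forall>r. 0 < r \<and> r \<le> r0 \<longrightarrow> good_cover \<theta> s \<epsilon> r Y)"

lemma lower_int_dim_eq: "lower_int_dim \<theta> Y = Inf {s. 0 \<le> s \<and> lower_coverable \<theta> s Y}"
  by (simp add: lower_int_dim_def lower_coverable_def)

lemma upper_int_dim_eq: "upper_int_dim \<theta> Y = Inf {s. 0 \<le> s \<and> upper_coverable \<theta> s Y}"
  by (simp add: upper_int_dim_def upper_coverable_def)

lemma good_cover_exponent_mono:
  assumes "good_cover \<theta> s \<epsilon> r Y" "0 < r" "r \<le> 1" "s \<le> s'"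
  shows "good_cover \<theta> s' \<epsilon> r Y"
proof -
  obtain U where U: "finite U" "Y \<subseteq> \<Union>U"
    "\<And>u. u \<in> U \<Longrightarrow> bounded u \<and> r powr (1 / \<theta>) \<le> diameter u \<and> diameter u \<le> r"
    "(\<Sum>u\<in>U. diameter u powr s) \<le> \<epsilon>"
    using assms(1) unfolding good_cover_def by blast
  have "(\<Sum>u\<in>U. diameter u powr s') \<le> (\<Sum>u\<in>U. diameter u powr s)"
  proof (rule sum_mono)
    fix u assume u: "u \<in> U"
    have "0 < r powr (1 / \<theta>)" using assms by simp
    then have "0 < diameter u" "diameter u \<le> 1" using U(3)[OF u] assms by linarith+
    then show "diameter u powr s' \<le> diameter u powr s" using assms by (intro powr_mono') auto
  qed
  then show ?thesis using U unfolding good_cover_def by (intro exI[of _ U]) auto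
qed

text \<open>Decreasing \<theta> relaxes only the lower bound on the diameters. This one-sided
  monotonicity is what allows \<theta> to be replaced by a rational number below it.\<close>

lemma good_cover_theta_mono:
  assumes "good_cover \<theta> s \<epsilon> r Y" "0 < r" "r \<le> 1" "0 < q" "q \<le> \<theta>"
  shows "good_cover q s \<epsilon> r Y"
proof -
  have "r powr (1 / q) \<le> r powr (1 / \<theta>)"
    using assms by (intro powr_mono') (auto intro!: divide_left_mono)
  then show ?thesis using assms(1) unfolding good_cover_def by (meson order_trans)
qed

lemma lower_coverable_mono:
  assumes "lower_coverable \<theta> s Y" "s \<le> s'" "0 < q" "q \<le> \<theta>"
  shows "lower_coverable q s' Y"
  unfolding lower_coverable_def
proof (intro allI impI)
  fix \<epsilon> r0 :: real assume "0 < \<epsilon>" "0 < r0"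
  then obtain r where r: "0 < r" "r \<le> min r0 1" "good_cover \<theta> s \<epsilon> r Y"
    using assms(1) unfolding lower_coverable_def by (metis min_less_iff_conj zero_less_one)
  then have "good_cover q s' \<epsilon> r Y"
    using assms good_cover_exponent_mono[OF good_cover_theta_mono] by auto
  then show "\<exists>r. 0 < r \<and> r \<le> r0 \<and> good_cover q s' \<epsilon> r Y" using r by auto
qed

lemma upper_coverable_mono:
  assumes "upper_coverable \<theta> s Y" "s \<le> s'" "0 < q" "q \<le> \<theta>"
  shows "upper_coverable q s' Y"
  unfolding upper_coverable_def
proof (intro allI impI)
  fix \<epsilon> :: real assume \<epsilon>: "0 < \<epsilon>"
  obtain r0 where r0: "0 < r0" "\<forall>r. 0 < r \<and> r \<le> r0 \<longrightarrow> good_cover \<theta> s \<epsilon> r Y"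
    using assms(1)[unfolded upper_coverable_def, rule_format, OF \<epsilon>] by (elim exE conjE)
  have "good_cover q s' \<epsilon> r Y" if r: "0 < r" "r \<le> min r0 1" for r
  proof (rule good_cover_exponent_mono[OF good_cover_theta_mono])
    show "good_cover \<theta> s \<epsilon> r Y" using r0(2) r by simp
  qed (use r assms in auto)
  then show "\<exists>r0>0. \<forall>r. 0 < r \<and> r \<le> r0 \<longrightarrow> good_cover q s' \<epsilon> r Y"
    using r0(1) by (intro exI[of _ "min r0 1"]) auto
qed

lemma cover_bound_tendsto:
  fixes L b :: real
  assumes "0 < b"
  shows "((\<lambda>r. L * (1 - ln r) * r powr b) \<longlongrightarrow> 0) (at_right 0)"
  using assms by real_asymp

context
  fixes X V :: "'a::euclidean_space set" and k :: nat and \<theta> :: real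
  assumes X: "bounded X" "X \<noteq> {}" and V: "V \<in> grassmannian k" "1 \<le> k"
    and \<theta>: "0 < \<theta>" "\<theta> \<le> 1"
begin

text \<open>The capacity bound makes the cost at most
  \<open>L * (1 - ln r) * r powr (s - a)\<close>, and the positive power beats the logarithm. As an
  implication inside the eventual statement it combines with eventual as well as with frequent
  capacity bounds.\<close>

lemma good_cover_eventually:
  assumes "0 \<le> s" "a < s" "0 < \<epsilon>"
  shows "\<forall>\<^sub>F r in at_right 0. phi_capacity r \<theta> s k X < r powr (- a) \<longrightarrow>
    good_cover \<theta> s \<epsilon> (r powr \<theta>) (proj_onto V ` X)"
proof -
  obtain L where L: "0 < L" "\<And>r. 0 < r \<Longrightarrow> r < 1 \<Longrightarrow>
    good_cover \<theta> s (L * (1 - ln r) * (r powr s * phi_capacity r \<theta> s k X)) (r powr \<theta>) (proj_onto V ` X)"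
    using good_cover_asymptotic[OF X V \<theta> assms(1)] by blast
  have "0 < s - a" using assms by simp
  note order_tendstoD(2)[OF cover_bound_tendsto[OF this, of L] assms(3)]
  then show ?thesis
    using eventually_less_1
  proof eventually_elim
    case (elim r)
    show ?case
    proof
      assume C: "phi_capacity r \<theta> s k X < r powr (- a)"
      have "r powr s * phi_capacity r \<theta> s k X \<le> r powr s * r powr (- a)"
        using C by (intro mult_left_mono) auto
      also have "\<dots> = r powr (s - a)" by (simp add: powr_add[symmetric])
      finally have le: "r powr s * phi_capacity r \<theta> s k X \<le> r powr (s - a)" .
      have "ln r < 0" using elim(2) by (simp add: ln_less_zero)
      then have "0 \<le> L * (1 - ln r)" using L(1) by (simp add: zero_le_mult_iff)
      from mult_left_mono[OF le this] have "L * (1 - ln r) * (r powr s * phi_capacity r \<theta> s k X) \<le> L * (1 - ln r) * r powr (s - a)" .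
      also have "\<dots> \<le> \<epsilon>" using elim by simp
      finally show "good_cover \<theta> s \<epsilon> (r powr \<theta>) (proj_onto V ` X)"
        using elim(2) by (intro good_cover_mono[OF L(2)]) auto
    qed
  qed
qed

lemma lower_coverable_proj:
  assumes "lower_dim_profile \<theta> k X < s"
  shows "lower_coverable \<theta> s (proj_onto V ` X)"
  unfolding lower_coverable_def
proof (intro allI impI)
  fix \<epsilon> r0 :: real assume \<epsilon>: "0 < \<epsilon>" and r0: "0 < r0"
  have s: "0 \<le> s" using lower.profile_nonneg[OF X \<theta>, of k] assms by linarith
  obtain a where a: "a < s" "\<exists>\<^sub>F r in at_right 0. phi_capacity r \<theta> s k X < r powr (- a)"
    using lower_profile_less[OF X \<theta> assms] by blast
  have "((\<lambda>r::real. r powr \<theta>) \<longlongrightarrow> 0) (at_right 0)" using \<theta>(1) by real_asymp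
  from order_tendstoD(2)[OF this r0]
  have "\<forall>\<^sub>F r in at_right 0. phi_capacity r \<theta> s k X < r powr (- a) \<longrightarrow>
     0 < r powr \<theta> \<and> r powr \<theta> \<le> r0 \<and> good_cover \<theta> s \<epsilon> (r powr \<theta>) (proj_onto V ` X)"
    using good_cover_eventually[OF s a(1) \<epsilon>] eventually_less_1 by eventually_elim auto
  then have "\<exists>\<^sub>F r in at_right 0. 0 < r powr \<theta> \<and> r powr \<theta> \<le> r0 \<and> good_cover \<theta> s \<epsilon> (r powr \<theta>) (proj_onto V ` X)"
    by (rule frequently_mp) (rule a(2))
  from frequently_ex[OF this]
  show "\<exists>r. 0 < r \<and> r \<le> r0 \<and> good_cover \<theta> s \<epsilon> r (proj_onto V ` X)" by blast
qed

lemma upper_coverable_proj: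
  assumes "upper_dim_profile \<theta> k X < s"
  shows "upper_coverable \<theta> s (proj_onto V ` X)"
  unfolding upper_coverable_def
proof (intro allI impI)
  fix \<epsilon> :: real assume \<epsilon>: "0 < \<epsilon>"
  have s: "0 \<le> s" using upper.profile_nonneg[OF X \<theta>, of k] assms by linarith
  obtain a where a: "a < s" "\<forall>\<^sub>F r in at_right 0. phi_capacity r \<theta> s k X < r powr (- a)"
    using upper_profile_less[OF X \<theta> assms] by blast
  have "\<forall>\<^sub>F r in at_right 0. good_cover \<theta> s \<epsilon> (r powr \<theta>) (proj_onto V ` X)"
    using good_cover_eventually[OF s a(1) \<epsilon>] a(2) by eventually_elim auto
  then obtain b where b: "0 < b" "\<And>r. 0 < r \<Longrightarrow> r < b \<Longrightarrow> good_cover \<theta> s \<epsilon> (r powr \<theta>) (proj_onto V ` X)"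
    unfolding eventually_at_right_field by auto
  \<comment> \<open>Every small scale \<open>R\<close> of the definition is
    \<open>r powr \<theta>\<close> for the kernel scale
    \<open>r = R powr (1 / \<theta>)\<close>.\<close>
  have "good_cover \<theta> s \<epsilon> R (proj_onto V ` X)" if R: "0 < R" "R \<le> (b / 2) powr \<theta>" for R
  proof -
    have "R powr (1 / \<theta>) \<le> ((b / 2) powr \<theta>) powr (1 / \<theta>)" using R \<theta> by (intro powr_mono2) auto
    also have "\<dots> < b" using \<theta> b by (simp add: powr_powr)
    finally have "good_cover \<theta> s \<epsilon> ((R powr (1 / \<theta>)) powr \<theta>) (proj_onto V ` X)" using R by (intro b(2)) auto
    then show ?thesis using R \<theta> by (simp add: powr_powr)
  qed
  then show "\<exists>r0>0. \<forall>r. 0 < r \<and> r \<le> r0 \<longrightarrow> good_cover \<theta> s \<epsilon> r (proj_onto V ` X)"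
    using b by (intro exI[of _ "(b / 2) powr \<theta>"]) auto
qed

lemma lower_int_dim_proj_le: "lower_int_dim \<theta> (proj_onto V ` X) \<le> lower_dim_profile \<theta> k X"
proof (rule dense_ge)
  fix s assume s: "lower_dim_profile \<theta> k X < s"
  then have "0 \<le> s" using lower.profile_nonneg[OF X \<theta>, of k] by linarith
  then show "lower_int_dim \<theta> (proj_onto V ` X) \<le> s"
    unfolding lower_int_dim_eq using lower_coverable_proj[OF s]
    by (intro cInf_lower bdd_belowI[of _ 0]) auto
qed

lemma upper_int_dim_proj_le: "upper_int_dim \<theta> (proj_onto V ` X) \<le> upper_dim_profile \<theta> k X"
proof (rule dense_ge)
  fix s assume s: "upper_dim_profile \<theta> k X < s"
  then have "0 \<le> s" using upper.profile_nonneg[OF X \<theta>, of k] by linarith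
  then show "upper_int_dim \<theta> (proj_onto V ` X) \<le> s"
    unfolding upper_int_dim_eq using upper_coverable_proj[OF s]
    by (intro cInf_lower bdd_belowI[of _ 0]) auto
qed

text \<open>A lower bound for the infimum presupposes that some exponent is admissible; any exponent
  above the profile is, by the upper bound already obtained.\<close>

lemma lower_int_dim_proj_ge:
  assumes "\<And>s. 0 \<le> s \<Longrightarrow> lower_coverable \<theta> s (proj_onto V ` X) \<Longrightarrow> D \<le> s"
  shows "D \<le> lower_int_dim \<theta> (proj_onto V ` X)"
  unfolding lower_int_dim_eq
proof (rule cInf_greatest)
  have "lower_coverable \<theta> (lower_dim_profile \<theta> k X + 1) (proj_onto V ` X)"
    by (rule lower_coverable_proj) simp
  moreover have "0 \<le> lower_dim_profile \<theta> k X + 1" using lower.profile_nonneg[OF X \<theta>, of k] by linarith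
  ultimately show "{s. 0 \<le> s \<and> lower_coverable \<theta> s (proj_onto V ` X)} \<noteq> {}" by blast
qed (use assms in auto)

lemma upper_int_dim_proj_ge:
  assumes "\<And>s. 0 \<le> s \<Longrightarrow> upper_coverable \<theta> s (proj_onto V ` X) \<Longrightarrow> D \<le> s"
  shows "D \<le> upper_int_dim \<theta> (proj_onto V ` X)"
  unfolding upper_int_dim_eq
proof (rule cInf_greatest)
  have "upper_coverable \<theta> (upper_dim_profile \<theta> k X + 1) (proj_onto V ` X)"
    by (rule upper_coverable_proj) simp
  moreover have "0 \<le> upper_dim_profile \<theta> k X + 1" using upper.profile_nonneg[OF X \<theta>, of k] by linarith
  ultimately show "{s. 0 \<le> s \<and> upper_coverable \<theta> s (proj_onto V ` X)} \<noteq> {}" by blast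
qed (use assms in auto)

end

subsection \<open>The invariant measure on the Grassmannian\<close>

lemma proj_onto_eqI:
  fixes V :: "'a::euclidean_space set"
  assumes V: "V \<in> grassmannian k" and y: "y \<in> V" "\<And>v. v \<in> V \<Longrightarrow> (x - y) \<bullet> v = 0"
  shows "proj_onto V x = y"
proof -
  have "y - proj_onto V x \<in> V"
    using proj_onto_in[OF V] y V by (auto simp: grassmannian_def intro: subspace_diff)
  then have "(x - proj_onto V x) \<bullet> (y - proj_onto V x) - (x - y) \<bullet> (y - proj_onto V x) = 0"
    using y proj_onto_orthogonal[OF V] by simp
  then have "(y - proj_onto V x) \<bullet> (y - proj_onto V x) = 0" by (simp flip: inner_diff_left)
  then show ?thesis by simp
qed

lemma orthogonal_image_grassmannian:
  fixes V :: "'a::euclidean_space set"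
  assumes f: "orthogonal_transformation f" and V: "V \<in> grassmannian k"
  shows "f ` V \<in> grassmannian k" "proj_onto (f ` V) (f x) = f (proj_onto V x)"
proof -
  have lin: "linear f" using f by (rule orthogonal_transformation_linear)
  have "inj f" using f by (rule orthogonal_transformation_inj)
  then have "dim (f ` V) = dim V"
    using lin by (intro dim_image_eq) (auto intro: inj_on_subset)
  then show fV: "f ` V \<in> grassmannian k"
    using V lin by (auto simp: grassmannian_def intro: linear_subspace_image)
  show "proj_onto (f ` V) (f x) = f (proj_onto V x)"
  proof (rule proj_onto_eqI[OF fV])
    show "f (proj_onto V x) \<in> f ` V" using proj_onto_in[OF V] by blast
    fix w assume "w \<in> f ` V"
    then obtain v where v: "v \<in> V" "w = f v" by blast
    have "(f x - f (proj_onto V x)) \<bullet> w = f (x - proj_onto V x) \<bullet> f v"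
      using v linear_diff[OF lin] by simp
    also have "\<dots> = (x - proj_onto V x) \<bullet> v" using f by (simp add: orthogonal_transformation_def)
    finally show "(f x - f (proj_onto V x)) \<bullet> w = 0" using proj_onto_orthogonal[OF V v(1)] by simp
  qed
qed

text \<open>For \<open>a \<noteq> b\<close> the map is the reflection in the hyperplane orthogonal
  to \<open>a - b\<close>; it exchanges two vectors of equal norm.\<close>

lemma orthogonal_transformation_between:
  fixes a b :: "'a::euclidean_space"
  assumes "norm a = norm b"
  obtains f where "orthogonal_transformation f" "f a = b"
proof (cases "a = b")
  case True
  then show thesis using that[of "\<lambda>x. x"] orthogonal_transformation_id by auto
next
  case False
  define u where "u = a - b"
  define f where "f x = x - (2 * (x \<bullet> u) / (u \<bullet> u)) *\<^sub>R u" for x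
  have u: "u \<bullet> u \<noteq> 0" using False by (simp add: u_def)
  have "linear f"
    unfolding f_def
    by (rule linearI) (simp_all add: inner_add_left algebra_simps add_divide_distrib)
  moreover have "f v \<bullet> f w = v \<bullet> w" for v w
  proof -
    define c d where "c = 2 * (v \<bullet> u) / (u \<bullet> u)" and "d = 2 * (w \<bullet> u) / (u \<bullet> u)"
    have "f v \<bullet> f w = v \<bullet> w - d * (v \<bullet> u) - c * (w \<bullet> u) + c * d * (u \<bullet> u)"
    proof -
      have "f v = v - c *\<^sub>R u" "f w = w - d *\<^sub>R u" by (simp_all add: f_def c_def d_def)
      then show ?thesis by (simp add: inner_diff_left inner_diff_right inner_commute[of u w] right_diff_distrib)
    qed
    moreover have "c * (u \<bullet> u) = 2 * (v \<bullet> u)" "d * (u \<bullet> u) = 2 * (w \<bullet> u)"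
      using u by (simp_all add: c_def d_def)
    then have "2 * (c * d * (u \<bullet> u)) = d * (2 * (v \<bullet> u)) + c * (2 * (w \<bullet> u))"
      by (metis mult.assoc mult.commute mult_2)
    ultimately show ?thesis by linarith
  qed
  ultimately have "orthogonal_transformation f" by (simp add: orthogonal_transformation_def)
  moreover have "f a = b"
  proof -
    have "a \<bullet> a = b \<bullet> b" using assms by (simp add: dot_square_norm)
    then have "2 * (a \<bullet> u) = u \<bullet> u"
      by (simp add: u_def inner_diff_left inner_diff_right inner_commute)
    then have "2 * (a \<bullet> u) / (u \<bullet> u) = 1" using u by (metis divide_self)
    then show ?thesis unfolding f_def by (simp only: scaleR_one) (simp add: u_def)
  qed
  ultimately show thesis by (rule that)
qed

text \<open>
  The translates of the slab by a \<open>3t\<close>-grid in \<open>V\<close> are pairwise disjoint and stay in the ball of radius 2.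
\<close>

lemma slab_volume:
  fixes V :: "'a::euclidean_space set"
  assumes V: "V \<in> grassmannian k" and k: "1 \<le> k" and t: "0 < t"
  shows "emeasure lborel {y \<in> cball 0 1. norm (proj_onto V y) \<le> t} \<le>
    ennreal ((6 * t * real k) ^ k) * emeasure lborel (cball (0::'a) 2)"
proof -
  let ?P = "proj_onto V"
  define S where "S = {y \<in> cball 0 1. norm (?P y) \<le> t}"
  have [measurable]: "?P \<in> borel_measurable borel" by (rule proj_onto_measurable[OF V])
  have Sm[measurable]: "S \<in> sets borel" unfolding S_def by measurable
  have S2: "S \<subseteq> cball 0 2" by (auto simp: S_def)
  show ?thesis
  proof (cases "1 < 6 * t * real k")
    case True
    have "emeasure lborel S \<le> 1 * emeasure lborel (cball (0::'a) 2)"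
      using emeasure_mono[OF S2, of lborel] by simp
    also have "\<dots> \<le> ennreal ((6 * t * real k) ^ k) * emeasure lborel (cball (0::'a) 2)"
      using True by (intro mult_right_mono) (auto simp: one_le_power)
    finally show ?thesis unfolding S_def .
  next
    case False
    \<comment> \<open>The spacing \<open>3 * t\<close> exceeds the width \<open>2 * t\<close> of the
      slab, and coordinates up to \<open>3 * t * q = 1 / k\<close> keep the \<open>k\<close>-term
      sum within norm 1. In this case \<open>q \<ge> 2\<close>, so rounding down loses at most half
      and \<open>6 * t * k * n \<ge> 1\<close>.\<close>
    define q where "q = 1 / (3 * t * real k)"
    have tk: "0 < 3 * t * real k" using t k by simp
    have q: "2 \<le> q" using False tk by (simp add: q_def field_simps)
    define n where "n = nat \<lfloor>q\<rfloor>"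
    have n: "real n \<le> q" "q / 2 \<le> real n" using q unfolding n_def by linarith+
    obtain B where B: "finite B" "card B = k" "B \<subseteq> V" "\<And>b. b \<in> B \<Longrightarrow> norm b = 1"
      "\<And>b c. b \<in> B \<Longrightarrow> c \<in> B \<Longrightarrow> b \<bullet> c = (if b = c then 1 else 0)"
      "\<And>x. ?P x = (\<Sum>b\<in>B. (x \<bullet> b) *\<^sub>R b)"
      by (rule grassmannian_basis[OF V], (rule that; assumption))
    define F where "F = PiE B (\<lambda>_. {..<n})"
    have F: "finite F" "card F = n ^ k" unfolding F_def using B by (auto simp: card_PiE intro: finite_PiE)
    define v where "v f = (\<Sum>b\<in>B. (3 * t * real (f b)) *\<^sub>R b)" for f
    have vb: "v f \<bullet> c = 3 * t * real (f c)" if "c \<in> B" for f c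
    proof -
      have "v f \<bullet> c = (\<Sum>b\<in>B. if b = c then 3 * t * real (f b) else 0)"
        unfolding v_def inner_sum_left using B(5) that by (intro sum.cong) auto
      then show ?thesis using B that by simp
    qed
    have vnorm: "norm (v f) \<le> 1" if "f \<in> F" for f
    proof -
      have "norm (v f) \<le> (\<Sum>b\<in>B. norm ((3 * t * real (f b)) *\<^sub>R b))" unfolding v_def by (rule norm_sum)
      also have "\<dots> \<le> (\<Sum>b\<in>B. 3 * t * q)"
      proof (rule sum_mono)
        fix b assume b: "b \<in> B"
        then have "f b < n" using that by (auto simp: F_def PiE_def)
        then have "real (f b) \<le> q" using n by linarith
        then show "norm ((3 * t * real (f b)) *\<^sub>R b) \<le> 3 * t * q"
          using B(4)[OF b] t by simp
      qed
      also have "\<dots> = 1" using B(2) k t by (simp add: q_def)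
      finally show ?thesis .
    qed
    define T where "T f = (+) (v f) -` S" for f
    have Tm[measurable]: "T f \<in> sets borel" for f
      unfolding T_def using measurable_sets[of "(+) (v f)" borel borel S] by simp
    have T: "emeasure lborel (T f) = emeasure lborel S" for f
    proof -
      have "emeasure lborel S = emeasure (distr lborel borel ((+) (v f))) S" by (simp add: lborel_distr_plus)
      also have "\<dots> = emeasure lborel (T f)" by (subst emeasure_distr) (auto simp: T_def)
      finally show ?thesis by simp
    qed
    have disj: "disjoint_family_on T F"
      unfolding disjoint_family_on_def
    proof (intro ballI impI)
      fix f g assume fg: "f \<in> F" "g \<in> F" "f \<noteq> g"
      then obtain b where b: "b \<in> B" "f b \<noteq> g b" unfolding F_def by (metis PiE_ext)
      have "y \<notin> T g" if y: "y \<in> T f" for y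
      proof
        assume "y \<in> T g"
        then have *: "norm (?P (v f + y)) \<le> t" "norm (?P (v g + y)) \<le> t" using y by (auto simp: T_def S_def)
        have pb: "\<bar>w \<bullet> b\<bar> \<le> t" if "norm (?P w) \<le> t" for w
        proof -
          have "(w - ?P w) \<bullet> b = 0" using b B(3) by (intro proj_onto_orthogonal[OF V]) auto
          then have "w \<bullet> b = ?P w \<bullet> b" by (simp add: inner_diff_left)
          also have "\<bar>\<dots>\<bar> \<le> norm (?P w) * norm b" by (rule Cauchy_Schwarz_ineq2)
          finally show ?thesis using that B(4)[OF b(1)] by simp
        qed
        have "\<bar>(v f + y) \<bullet> b - (v g + y) \<bullet> b\<bar> \<le> 2 * t" using pb[OF *(1)] pb[OF *(2)] by linarith
        also have "(v f + y) \<bullet> b - (v g + y) \<bullet> b = 3 * t * (real (f b) - real (g b))"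
          using b by (simp add: inner_add_left vb algebra_simps)
        finally have "3 * t * \<bar>real (f b) - real (g b)\<bar> \<le> 2 * t" using t by (simp add: abs_mult)
        moreover have "3 * t * 1 \<le> 3 * t * \<bar>real (f b) - real (g b)\<bar>"
          using b t by (intro mult_left_mono) auto
        ultimately show False using t by simp
      qed
      then show "T f \<inter> T g = {}" by blast
    qed
    have "ennreal (real n ^ k) * emeasure lborel S = (\<Sum>f\<in>F. emeasure lborel (T f))"
      using F by (simp add: T ennreal_of_nat_eq_real_of_nat)
    also have "\<dots> = emeasure lborel (\<Union>f\<in>F. T f)"
      using F disj by (intro sum_emeasure) auto
    also have "\<dots> \<le> emeasure lborel (cball (0::'a) 2)"
    proof (rule emeasure_mono)
      show "(\<Union>f\<in>F. T f) \<subseteq> cball 0 2"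
      proof safe
        fix f y assume f: "f \<in> F" "y \<in> T f"
        then have "norm (v f + y) \<le> 1" by (simp add: T_def S_def)
        then show "y \<in> cball 0 2" using vnorm[OF f(1)] norm_diff_ineq[of y "v f"]
          by (simp add: add.commute)
      qed
    qed simp
    finally have main: "ennreal (real n ^ k) * emeasure lborel S \<le> emeasure lborel (cball (0::'a) 2)" .
    have "1 \<le> (6 * t * real k) * real n"
      using n(2) tk by (simp add: q_def field_simps)
    then have "1 \<le> ((6 * t * real k) * real n) ^ k" by (rule one_le_power)
    then have "1 * emeasure lborel S \<le> ennreal (((6 * t * real k) * real n) ^ k) * emeasure lborel S"
      by (intro mult_right_mono) auto
    also have "\<dots> = ennreal ((6 * t * real k) ^ k) * (ennreal (real n ^ k) * emeasure lborel S)"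
      using t unfolding power_mult_distrib[of "6 * t * real k"] by (simp add: ennreal_mult mult.assoc)
    also have "\<dots> \<le> ennreal ((6 * t * real k) ^ k) * emeasure lborel (cball (0::'a) 2)"
      using main by (intro mult_left_mono) auto
    finally show ?thesis unfolding S_def by simp
  qed
qed

section \<open>Borel structure of the Grassmannian and measure of slabs\<close>

context
  fixes \<gamma> :: "'a::euclidean_space set measure" and k :: nat
  assumes \<gamma>: "grassmann_measure k \<gamma>"
begin

lemma space_grassmann_measure: "space \<gamma> = grassmannian k"
proof -
  have "space \<gamma> = space (grass_borel k)"
    using \<gamma> by (intro sets_eq_imp_space_eq) (simp add: grassmann_measure_def)
  then show ?thesis by (simp add: grass_borel_def space_measure_of_conv)
qed

lemma prob_space_grassmann: "prob_space \<gamma>"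
  using \<gamma> by (simp add: grassmann_measure_def)

lemma grass_open_in_sets: "grass_open k U \<Longrightarrow> U \<in> sets \<gamma>"
proof -
  assume "grass_open k U"
  moreover have "{U. grass_open k U} \<subseteq> Pow (grassmannian k)" by (auto simp: grass_open_def)
  ultimately have "U \<in> sets (grass_borel k)" unfolding grass_borel_def by (auto simp: sets_measure_of)
  then show ?thesis using \<gamma> by (simp add: grassmann_measure_def)
qed

lemma proj_onto_measurable_grass: "(\<lambda>V. proj_onto V b) \<in> borel_measurable \<gamma>"
proof (rule borel_measurableI)
  fix S :: "'a set" assume S: "open S"
  have "grass_open k ((\<lambda>V. proj_onto V b) -` S \<inter> space \<gamma>)"
    unfolding grass_open_def
  proof (intro conjI ballI)
    fix V assume V: "V \<in> (\<lambda>V. proj_onto V b) -` S \<inter> space \<gamma>"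
    then obtain e where e: "0 < e" "ball (proj_onto V b) e \<subseteq> S" using S open_contains_ball by blast
    have Vg: "V \<in> grassmannian k" using V by (simp add: space_grassmann_measure)
    \<comment> \<open>The operator norm of the difference controls the movement of the single vector
      \<open>b\<close>. The summand 1 in the radius takes care of \<open>b = 0\<close> and makes the
      final inequality strict.\<close>
    have "W \<in> (\<lambda>V. proj_onto V b) -` S \<inter> space \<gamma>"
      if W: "W \<in> grassmannian k" "grass_dist V W < e / (norm b + 1)" for W
    proof -
      have "bounded_linear (\<lambda>x. proj_onto V x - proj_onto W x)"
        using proj_onto_linear[OF Vg] proj_onto_linear[OF W(1)]
        by (intro bounded_linear_sub) (auto simp: linear_conv_bounded_linear)
      then have "norm (proj_onto V b - proj_onto W b) \<le> grass_dist V W * norm b"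
        unfolding grass_dist_def by (rule onorm)
      also have "\<dots> \<le> e / (norm b + 1) * norm b" using W by (intro mult_right_mono) auto
      also have "\<dots> = e * (norm b / (norm b + 1))" by simp
      also have "\<dots> < e * 1"
        using e by (intro mult_strict_left_mono) (auto simp: add_nonneg_pos)
      finally have "proj_onto W b \<in> ball (proj_onto V b) e" by (simp add: dist_norm)
      then show ?thesis using e W by (auto simp: space_grassmann_measure)
    qed
    moreover have "0 < e / (norm b + 1)" using e by (simp add: add_nonneg_pos)
    ultimately show "\<exists>e>0. \<forall>W\<in>grassmannian k. grass_dist V W < e \<longrightarrow> W \<in> (\<lambda>V. proj_onto V b) -` S \<inter> space \<gamma>"
      by blast
  qed (simp add: space_grassmann_measure)
  then show "(\<lambda>V. proj_onto V b) -` S \<inter> space \<gamma> \<in> sets \<gamma>" by (rule grass_open_in_sets)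
qed

text \<open>By linearity in \<open>x\<close> the joint map is a finite combination of the maps at
  basis vectors, each depending on \<open>V\<close> alone.\<close>

lemma proj_onto_measurable_pair: "(\<lambda>(V, x). proj_onto V x) \<in> borel_measurable (\<gamma> \<Otimes>\<^sub>M borel)"
proof -
  note [measurable] = proj_onto_measurable_grass
  have eq: "proj_onto V x = (\<Sum>b\<in>Basis. (x \<bullet> b) *\<^sub>R proj_onto V b)" if "V \<in> space \<gamma>" for V x
  proof -
    have lin: "linear (proj_onto V)" using that proj_onto_linear by (simp add: space_grassmann_measure)
    have "proj_onto V x = proj_onto V (\<Sum>b\<in>Basis. (x \<bullet> b) *\<^sub>R b)" by (simp add: euclidean_representation)
    also have "\<dots> = (\<Sum>b\<in>Basis. (x \<bullet> b) *\<^sub>R proj_onto V b)"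
      by (simp add: linear_sum[OF lin] linear_cmul[OF lin])
    finally show ?thesis .
  qed
  have "(\<lambda>p. \<Sum>b\<in>Basis. (snd p \<bullet> b) *\<^sub>R proj_onto (fst p) b) \<in> borel_measurable (\<gamma> \<Otimes>\<^sub>M borel)"
    by measurable
  then show ?thesis
    by (rule measurable_cong[THEN iffD1, rotated]) (auto simp: space_pair_measure eq[symmetric])
qed

lemma proj_onto_measurable_compose [measurable (raw)]:
  assumes "f \<in> measurable M \<gamma>" "g \<in> borel_measurable M"
  shows "(\<lambda>z. proj_onto (f z) (g z)) \<in> borel_measurable M"
  using measurable_compose[OF measurable_Pair[OF assms] proj_onto_measurable_pair] by simp

lemma grassmann_slab_rotate:
  assumes "norm x = norm y"
  shows "emeasure \<gamma> {V \<in> space \<gamma>. norm (proj_onto V x) \<le> t} = emeasure \<gamma> {V \<in> space \<gamma>. norm (proj_onto V y) \<le> t}"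
proof -
  obtain f where f: "orthogonal_transformation f" "f y = x"
    using orthogonal_transformation_between[of y x] assms by metis
  let ?A = "{V \<in> space \<gamma>. norm (proj_onto V x) \<le> t}"
  have "{V \<in> space \<gamma>. f ` V \<in> ?A} = {V \<in> space \<gamma>. norm (proj_onto V y) \<le> t}"
    using orthogonal_image_grassmannian[OF f(1)] f orthogonal_transformation_norm[OF f(1)]
    by (auto simp: space_grassmann_measure)
  moreover have "?A \<in> sets \<gamma>" using proj_onto_measurable_grass by measurable
  with \<gamma> f(1) have "emeasure \<gamma> {V \<in> space \<gamma>. f ` V \<in> ?A} = emeasure \<gamma> ?A"
    unfolding grassmann_measure_def by blast
  ultimately show ?thesis by simp
qed

lemma grassmann_slab_scale:
  assumes "0 < c"
  shows "{V \<in> space \<gamma>. norm (proj_onto V (c *\<^sub>R x)) \<le> c * t} = {V \<in> space \<gamma>. norm (proj_onto V x) \<le> t}"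
proof -
  have "norm (proj_onto V (c *\<^sub>R x)) \<le> c * t \<longleftrightarrow> norm (proj_onto V x) \<le> t" if "V \<in> space \<gamma>" for V
    using assms that linear_cmul[OF proj_onto_linear[of V k]] by (simp add: space_grassmann_measure)
  then show ?thesis by blast
qed

text \<open>
  By invariance the measure of the slab depends on \<open>|x|\<close> only, so it may be averaged over \<open>x\<close> in the unit
  ball; Fubini then reduces the bound to the volume of slabs.
\<close>

lemma grassmann_slab_bound:
  assumes k: "1 \<le> k"
  shows "\<exists>c>0. \<forall>x t. x \<noteq> 0 \<longrightarrow> 0 < t \<longrightarrow>
    emeasure \<gamma> {V \<in> space \<gamma>. norm (proj_onto V x) \<le> t} \<le> ennreal (c * (t / norm x) ^ k)"
proof -
  define b1 b2 where "b1 = measure lborel (cball (0::'a) 1)" and "b2 = measure lborel (cball (0::'a) 2)"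
  have fin: "emeasure lborel (cball (0::'a) r) = ennreal (measure lborel (cball (0::'a) r))" for r
    using emeasure_lborel_cball_finite[of "0::'a" r] by (intro emeasure_eq_ennreal_measure) auto
  have b: "0 < b1" "0 < b2" unfolding b1_def b2_def by (auto simp: content_cball_pos)
  interpret prob_space \<gamma> by (rule prob_space_grassmann)
  interpret pair_sigma_finite \<gamma> "lborel :: 'a measure" ..
  show ?thesis
  proof (intro exI conjI allI impI)
    show "0 < (6 * real k) ^ k * b2 / b1" using k b by simp
    fix x :: 'a and \<rho> :: real assume x: "x \<noteq> 0" and \<rho>: "0 < \<rho>"
    define t where "t = \<rho> / norm x"
    have t: "0 < t" using x \<rho> by (simp add: t_def)
    define p where "p = emeasure \<gamma> {V \<in> space \<gamma>. norm (proj_onto V x) \<le> \<rho>}"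
    define Q where "Q = {z \<in> space (\<gamma> \<Otimes>\<^sub>M (lborel :: 'a measure)). norm (snd z) \<le> 1 \<and> norm (proj_onto (fst z) (snd z)) \<le> t}"
    have [measurable]: "(\<lambda>z. proj_onto (fst z) (snd z)) \<in> borel_measurable (\<gamma> \<Otimes>\<^sub>M (lborel :: 'a measure))"
      by (rule proj_onto_measurable_compose) measurable
    have Q: "Q \<in> sets (\<gamma> \<Otimes>\<^sub>M lborel)" unfolding Q_def by measurable
    have "p * emeasure lborel (cball (0::'a) 1) = (\<integral>\<^sup>+y. p * indicator (cball (0::'a) 1) y \<partial>lborel)"
      by (rule nn_integral_cmult_indicator[symmetric]) simp
    also have "\<dots> \<le> (\<integral>\<^sup>+y. emeasure \<gamma> ((\<lambda>V. (V, y)) -` Q) \<partial>lborel)"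
    proof (rule nn_integral_mono)
      fix y :: 'a
      have meas: "{V \<in> space \<gamma>. norm (proj_onto V y) \<le> t} \<in> sets \<gamma>" using proj_onto_measurable_grass by measurable
      show "p * indicator (cball 0 1) y \<le> emeasure \<gamma> ((\<lambda>V. (V, y)) -` Q)"
      proof (cases "y \<in> cball 0 1")
        case True
        then have eq: "(\<lambda>V. (V, y)) -` Q = {V \<in> space \<gamma>. norm (proj_onto V y) \<le> t}"
          by (auto simp: Q_def space_pair_measure)
        have "p \<le> emeasure \<gamma> {V \<in> space \<gamma>. norm (proj_onto V y) \<le> t}"
        proof (cases "y = 0")
          case True
          have "proj_onto V y = 0" if "V \<in> space \<gamma>" for V
            using that True linear_0[OF proj_onto_linear[of V k]] by (simp add: space_grassmann_measure)
          then have "{V \<in> space \<gamma>. norm (proj_onto V y) \<le> t} = space \<gamma>" using t by auto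
          then show ?thesis unfolding p_def by (metis emeasure_space_1 measure_le_1)
        next
          case False
          \<comment> \<open>Rescaling \<open>x\<close> to norm \<open>|y|\<close> turns the
            threshold into \<open>|y| * t\<close>, which is at most \<open>t\<close> in the unit
            ball; a rotation then carries the rescaled vector to \<open>y\<close>.\<close>
          define c where "c = norm y / norm x"
          have c: "0 < c" using False x by (simp add: c_def)
          have "p = emeasure \<gamma> {V \<in> space \<gamma>. norm (proj_onto V (c *\<^sub>R x)) \<le> c * \<rho>}"
            unfolding p_def grassmann_slab_scale[OF c] ..
          also have "\<dots> = emeasure \<gamma> {V \<in> space \<gamma>. norm (proj_onto V y) \<le> c * \<rho>}"
            using x by (intro grassmann_slab_rotate) (simp add: c_def)
          also have "\<dots> \<le> emeasure \<gamma> {V \<in> space \<gamma>. norm (proj_onto V y) \<le> t}"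
          proof (rule emeasure_mono[OF _ meas])
            have "c * \<rho> = norm y * t" by (simp add: c_def t_def)
            also have "\<dots> \<le> 1 * t" using t \<open>y \<in> cball 0 1\<close> by (intro mult_right_mono) auto
            finally show "{V \<in> space \<gamma>. norm (proj_onto V y) \<le> c * \<rho>} \<subseteq> {V \<in> space \<gamma>. norm (proj_onto V y) \<le> t}"
              by auto
          qed
          finally show ?thesis .
        qed
        then show ?thesis using True eq by simp
      qed simp
    qed
    also have "\<dots> = emeasure (\<gamma> \<Otimes>\<^sub>M lborel) Q" by (rule emeasure_pair_measure_alt2[OF Q, symmetric])
    also have "\<dots> = (\<integral>\<^sup>+V. emeasure lborel (Pair V -` Q) \<partial>\<gamma>)" by (rule lborel.emeasure_pair_measure_alt[OF Q])
    also have "\<dots> \<le> (\<integral>\<^sup>+V. ennreal ((6 * t * real k) ^ k) * ennreal b2 \<partial>\<gamma>)"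
    proof (rule nn_integral_mono)
      fix V assume V: "V \<in> space \<gamma>"
      then have "Pair V -` Q = {y \<in> cball 0 1. norm (proj_onto V y) \<le> t}"
        by (auto simp: Q_def space_pair_measure)
      then show "emeasure lborel (Pair V -` Q) \<le> ennreal ((6 * t * real k) ^ k) * ennreal b2"
        using slab_volume[OF _ k t, of V] V by (simp add: space_grassmann_measure fin b2_def)
    qed
    also have "\<dots> = ennreal ((6 * t * real k) ^ k * b2)"
      using t b by (simp add: emeasure_space_1 ennreal_mult)
    finally have le: "p * ennreal b1 \<le> ennreal ((6 * t * real k) ^ k * b2)" unfolding fin b1_def .
    have p: "p = ennreal (measure \<gamma> {V \<in> space \<gamma>. norm (proj_onto V x) \<le> \<rho>})" (is "_ = ennreal ?m")
      unfolding p_def by (rule emeasure_eq_measure)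
    have "ennreal (?m * b1) = p * ennreal b1" unfolding p by (rule ennreal_mult'') (use b in simp)
    with le have "ennreal (?m * b1) \<le> ennreal ((6 * t * real k) ^ k * b2)" by (simp only:)
    moreover have "0 \<le> (6 * t * real k) ^ k * b2" using t b by simp
    ultimately have "?m * b1 \<le> (6 * t * real k) ^ k * b2" by (simp only: ennreal_le_iff)
    then have "?m \<le> (6 * t * real k) ^ k * b2 / b1" using b by (simp add: pos_le_divide_eq)
    also have "(6 * t * real k) ^ k = (6 * real k) ^ k * t ^ k"
      by (simp only: power_mult_distrib mult_ac)
    also have "(6 * real k) ^ k * t ^ k * b2 / b1 = (6 * real k) ^ k * b2 / b1 * t ^ k"
      by (simp only: divide_inverse mult_ac)
    finally have "ennreal ?m \<le> ennreal ((6 * real k) ^ k * b2 / b1 * t ^ k)" by (rule ennreal_leI)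
    then show "emeasure \<gamma> {V \<in> space \<gamma>. norm (proj_onto V x) \<le> \<rho>} \<le> ennreal ((6 * real k) ^ k * b2 / b1 * (\<rho> / norm x) ^ k)"
      unfolding p[unfolded p_def] t_def .
  qed
qed

end

subsection \<open>Average energy of projections\<close>

text \<open>
  The kernel is cut off at \<open>2 * r powr \<theta>\<close> instead of \<open>r powr \<theta>\<close>, so that a kernel at a dyadic scale also
  controls the covers at all scales between it and its double.
\<close>

definition psi_kernel :: "real \<Rightarrow> real \<Rightarrow> real \<Rightarrow> 'a::real_normed_vector \<Rightarrow> real" where
  "psi_kernel r \<theta> s z = (if norm z \<le> 2 * r powr \<theta> then (r / max r (norm z)) powr s else 0)"

lemma psi_kernel_measurable [measurable]:
  "psi_kernel r \<theta> s \<in> borel_measurable (borel :: 'a::euclidean_space measure)"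
  unfolding psi_kernel_def by measurable

lemma psi_kernel_le_1:
  assumes "0 < r" "0 \<le> s"
  shows "psi_kernel r \<theta> s z \<le> 1"
  using assms by (auto simp: psi_kernel_def intro!: powr_le1)

text \<open>Take the least \<open>i\<close> with \<open>\<tau> / 2 ^ Suc i \<le> m\<close>, where
  \<open>m = max r |z|\<close>: minimality puts \<open>z\<close> in the slab of width
  \<open>\<tau> / 2 ^ i\<close>, and the defining inequality bounds the kernel there. Such an
  \<open>i\<close> exists because \<open>m \<ge> r > 0\<close>.\<close>

lemma dyadic_layer:
  fixes z :: "'a::real_normed_vector"
  assumes r: "0 < r" and s: "0 \<le> s" and \<tau>: "0 < \<tau>" "norm z \<le> \<tau>"
  shows "\<exists>i. norm z \<le> \<tau> / 2 ^ i \<and> (r / max r (norm z)) powr s \<le> (r * 2 ^ Suc i / \<tau>) powr s"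
proof -
  define m where "m = max r (norm z)"
  have m: "0 < m" "norm z \<le> m" using r by (auto simp: m_def)
  obtain N where N: "\<tau> / m < 2 ^ N" using real_arch_pow[of 2 "\<tau> / m"] by auto
  have ex: "\<tau> / 2 ^ Suc N \<le> m"
  proof -
    have "\<tau> \<le> m * 2 ^ N" using N m by (simp add: pos_divide_less_eq mult.commute)
    also have "\<dots> \<le> m * 2 ^ Suc N" using m by simp
    finally show ?thesis by (simp add: pos_divide_le_eq)
  qed
  define i where "i = (LEAST i. \<tau> / 2 ^ Suc i \<le> m)"
  have i: "\<tau> / 2 ^ Suc i \<le> m" unfolding i_def by (rule LeastI[of "\<lambda>i. \<tau> / 2 ^ Suc i \<le> m", OF ex])
  have "norm z \<le> \<tau> / 2 ^ i"
  proof (cases i)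
    case 0
    then show ?thesis using \<tau> by simp
  next
    case (Suc j)
    then have "j < (LEAST i. \<tau> / 2 ^ Suc i \<le> m)" unfolding i_def[symmetric] by simp
    then have "\<not> \<tau> / 2 ^ Suc j \<le> m" by (rule not_less_Least)
    then show ?thesis using m Suc by simp
  qed
  moreover have "(r / m) powr s \<le> (r * 2 ^ Suc i / \<tau>) powr s"
  proof (rule powr_mono2)
    have "\<tau> \<le> m * 2 ^ Suc i" using i by (simp add: pos_divide_le_eq)
    then have "r * \<tau> \<le> r * (m * 2 ^ Suc i)" using r by (intro mult_left_mono) auto
    then have "r * \<tau> \<le> (r * 2 ^ Suc i) * m" by (simp only: mult_ac)
    then show "r / m \<le> r * 2 ^ Suc i / \<tau>" using m \<tau> by (simp only: frac_le_eq divide_le_0_iff pos_divide_le_eq pos_le_divide_eq times_divide_eq_left times_divide_eq_right)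
  qed (use s r m in auto)
  ultimately show ?thesis unfolding m_def by blast
qed

lemma suminf_geometric_ennreal:
  assumes "0 \<le> D" "0 \<le> q" "q < 1"
  shows "(\<Sum>i. ennreal (D * q ^ i)) = ennreal (D / (1 - q))"
proof -
  have "(\<lambda>i. D * q ^ i) sums (D * (1 / (1 - q)))"
    using assms by (intro sums_mult geometric_sums) auto
  then have "(\<Sum>i. ennreal (D * q ^ i)) = ennreal (D * (1 / (1 - q)))"
    using assms by (intro suminf_ennreal_eq) auto
  then show ?thesis by simp
qed

context
  fixes \<gamma> :: "'a::euclidean_space set measure" and k :: nat
  assumes \<gamma>: "grassmann_measure k \<gamma>" and k: "1 \<le> k"
begin

text \<open>The projection of \<open>x\<close> is no longer than \<open>x\<close>, and the truncated
  kernel vanishes beyond \<open>2 * r powr \<theta>\<close>; hence the starting width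
  \<open>\<tau>\<close>. Layer \<open>i\<close> has weight growing like
  \<open>2 powr (i * s)\<close> and measure shrinking like \<open>2 powr (- i * k)\<close>, so the
  layers form a geometric series of ratio \<open>q < 1\<close>.\<close>

lemma psi_layer_integral:
  fixes r s c \<theta> :: real and x :: 'a
  assumes r: "0 < r" and s: "0 \<le> s" "s < real k" and x: "x \<noteq> 0" and c: "0 \<le> c"
    and slab: "\<And>t. 0 < t \<Longrightarrow> emeasure \<gamma> {V \<in> space \<gamma>. norm (proj_onto V x) \<le> t} \<le> ennreal (c * (t / norm x) ^ k)"
  defines "\<tau> \<equiv> min (norm x) (2 * r powr \<theta>)" and "q \<equiv> 2 powr (s - real k)"
  shows "(\<integral>\<^sup>+V. ennreal (psi_kernel r \<theta> s (proj_onto V x)) \<partial>\<gamma>) \<le>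
    ennreal (c * 2 powr s * (r / \<tau>) powr s * (\<tau> / norm x) ^ k / (1 - q))"
proof -
  have \<tau>: "0 < \<tau>" using r x by (simp add: \<tau>_def)
  have q: "0 \<le> q" "q < 1" using s by (auto simp: q_def powr_less_one)
  define A where "A i = (r * 2 ^ Suc i / \<tau>) powr s" for i
  define S where "S i = {V \<in> space \<gamma>. norm (proj_onto V x) \<le> \<tau> / 2 ^ i}" for i :: nat
  have Sm[measurable]: "S i \<in> sets \<gamma>" for i
    unfolding S_def using proj_onto_measurable_grass[OF \<gamma>] by measurable
  have "(\<integral>\<^sup>+V. ennreal (psi_kernel r \<theta> s (proj_onto V x)) \<partial>\<gamma>) \<le>
      (\<integral>\<^sup>+V. (\<Sum>i. ennreal (A i) * indicator (S i) V) \<partial>\<gamma>)"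
  proof (rule nn_integral_mono)
    fix V assume V: "V \<in> space \<gamma>"
    let ?z = "proj_onto V x"
    have Vg: "V \<in> grassmannian k" using V by (simp add: space_grassmann_measure[OF \<gamma>])
    show "ennreal (psi_kernel r \<theta> s ?z) \<le> (\<Sum>i. ennreal (A i) * indicator (S i) V)"
    proof (cases "norm ?z \<le> 2 * r powr \<theta>")
      case True
      then have "norm ?z \<le> \<tau>" using proj_onto_norm_le[OF Vg] by (simp add: \<tau>_def)
      then obtain i where i: "norm ?z \<le> \<tau> / 2 ^ i" "(r / max r (norm ?z)) powr s \<le> A i"
        unfolding A_def using dyadic_layer[OF r s(1) \<tau>] by blast
      define g where "g j = ennreal (A j) * indicator (S j) V" for j
      have "ennreal (psi_kernel r \<theta> s ?z) \<le> g i"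
        using i V True by (simp add: g_def psi_kernel_def S_def ennreal_leI)
      also have "g i = sum g {i}" by simp
      also have "\<dots> \<le> suminf g"
        by (rule sum_le_suminf) (auto intro: summableI)
      finally show ?thesis unfolding g_def .
    qed (simp add: psi_kernel_def)
  qed
  also have "\<dots> = (\<Sum>i. \<integral>\<^sup>+V. ennreal (A i) * indicator (S i) V \<partial>\<gamma>)"
    by (rule nn_integral_suminf) measurable
  also have "\<dots> = (\<Sum>i. ennreal (A i) * emeasure \<gamma> (S i))"
    by (simp add: nn_integral_cmult_indicator)
  also have "\<dots> \<le> (\<Sum>i. ennreal (c * 2 powr s * (r / \<tau>) powr s * (\<tau> / norm x) ^ k * q ^ i))"
  proof (rule suminf_le)
    fix i
    have "ennreal (A i) * emeasure \<gamma> (S i) \<le> ennreal (A i) * ennreal (c * (\<tau> / 2 ^ i / norm x) ^ k)"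
      unfolding S_def using \<tau> by (intro mult_left_mono slab) auto
    also have "\<dots> = ennreal (A i * (c * (\<tau> / 2 ^ i / norm x) ^ k))"
      by (rule ennreal_mult'[symmetric]) (simp add: A_def)
    also have "A i * (c * (\<tau> / 2 ^ i / norm x) ^ k) = c * 2 powr s * (r / \<tau>) powr s * (\<tau> / norm x) ^ k * q ^ i"
    proof -
      have "A i = ((r / \<tau>) * (2 * 2 ^ i)) powr s" by (simp add: A_def)
      also have "\<dots> = (r / \<tau>) powr s * (2 powr s * (2 ^ i) powr s)"
      proof -
        have "((r / \<tau>) * (2 * 2 ^ i)) powr s = (r / \<tau>) powr s * (2 * 2 ^ i) powr s"
          by (rule powr_mult; use r \<tau> in simp)
        moreover have "(2 * 2 ^ i :: real) powr s = 2 powr s * (2 ^ i) powr s"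
          by (rule powr_mult; simp)
        ultimately show ?thesis by (simp only:)
      qed
      finally have Ai: "A i = (r / \<tau>) powr s * (2 powr s * (2 ^ i) powr s)" .
      have e1: "(\<tau> / 2 ^ i / norm x) ^ k = (\<tau> / norm x) ^ k * (1 / (2 ^ i) ^ k)"
        by (simp only: divide_inverse power_mult_distrib power_inverse mult_1_left mult_ac)
      have e2: "(2 ^ i) powr s * (1 / (2 ^ i) ^ k) = q ^ i"
      proof -
        have "(2 ^ i :: real) ^ k = (2 powr real i) powr real k" by (simp add: powr_realpow)
        then have "(2 ^ i) powr s * (1 / (2 ^ i) ^ k) = 2 powr (real i * s) / 2 powr (real i * real k)"
          by (simp add: powr_realpow[symmetric] powr_powr)
        also have "\<dots> = 2 powr (real i * (s - real k))" by (simp add: powr_diff[symmetric] right_diff_distrib)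
        also have "\<dots> = q ^ i" unfolding q_def by (simp add: powr_realpow[symmetric] powr_powr mult.commute)
        finally show ?thesis .
      qed
      show ?thesis unfolding Ai e1 e2[symmetric] by (simp only: mult_ac)
    qed
    finally show "ennreal (A i) * emeasure \<gamma> (S i) \<le>
      ennreal (c * 2 powr s * (r / \<tau>) powr s * (\<tau> / norm x) ^ k * q ^ i)" .
  qed (auto intro: summableI)
  also have "\<dots> = ennreal (c * 2 powr s * (r / \<tau>) powr s * (\<tau> / norm x) ^ k / (1 - q))"
    using c \<tau> q by (intro suminf_geometric_ennreal) (auto intro!: mult_nonneg_nonneg)
  finally show ?thesis .
qed

text \<open>Outside the ball of radius \<open>r\<close> the width \<open>\<tau>\<close> is within a
  factor 2 of the cutoff, so the layer bound is a constant times the closed formula of the kernel.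
  Inside it the kernel equals 1; hence the constant \<open>max 1 b\<close>.\<close>

lemma psi_average_bound:
  assumes s: "0 \<le> s" "s < real k" and \<theta>: "0 < \<theta>" "\<theta> \<le> 1"
  shows "\<exists>a>0. \<forall>r x. 0 < r \<longrightarrow> r \<le> 1 \<longrightarrow>
    (\<integral>\<^sup>+V. ennreal (psi_kernel r \<theta> s (proj_onto V x)) \<partial>\<gamma>) \<le> ennreal (a * phi_kernel r \<theta> s k x)"
proof -
  obtain c where c: "0 < c" "\<And>x t. x \<noteq> 0 \<Longrightarrow> 0 < t \<Longrightarrow>
    emeasure \<gamma> {V \<in> space \<gamma>. norm (proj_onto V x) \<le> t} \<le> ennreal (c * (t / norm x) ^ k)"
    using grassmann_slab_bound[OF \<gamma> k] by blast
  interpret prob_space \<gamma> by (rule prob_space_grassmann[OF \<gamma>])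
  define q where "q = 2 powr (s - real k)"
  have q: "q < 1" using s by (simp add: q_def powr_less_one)
  define b where "b = c * 2 powr s * 2 ^ k / (1 - q)"
  have b: "0 < b" using c(1) q by (simp add: b_def)
  show ?thesis
  proof (intro exI conjI allI impI)
    show "0 < max 1 b" by simp
    fix r :: real and x :: 'a assume r: "0 < r" "r \<le> 1"
    have \<phi>0: "0 < phi_kernel r \<theta> s k x" by (rule phi_kernel_pos[OF r \<theta>])
    show "(\<integral>\<^sup>+V. ennreal (psi_kernel r \<theta> s (proj_onto V x)) \<partial>\<gamma>) \<le> ennreal (max 1 b * phi_kernel r \<theta> s k x)"
    proof (cases "norm x \<le> r")
      case True
      have "phi_kernel r \<theta> s k x = 1"
        using True r \<theta> le_powr_self[of r \<theta>] by (simp add: phi_kernel_eq max_def cutoff_def min_def)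
      then have "1 \<le> max 1 b * phi_kernel r \<theta> s k x" by simp
      moreover have "(\<integral>\<^sup>+V. ennreal (psi_kernel r \<theta> s (proj_onto V x)) \<partial>\<gamma>) \<le> (\<integral>\<^sup>+V. 1 \<partial>\<gamma>)"
        using psi_kernel_le_1[OF r(1) s(1)] by (intro nn_integral_mono) auto
      then have "(\<integral>\<^sup>+V. ennreal (psi_kernel r \<theta> s (proj_onto V x)) \<partial>\<gamma>) \<le> 1" by (simp add: emeasure_space_1)
      ultimately show ?thesis by (metis ennreal_leI ennreal_1 order_trans)
    next
      case False
      then have x: "x \<noteq> 0" "r < norm x" using r by auto
      define \<tau> where "\<tau> = min (norm x) (2 * r powr \<theta>)"
      define \<sigma> where "\<sigma> = cutoff r \<theta> (norm x)"
      have rx: "r \<le> norm x" using x by simp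
      note cb = cutoff_bounds[OF r \<theta> rx, folded \<sigma>_def]
      have \<sigma>\<tau>: "\<sigma> \<le> \<tau>" "\<tau> \<le> 2 * \<sigma>" using r x by (auto simp: \<sigma>_def \<tau>_def cutoff_def min_def)
      have \<phi>: "phi_kernel r \<theta> s k x = (r / \<sigma>) powr s * (\<sigma> / norm x) ^ k"
        using x by (simp add: phi_kernel_eq[OF r \<theta>] \<sigma>_def max_def)
      have 1: "(r / \<tau>) powr s \<le> (r / \<sigma>) powr s"
        using r cb \<sigma>\<tau> s by (intro powr_mono2 divide_left_mono mult_pos_pos) auto
      have "(\<tau> / norm x) ^ k \<le> (2 * \<sigma> / norm x) ^ k"
        using \<sigma>\<tau> cb x by (intro power_mono divide_right_mono) auto
      also have "\<dots> = 2 ^ k * (\<sigma> / norm x) ^ k" by (simp add: power_mult_distrib power_divide)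
      finally have 2: "(\<tau> / norm x) ^ k \<le> 2 ^ k * (\<sigma> / norm x) ^ k" .
      have "(r / \<tau>) powr s * (\<tau> / norm x) ^ k \<le> (r / \<sigma>) powr s * (2 ^ k * (\<sigma> / norm x) ^ k)"
        using 1 2 cb \<sigma>\<tau> x by (intro mult_mono) auto
      then have "c * 2 powr s / (1 - q) * ((r / \<tau>) powr s * (\<tau> / norm x) ^ k) \<le>
        c * 2 powr s / (1 - q) * ((r / \<sigma>) powr s * (2 ^ k * (\<sigma> / norm x) ^ k))"
        using c(1) q by (intro mult_left_mono) auto
      also have "\<dots> = b * phi_kernel r \<theta> s k x" unfolding b_def \<phi> by (simp only: divide_inverse mult_ac)
      also have "\<dots> \<le> max 1 b * phi_kernel r \<theta> s k x" using \<phi>0 by (intro mult_right_mono) auto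
      finally have le: "c * 2 powr s * (r / \<tau>) powr s * (\<tau> / norm x) ^ k / (1 - q) \<le> max 1 b * phi_kernel r \<theta> s k x"
        by (simp only: divide_inverse mult_ac)
      have "(\<integral>\<^sup>+V. ennreal (psi_kernel r \<theta> s (proj_onto V x)) \<partial>\<gamma>) \<le>
        ennreal (c * 2 powr s * (r / \<tau>) powr s * (\<tau> / norm x) ^ k / (1 - q))"
        unfolding \<tau>_def q_def using c x by (intro psi_layer_integral[OF r(1) s]) auto
      also have "\<dots> \<le> ennreal (max 1 b * phi_kernel r \<theta> s k x)" using le by (rule ennreal_leI)
      finally show ?thesis .
    qed
  qed
qed

end

text \<open>The energy of the image of \<open>\<mu>\<close> under the projection to
  \<open>V\<close>, written over \<open>\<mu>\<close> itself so that the measure does not vary with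
  \<open>V\<close> when the order of integration is changed.\<close>

definition proj_energy :: "real \<Rightarrow> real \<Rightarrow> real \<Rightarrow> 'a::euclidean_space measure \<Rightarrow> 'a set \<Rightarrow> ennreal" where
  "proj_energy r \<theta> s \<mu> V =
    (\<integral>\<^sup>+x. (\<integral>\<^sup>+y. ennreal (psi_kernel r \<theta> s (proj_onto V x - proj_onto V y)) \<partial>\<mu>) \<partial>\<mu>)"

lemma proj_energy_measurable:
  assumes \<gamma>: "grassmann_measure k \<gamma>" and \<mu>: "prob_on X \<mu>"
  shows "proj_energy r \<theta> s \<mu> \<in> borel_measurable \<gamma>"
proof -
  interpret prob_space \<mu> using \<mu> by (simp add: prob_on_def)
  have sets[measurable_cong]: "sets \<mu> = sets borel" using \<mu> by (simp add: prob_on_def)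
  note [measurable (raw)] = proj_onto_measurable_compose[OF \<gamma>]
  show ?thesis unfolding proj_energy_def[abs_def] by measurable
qed

lemma proj_energy_average:
  assumes \<gamma>: "grassmann_measure k \<gamma>" and \<mu>: "prob_on X \<mu>" and a: "0 < a"
    and avg: "\<And>x. (\<integral>\<^sup>+V. ennreal (psi_kernel r \<theta> s (proj_onto V x)) \<partial>\<gamma>) \<le> ennreal (a * phi_kernel r \<theta> s k x)"
  shows "(\<integral>\<^sup>+V. proj_energy r \<theta> s \<mu> V \<partial>\<gamma>) \<le> ennreal a * phi_energy r \<theta> s k \<mu>"
proof -
  interpret M: prob_space \<mu> using \<mu> by (simp add: prob_on_def)
  interpret G: prob_space \<gamma> by (rule prob_space_grassmann[OF \<gamma>])
  interpret pair_sigma_finite \<gamma> \<mu> ..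
  have sets[measurable_cong]: "sets \<mu> = sets borel" using \<mu> by (simp add: prob_on_def)
  note [measurable (raw)] = proj_onto_measurable_compose[OF \<gamma>]
  let ?f = "\<lambda>V x y. ennreal (psi_kernel r \<theta> s (proj_onto V x - proj_onto V y))"
  have "(\<integral>\<^sup>+V. proj_energy r \<theta> s \<mu> V \<partial>\<gamma>) = (\<integral>\<^sup>+x. \<integral>\<^sup>+V. \<integral>\<^sup>+y. ?f V x y \<partial>\<mu> \<partial>\<gamma> \<partial>\<mu>)"
    unfolding proj_energy_def by (rule Fubini'[symmetric]) measurable
  also have "\<dots> = (\<integral>\<^sup>+x. \<integral>\<^sup>+y. \<integral>\<^sup>+V. ?f V x y \<partial>\<gamma> \<partial>\<mu> \<partial>\<mu>)"
  proof (rule nn_integral_cong)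
    fix x assume "x \<in> space \<mu>"
    show "(\<integral>\<^sup>+V. \<integral>\<^sup>+y. ?f V x y \<partial>\<mu> \<partial>\<gamma>) = (\<integral>\<^sup>+y. \<integral>\<^sup>+V. ?f V x y \<partial>\<gamma> \<partial>\<mu>)"
      by (rule Fubini'[symmetric]) measurable
  qed
  also have "\<dots> \<le> (\<integral>\<^sup>+x. \<integral>\<^sup>+y. ennreal a * ennreal (phi_kernel r \<theta> s k (x - y)) \<partial>\<mu> \<partial>\<mu>)"
  proof (intro nn_integral_mono)
    fix x y :: 'a
    have "(\<integral>\<^sup>+V. ?f V x y \<partial>\<gamma>) = (\<integral>\<^sup>+V. ennreal (psi_kernel r \<theta> s (proj_onto V (x - y))) \<partial>\<gamma>)"
      by (intro nn_integral_cong) (simp add: space_grassmann_measure[OF \<gamma>] proj_onto_diff)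
    also have "\<dots> \<le> ennreal (a * phi_kernel r \<theta> s k (x - y))" by (rule avg)
    also have "\<dots> = ennreal a * ennreal (phi_kernel r \<theta> s k (x - y))"
      by (rule ennreal_mult') (use a in simp)
    finally show "(\<integral>\<^sup>+V. ?f V x y \<partial>\<gamma>) \<le> ennreal a * ennreal (phi_kernel r \<theta> s k (x - y))" .
  qed
  also have "\<dots> = ennreal a * phi_energy r \<theta> s k \<mu>"
    unfolding phi_energy_def by (simp add: nn_integral_cmult)
  finally show ?thesis .
qed

subsection \<open>Covers and energies\<close>

lemma sum_squares_weighted:
  fixes m w :: "nat \<Rightarrow> real"
  assumes w: "\<And>i. i < n \<Longrightarrow> 0 < w i"
  shows "(\<Sum>i<n. m i)\<^sup>2 \<le> (\<Sum>i<n. (m i)\<^sup>2 * w i) * (\<Sum>i<n. 1 / w i)"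
proof -
  have "(\<Sum>i<n. m i) = (\<Sum>i<n. (m i * sqrt (w i)) * (1 / sqrt (w i)))"
    using w by (intro sum.cong) (auto dest!: w)
  also have "\<dots>\<^sup>2 \<le> (\<Sum>i<n. (m i * sqrt (w i))\<^sup>2) * (\<Sum>i<n. (1 / sqrt (w i))\<^sup>2)"
    by (rule Cauchy_Schwarz_ineq_sum)
  also have "(\<Sum>i<n. (m i * sqrt (w i))\<^sup>2) = (\<Sum>i<n. (m i)\<^sup>2 * w i)"
    using w by (intro sum.cong) (auto simp: power_mult_distrib less_imp_le)
  also have "(\<Sum>i<n. (1 / sqrt (w i))\<^sup>2) = (\<Sum>i<n. 1 / w i)"
    using w by (intro sum.cong) (auto simp: power_divide less_imp_le)
  finally show ?thesis .
qed

text \<open>Split the mass 1 of \<open>\<mu>\<close> among disjoint parts of the cover. Two points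
  in part \<open>i\<close> project to distance at most \<open>d i\<close>, so the energy is at least
  the sum of \<open>(m i)\<^sup>2 * (r / d i) powr s\<close>, while the cover bounds the sum of
  \<open>(d i / r) powr s\<close>; Cauchy-Schwarz multiplies the two. The truncation at
  \<open>2 * r powr \<theta>\<close> admits all \<open>R \<le> 2 * r\<close>.\<close>

lemma good_cover_energy:
  fixes X :: "'a::euclidean_space set"
  assumes V: "V \<in> grassmannian k" and \<mu>: "prob_on X \<mu>" and r: "0 < r" "r \<le> R" "R \<le> 2 * r"
    and \<theta>: "0 < \<theta>" "\<theta> \<le> 1" and s: "0 \<le> s"
    and cover: "good_cover \<theta> s \<epsilon> (R powr \<theta>) (proj_onto V ` X)"
  shows "1 \<le> proj_energy r \<theta> s \<mu> V * ennreal (\<epsilon> / r powr s)"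
proof -
  let ?P = "proj_onto V"
  interpret prob_space \<mu> using \<mu> by (simp add: prob_on_def)
  have sets[measurable_cong]: "sets \<mu> = sets borel" using \<mu> by (simp add: prob_on_def)
  have sp: "space \<mu> = UNIV" using sets_eq_imp_space_eq[OF sets] by simp
  have Pm: "?P \<in> borel_measurable borel" by (rule proj_onto_measurable[OF V])
  obtain \<U> where \<U>: "finite \<U>" "?P ` X \<subseteq> \<Union>\<U>"
    "\<forall>U\<in>\<U>. bounded U \<and> (R powr \<theta>) powr (1 / \<theta>) \<le> diameter U \<and> diameter U \<le> R powr \<theta>"
    "(\<Sum>U\<in>\<U>. diameter U powr s) \<le> \<epsilon>"
    using cover unfolding good_cover_def by (elim exE conjE)
  have Rr: "(R powr \<theta>) powr (1 / \<theta>) = R" using r \<theta> by (simp add: powr_powr)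
  have R2: "R powr \<theta> \<le> 2 * r powr \<theta>"
  proof -
    have "R powr \<theta> \<le> (2 * r) powr \<theta>" using r \<theta> by (intro powr_mono2) auto
    also have "\<dots> = 2 powr \<theta> * r powr \<theta>" by (rule powr_mult; use r in simp)
    also have "\<dots> \<le> 2 * r powr \<theta>" using powr_mono[of \<theta> 1 2] \<theta> by (intro mult_right_mono) auto
    finally show ?thesis .
  qed
  define n where "n = card \<U>"
  obtain h where "bij_betw h {0..<n} \<U>" using ex_bij_betw_nat_finite[OF \<U>(1)] unfolding n_def by blast
  then have h: "bij_betw h {..<n} \<U>" by (simp add: atLeast0LessThan)
  have hU: "h i \<in> \<U>" if "i < n" for i using bij_betwE[OF h] that by simp
  define d where "d i = diameter (h i)" for i
  have d: "r \<le> d i" "d i \<le> 2 * r powr \<theta>" "bounded (h i)" if "i < n" for i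
    using \<U>(3)[rule_format, OF hU[OF that]] r R2 unfolding Rr d_def by linarith+
  \<comment> \<open>The measure lives on the closure of \<open>X\<close>, but the cover is only one
    of the projection of \<open>X\<close>. Closures of the finitely many sets cover the larger
    projection, keep their diameters, and are Borel.\<close>
  define c where "c i = closure (h i)" for i
  have cd: "dist u v \<le> d i" if "i < n" "u \<in> c i" "v \<in> c i" for i u v
    using diameter_bounded_bound[OF bounded_closure[OF d(3)[OF that(1)]]] that(2,3)
    by (simp add: c_def d_def diameter_closure[OF d(3)[OF that(1)]])
  have sum_d: "(\<Sum>i<n. d i powr s) \<le> \<epsilon>"
    using \<U>(4) sum.reindex_bij_betw[OF h, of "\<lambda>U. diameter U powr s"] by (simp add: d_def)
  define A where "A i = ?P -` (disjointed c i)" for i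
  have "range c \<subseteq> sets borel" by (auto simp: c_def)
  then have "range (disjointed c) \<subseteq> sets borel" by (rule sets.range_disjointed_sets)
  then have dm: "disjointed c i \<in> sets borel" for i by blast
  have Am: "A i \<in> sets borel" for i
    unfolding A_def using measurable_sets[OF Pm dm[of i]] by simp
  note Am[measurable]
  have disjA: "A i \<inter> A j = {}" if "i \<noteq> j" for i j
    using disjoint_family_disjointed[of c] that unfolding disjoint_family_on_def A_def by blast
  have cl: "closure X \<subseteq> (\<Union>i<n. A i)"
  proof
    fix x assume x: "x \<in> closure X"
    have cP: "continuous_on (closure X) ?P"
      using proj_onto_linear[OF V] by (intro linear_continuous_on) (simp add: linear_conv_bounded_linear)
    have "?P ` closure X \<subseteq> closure (?P ` X)"
      by (rule image_closure_subset[OF cP]) (auto intro: closure_subset[THEN subsetD])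
    also have "\<dots> \<subseteq> closure (\<Union>\<U>)" by (rule closure_mono[OF \<U>(2)])
    also have "\<dots> \<subseteq> (\<Union>U\<in>\<U>. closure U)"
    proof (rule closure_minimal)
      show "\<Union>\<U> \<subseteq> (\<Union>U\<in>\<U>. closure U)" using closure_subset by blast
      show "closed (\<Union>U\<in>\<U>. closure U)" using \<U>(1) by (intro closed_UN) auto
    qed
    finally have "?P x \<in> (\<Union>U\<in>\<U>. closure U)" using x by blast
    then obtain i where "i < n" "?P x \<in> c i"
      using bij_betw_imp_surj_on[OF h] unfolding c_def by blast
    then have "?P x \<in> (\<Union>i<n. c i)" by blast
    then have "?P x \<in> (\<Union>i<n. disjointed c i)"
      using finite_UN_disjointed_eq[of c n] by (simp add: atLeast0LessThan)
    then show "x \<in> (\<Union>i<n. A i)" unfolding A_def by blast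
  qed
  define m where "m i = measure \<mu> (A i)" for i
  have one: "(\<Sum>i<n. m i) = 1"
  proof -
    have "(\<Sum>i<n. m i) = measure \<mu> (\<Union>i<n. A i)"
      unfolding m_def
      by (rule finite_measure_finite_Union[symmetric]) (use disjA in \<open>auto simp: disjoint_family_on_def Am sets\<close>)
    moreover have "AE x in \<mu>. x \<in> (\<Union>i<n. A i)"
      using prob_on_AE[OF \<mu>] by (rule eventually_mono) (use cl in blast)
    then have "measure \<mu> (\<Union>i<n. A i) = 1"
      by (subst prob_eq_1) (auto simp: sets Am)
    ultimately show ?thesis by simp
  qed
  define w where "w i = (r / d i) powr s" for i
  have w: "0 < w i" if "i < n" for i using d(1)[OF that] r by (simp add: w_def)
  have "(\<Sum>i<n. (m i)\<^sup>2 * w i) \<ge> 0" using w by (intro sum_nonneg) (auto simp: less_imp_le)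
  have "ennreal (\<Sum>i<n. (m i)\<^sup>2 * w i) = (\<Sum>i<n. ennreal (w i) * (emeasure \<mu> (A i) * emeasure \<mu> (A i)))"
    using w by (subst sum_ennreal[symmetric])
      (auto simp: emeasure_eq_measure m_def ennreal_mult power2_eq_square less_imp_le mult.commute)
  also have "\<dots> = (\<Sum>i<n. \<integral>\<^sup>+x. \<integral>\<^sup>+y. ennreal (w i) * (indicator (A i) x * indicator (A i) y) \<partial>\<mu> \<partial>\<mu>)"
    by (intro sum.cong refl) (simp add: nn_integral_cmult nn_integral_multc Am sets mult_ac)
  also have "\<dots> = (\<integral>\<^sup>+x. (\<Sum>i<n. \<integral>\<^sup>+y. ennreal (w i) * (indicator (A i) x * indicator (A i) y) \<partial>\<mu>) \<partial>\<mu>)"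
    by (rule nn_integral_sum[symmetric]) measurable
  also have "\<dots> = (\<integral>\<^sup>+x. \<integral>\<^sup>+y. (\<Sum>i<n. ennreal (w i) * (indicator (A i) x * indicator (A i) y)) \<partial>\<mu> \<partial>\<mu>)"
    by (intro nn_integral_cong nn_integral_sum[symmetric]) measurable
  also have "\<dots> \<le> proj_energy r \<theta> s \<mu> V"
    unfolding proj_energy_def
  proof (intro nn_integral_mono)
    fix x y :: 'a
    show "(\<Sum>i<n. ennreal (w i) * (indicator (A i) x * indicator (A i) y)) \<le>
      ennreal (psi_kernel r \<theta> s (?P x - ?P y))"
    proof (cases "\<exists>i<n. x \<in> A i \<and> y \<in> A i")
      case True
      then obtain i where i: "i < n" "x \<in> A i" "y \<in> A i" by blast
      have "(\<Sum>j<n. ennreal (w j) * (indicator (A j) x * indicator (A j) y)) = (\<Sum>j<n. if j = i then ennreal (w i) else 0)"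
      proof (rule sum.cong[OF refl])
        fix j
        show "ennreal (w j) * (indicator (A j) x * indicator (A j) y) = (if j = i then ennreal (w i) else 0)"
          using i disjA[of j i] by (cases "j = i") (auto simp: indicator_def)
      qed
      also have "\<dots> = ennreal (w i)" using i by simp
      also have "\<dots> \<le> ennreal (psi_kernel r \<theta> s (?P x - ?P y))"
      proof (rule ennreal_leI)
        have "?P x \<in> c i" "?P y \<in> c i" using i disjointed_subset[of c i] unfolding A_def by auto
        then have le: "norm (?P x - ?P y) \<le> d i" using cd[OF i(1)] by (simp add: dist_norm)
        have "w i \<le> (r / max r (norm (?P x - ?P y))) powr s"
          unfolding w_def using r s le d(1)[OF i(1)] by (intro powr_mono2 divide_left_mono) auto
        moreover have "norm (?P x - ?P y) \<le> 2 * r powr \<theta>" using le d(2)[OF i(1)] by linarith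
        ultimately show "w i \<le> psi_kernel r \<theta> s (?P x - ?P y)" by (simp add: psi_kernel_def)
      qed
      finally show ?thesis .
    next
      case False
      then have "(\<Sum>i<n. ennreal (w i) * (indicator (A i) x * indicator (A i) y)) = 0"
        by (intro sum.neutral) (auto simp: indicator_def)
      then show ?thesis by (simp only: zero_le)
    qed
  qed
  finally have E: "ennreal (\<Sum>i<n. (m i)\<^sup>2 * w i) \<le> proj_energy r \<theta> s \<mu> V" .
  have "(\<Sum>i<n. 1 / w i) = (\<Sum>i<n. d i powr s / r powr s)"
  proof (rule sum.cong[OF refl])
    fix i assume "i \<in> {..<n}"
    then have "0 < d i" using d(1)[of i] r by simp
    then show "1 / w i = d i powr s / r powr s" using r by (simp add: w_def powr_divide)
  qed
  also have "\<dots> = (\<Sum>i<n. d i powr s) / r powr s" by (rule sum_divide_distrib[symmetric])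
  also have "\<dots> \<le> \<epsilon> / r powr s" using sum_d by (rule divide_right_mono) simp
  finally have W: "(\<Sum>i<n. 1 / w i) \<le> \<epsilon> / r powr s" .
  have "0 \<le> (\<Sum>i<n. 1 / w i)" using w by (intro sum_nonneg) (auto simp: less_imp_le)
  with W have \<epsilon>0: "0 \<le> \<epsilon> / r powr s" by linarith
  have "1 \<le> (\<Sum>i<n. (m i)\<^sup>2 * w i) * (\<Sum>i<n. 1 / w i)"
    using sum_squares_weighted[of n w m] w one by simp
  also have "\<dots> \<le> (\<Sum>i<n. (m i)\<^sup>2 * w i) * (\<epsilon> / r powr s)"
    using W \<open>0 \<le> (\<Sum>i<n. (m i)\<^sup>2 * w i)\<close> by (rule mult_left_mono)
  finally have "ennreal 1 \<le> ennreal ((\<Sum>i<n. (m i)\<^sup>2 * w i) * (\<epsilon> / r powr s))" by (rule ennreal_leI)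
  also have "\<dots> = ennreal (\<Sum>i<n. (m i)\<^sup>2 * w i) * ennreal (\<epsilon> / r powr s)"
    using \<epsilon>0 by (rule ennreal_mult'')
  also have "\<dots> \<le> proj_energy r \<theta> s \<mu> V * ennreal (\<epsilon> / r powr s)"
    using E by (intro mult_right_mono) auto
  finally show ?thesis by (simp only: ennreal_1)
qed

lemma energy_near_min:
  fixes X :: "'a::euclidean_space set"
  assumes X: "bounded X" "X \<noteq> {}" and r: "0 < r" "r \<le> 1" "0 < \<theta>" "\<theta> \<le> 1" "0 \<le> s"
  obtains \<mu> where "prob_on X \<mu>" "phi_energy r \<theta> s k \<mu> \<le> ennreal (2 * min_energy r \<theta> s k X)"
proof -
  define I where "I = min_energy r \<theta> s k X"
  have I: "0 < I" unfolding I_def by (rule min_energy_pos[OF X r])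
  then have "I < 2 * I" by simp
  then obtain e where "e \<in> {enn2real (phi_energy r \<theta> s k \<mu>) | \<mu>. prob_on X \<mu>}" "e < 2 * I"
    using prob_on_ex[OF X(2)] unfolding I_def min_energy_def
    by (subst (asm) cInf_less_iff[OF _ bdd_below_energies]) auto
  then obtain \<mu> where \<mu>: "prob_on X \<mu>" and e: "enn2real (phi_energy r \<theta> s k \<mu>) < 2 * I"
    by auto
  have "phi_energy r \<theta> s k \<mu> < top"
    using phi_energy_le_1[OF \<mu> r, of k] by (simp add: ennreal_one_less_top order_le_less_trans)
  then have "phi_energy r \<theta> s k \<mu> = ennreal (enn2real (phi_energy r \<theta> s k \<mu>))" by simp
  also have "\<dots> \<le> ennreal (2 * I)" using e by (intro ennreal_leI) simp
  finally show thesis using that[OF \<mu>] unfolding I_def by blast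
qed

text \<open>By Markov's inequality the projected energy at scale \<open>(1 / 2) ^ j\<close> exceeds
  the minimal one by the factor \<open>2 powr (j * \<delta>)\<close> with probability of order
  \<open>2 powr (- j * \<delta>)\<close>, which is summable. All \<open>R\<close> within a factor 2
  and all costs are quantified inside, so one null set handles a continuum of scales.\<close>

lemma AE_good_cover_bound:
  fixes X :: "'a::euclidean_space set"
  assumes X: "bounded X" "X \<noteq> {}" and \<gamma>: "grassmann_measure k \<gamma>" and k: "1 \<le> k"
    and \<theta>: "0 < \<theta>" "\<theta> \<le> 1" and s: "0 \<le> s" "s < real k" and \<delta>: "0 < \<delta>"
  shows "AE V in \<gamma>. \<forall>\<^sub>F j in sequentially. \<forall>R \<epsilon>. (1 / 2) ^ j \<le> R \<longrightarrow> R \<le> 2 * (1 / 2) ^ j \<longrightarrow>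
    good_cover \<theta> s \<epsilon> (R powr \<theta>) (proj_onto V ` X) \<longrightarrow>
    ((1 / 2) ^ j) powr (s + \<delta>) * phi_capacity ((1 / 2) ^ j) \<theta> s k X \<le> \<epsilon>"
proof -
  interpret prob_space \<gamma> by (rule prob_space_grassmann[OF \<gamma>])
  define r :: "nat \<Rightarrow> real" where "r j = (1 / 2) ^ j" for j
  have r: "0 < r j" "r j \<le> 1" for j unfolding r_def by (auto simp: power_le_one)
  define I where "I j = min_energy (r j) \<theta> s k X" for j
  have I: "0 < I j" for j unfolding I_def by (rule min_energy_pos[OF X r \<theta> s(1)])
  obtain a where a: "0 < a" "\<And>r x. 0 < r \<Longrightarrow> r \<le> 1 \<Longrightarrow>
    (\<integral>\<^sup>+V. ennreal (psi_kernel r \<theta> s (proj_onto V x)) \<partial>\<gamma>) \<le> ennreal (a * phi_kernel r \<theta> s k x)"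
    using psi_average_bound[OF \<gamma> k s \<theta>] by blast
  have "\<exists>\<mu>. prob_on X \<mu> \<and> phi_energy (r j) \<theta> s k \<mu> \<le> ennreal (2 * I j)" for j
    unfolding I_def using energy_near_min[OF X r \<theta> s(1)] by blast
  then obtain \<mu> where \<mu>: "\<And>j. prob_on X (\<mu> j)" "\<And>j. phi_energy (r j) \<theta> s k (\<mu> j) \<le> ennreal (2 * I j)"
    by metis
  define E where "E j V = proj_energy (r j) \<theta> s (\<mu> j) V" for j V
  have Em[measurable]: "E j \<in> borel_measurable \<gamma>" for j
    unfolding E_def using proj_energy_measurable[OF \<gamma> \<mu>(1)] by simp
  \<comment> \<open>The reciprocal of the energy threshold \<open>I j / r j powr \<delta>\<close>.
    Multiplied by \<open>r j powr s\<close> it becomes the lower bound for the cost of a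
    cover.\<close>
  define w where "w j = r j powr \<delta> / I j" for j
  have w: "0 < w j" for j using r[of j] I[of j] by (simp add: w_def)
  define A where "A j = {V \<in> space \<gamma>. 1 \<le> ennreal (w j) * E j V}" for j
  have Am: "A j \<in> sets \<gamma>" for j unfolding A_def by measurable
  define q where "q = (1 / 2) powr \<delta>"
  have q: "0 < q" "q < 1" using \<delta> powr_less_mono2[of \<delta> "1 / 2" 1] by (auto simp: q_def)
  have rq: "r j powr \<delta> = q ^ j" for j
    unfolding r_def q_def by (simp add: powr_realpow[symmetric] powr_powr mult.commute)
  have bound: "measure \<gamma> (A j) \<le> 2 * a * q ^ j" for j
  proof -
    have "emeasure \<gamma> (A j) \<le> ennreal (w j) * (\<integral>\<^sup>+V. E j V * indicator (space \<gamma>) V \<partial>\<gamma>)"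
      unfolding A_def by (rule nn_integral_Markov_inequality) measurable
    also have "(\<integral>\<^sup>+V. E j V * indicator (space \<gamma>) V \<partial>\<gamma>) = (\<integral>\<^sup>+V. E j V \<partial>\<gamma>)"
      by (rule nn_integral_cong) simp
    also have "(\<integral>\<^sup>+V. E j V \<partial>\<gamma>) \<le> ennreal a * phi_energy (r j) \<theta> s k (\<mu> j)"
      unfolding E_def by (rule proj_energy_average[OF \<gamma> \<mu>(1) a(1) a(2)[OF r]])
    also have "\<dots> \<le> ennreal a * ennreal (2 * I j)" by (rule mult_left_mono[OF \<mu>(2)]) simp
    also have "ennreal (w j) * (ennreal a * ennreal (2 * I j)) = ennreal (w j * (a * (2 * I j)))"
      using w[of j] a I[of j] by (simp add: ennreal_mult less_imp_le)
    also have "w j * (a * (2 * I j)) = 2 * a * q ^ j"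
      using I[of j] by (simp add: w_def rq)
    finally have "emeasure \<gamma> (A j) \<le> ennreal (2 * a * q ^ j)" by (simp add: mult_left_mono)
    then show ?thesis
      using a q by (subst (asm) emeasure_eq_measure) (simp add: ennreal_le_iff less_imp_le)
  qed
  have "summable (\<lambda>j. measure \<gamma> (A j))"
  proof (rule summable_comparison_test')
    show "summable (\<lambda>j. 2 * a * q ^ j)" using q by (intro summable_mult summable_geometric) simp
    show "norm (measure \<gamma> (A j)) \<le> 2 * a * q ^ j" if "j \<ge> 0" for j using bound[of j] by simp
  qed
  then have "AE V in \<gamma>. \<forall>\<^sub>F j in sequentially. V \<in> space \<gamma> - A j"
    by (intro borel_cantelli_AE1) (auto simp: Am emeasure_eq_measure)
  then show ?thesis
  proof (rule eventually_mono)
    fix V assume "\<forall>\<^sub>F j in sequentially. V \<in> space \<gamma> - A j"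
    then show "\<forall>\<^sub>F j in sequentially. \<forall>R \<epsilon>. (1 / 2) ^ j \<le> R \<longrightarrow> R \<le> 2 * (1 / 2) ^ j \<longrightarrow>
      good_cover \<theta> s \<epsilon> (R powr \<theta>) (proj_onto V ` X) \<longrightarrow>
      ((1 / 2) ^ j) powr (s + \<delta>) * phi_capacity ((1 / 2) ^ j) \<theta> s k X \<le> \<epsilon>"
    proof (rule eventually_mono, unfold r_def[symmetric], intro allI impI)
      fix j R \<epsilon> assume V: "V \<in> space \<gamma> - A j" and R: "r j \<le> R" "R \<le> 2 * r j"
        and cover: "good_cover \<theta> s \<epsilon> (R powr \<theta>) (proj_onto V ` X)"
      have Vg: "V \<in> grassmannian k" using V by (simp add: space_grassmann_measure[OF \<gamma>])
      have E1: "1 \<le> E j V * ennreal (\<epsilon> / r j powr s)"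
        unfolding E_def by (rule good_cover_energy[OF Vg \<mu>(1) r(1) R \<theta> s(1) cover])
      have E2: "ennreal (w j) * E j V < 1" using V by (simp add: A_def not_le)
      have "w j \<le> \<epsilon> / r j powr s"
      proof (rule ccontr)
        assume "\<not> w j \<le> \<epsilon> / r j powr s"
        then have "ennreal (\<epsilon> / r j powr s) \<le> ennreal (w j)" by (intro ennreal_leI) simp
        then have "E j V * ennreal (\<epsilon> / r j powr s) \<le> E j V * ennreal (w j)" by (rule mult_left_mono) simp
        then have "1 \<le> ennreal (w j) * E j V" using E1 by (simp add: mult.commute)
        then show False using E2 by simp
      qed
      then have "w j * r j powr s \<le> \<epsilon>" using r(1)[of j] by (simp add: pos_le_divide_eq)
      moreover have "r j powr (s + \<delta>) * phi_capacity (r j) \<theta> s k X = w j * r j powr s"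
        unfolding w_def phi_capacity_eq I_def powr_add by simp
      ultimately show "r j powr (s + \<delta>) * phi_capacity (r j) \<theta> s k X \<le> \<epsilon>" by simp
    qed
  qed
qed

subsection \<open>Lower bounds for almost every subspace\<close>

lemma dyadic_scale:
  fixes R :: real
  assumes R: "0 < R" "R \<le> (1 / 2) ^ J"
  shows "\<exists>j\<ge>J. (1 / 2) ^ j \<le> R \<and> R \<le> 2 * (1 / 2) ^ j"
proof -
  obtain N where N: "(1 / 2) ^ N < R" using real_arch_pow_inv[OF R(1), of "1 / 2"] by auto
  define j where "j = (LEAST j. (1 / 2) ^ j \<le> R)"
  have j: "(1 / 2) ^ j \<le> R" unfolding j_def by (rule LeastI[of "\<lambda>j. (1 / 2) ^ j \<le> R" N]) (use N in simp)
  have "J \<le> j"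
  proof (rule ccontr)
    assume "\<not> J \<le> j"
    then have "(1 / 2) ^ J < (1 / 2 :: real) ^ j" by (intro power_strict_decreasing) auto
    then show False using j R by linarith
  qed
  moreover have "R \<le> 2 * (1 / 2) ^ j"
  proof (cases j)
    case 0
    have "(1 / 2 :: real) ^ J \<le> 1" by (simp add: power_le_one)
    then show ?thesis using R 0 by simp
  next
    case (Suc i)
    then have "i < (LEAST j. (1 / 2) ^ j \<le> R)" unfolding j_def[symmetric] by simp
    then have "\<not> (1 / 2) ^ i \<le> R" by (rule not_less_Least)
    then show ?thesis using Suc by simp
  qed
  ultimately show ?thesis using j by blast
qed

lemma filterlim_half_pow: "filterlim (\<lambda>j. (1 / 2 :: real) ^ j) (at_right 0) sequentially"
  unfolding filterlim_at by (auto intro!: LIMSEQ_realpow_zero)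

context
  fixes X :: "'a::euclidean_space set" and k :: nat and \<gamma> :: "'a set measure" and \<theta> :: real
  assumes X: "bounded X" "X \<noteq> {}" and k: "1 \<le> k" and \<gamma>: "grassmann_measure k \<gamma>"
    and \<theta>: "0 < \<theta>" "\<theta> \<le> 1"
begin

text \<open>With \<open>\<delta> = a - s\<close> the cost of a cover is at least
  \<open>p powr a\<close> times the capacity at \<open>p\<close>, which exceeds 1 at all small
  dyadic \<open>p\<close>. So already the tolerance \<open>1 / 2\<close> cannot be met.\<close>

lemma AE_not_lower_coverable:
  assumes s: "0 \<le> s" "s < lower_dim_profile \<theta> k X"
  shows "AE V in \<gamma>. \<not> lower_coverable \<theta> s (proj_onto V ` X)"
proof -
  have sk: "s < real k" using s lower.profile_le[OF X \<theta>, of k] by linarith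
  obtain a where a: "s < a" "\<forall>\<^sub>F r in at_right 0. r powr (- a) < phi_capacity r \<theta> s k X"
    using lower_profile_greater[OF X \<theta> s] by blast
  have cap: "\<forall>\<^sub>F j in sequentially. ((1 / 2) ^ j) powr (- a) < phi_capacity ((1 / 2) ^ j) \<theta> s k X"
    using eventually_compose_filterlim[OF a(2) filterlim_half_pow] .
  have "0 < a - s" using a by simp
  from AE_good_cover_bound[OF X \<gamma> k \<theta> s(1) sk this]
  show ?thesis
  proof (rule eventually_mono)
    fix V assume "\<forall>\<^sub>F j in sequentially. \<forall>R \<epsilon>. (1 / 2) ^ j \<le> R \<longrightarrow> R \<le> 2 * (1 / 2) ^ j \<longrightarrow>
      good_cover \<theta> s \<epsilon> (R powr \<theta>) (proj_onto V ` X) \<longrightarrow>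
      ((1 / 2) ^ j) powr (s + (a - s)) * phi_capacity ((1 / 2) ^ j) \<theta> s k X \<le> \<epsilon>"
    from eventually_conj[OF this cap] obtain J where J: "\<And>j. J \<le> j \<Longrightarrow>
      (\<forall>R \<epsilon>. (1 / 2) ^ j \<le> R \<longrightarrow> R \<le> 2 * (1 / 2) ^ j \<longrightarrow>
      good_cover \<theta> s \<epsilon> (R powr \<theta>) (proj_onto V ` X) \<longrightarrow>
      ((1 / 2) ^ j) powr (s + (a - s)) * phi_capacity ((1 / 2) ^ j) \<theta> s k X \<le> \<epsilon>) \<and>
      ((1 / 2) ^ j) powr (- a) < phi_capacity ((1 / 2) ^ j) \<theta> s k X"
      unfolding eventually_sequentially by blast
    show "\<not> lower_coverable \<theta> s (proj_onto V ` X)"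
    proof
      assume "lower_coverable \<theta> s (proj_onto V ` X)"
      moreover have "(0::real) < 1 / 2" "0 < ((1 / 2 :: real) ^ J) powr \<theta>" by simp_all
      ultimately obtain \<rho> where \<rho>: "0 < \<rho>" "\<rho> \<le> ((1 / 2) ^ J) powr \<theta>" "good_cover \<theta> s (1 / 2) \<rho> (proj_onto V ` X)"
        unfolding lower_coverable_def by blast
      \<comment> \<open>The kernel scale belonging to a cover with diameters up to
        \<open>\<rho>\<close>: it is the least diameter that the cover may use.\<close>
      define R where "R = \<rho> powr (1 / \<theta>)"
      have R\<rho>: "R powr \<theta> = \<rho>" using \<rho> \<theta> by (simp add: R_def powr_powr)
      have "R \<le> (((1 / 2) ^ J) powr \<theta>) powr (1 / \<theta>)" unfolding R_def using \<rho> \<theta> by (intro powr_mono2) auto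
      then have "R \<le> (1 / 2) ^ J" using \<theta> by (simp add: powr_powr)
      moreover have "0 < R" using \<rho> by (simp add: R_def)
      ultimately obtain j where j: "J \<le> j" "(1 / 2) ^ j \<le> R" "R \<le> 2 * (1 / 2) ^ j"
        using dyadic_scale by blast
      define p :: real where "p = (1 / 2) ^ j"
      have "good_cover \<theta> s (1 / 2) (R powr \<theta>) (proj_onto V ` X)" using \<rho>(3) R\<rho> by simp
      from J[OF j(1), THEN conjunct1, rule_format, OF j(2,3) this]
      have "p powr (s + (a - s)) * phi_capacity p \<theta> s k X \<le> 1 / 2" unfolding p_def .
      moreover have cap_j: "p powr (- a) < phi_capacity p \<theta> s k X"
        using J[OF j(1), THEN conjunct2] unfolding p_def .
      ultimately have "p powr a * phi_capacity p \<theta> s k X \<le> 1 / 2" by simp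
      moreover have "p powr a * p powr (- a) \<le> p powr a * phi_capacity p \<theta> s k X"
        using cap_j by (intro mult_left_mono) auto
      moreover have "p powr a * p powr (- a) = 1" unfolding powr_add[symmetric] by (simp add: p_def)
      ultimately show False by linarith
    qed
  qed
qed

text \<open>The capacity is known to be large only at certain scales \<open>r\<close>. A dyadic
  \<open>p\<close> with \<open>p \<le> r \<le> 2 * p\<close> inherits the bound, since capacities
  grow as the scale shrinks, at the price of replacing \<open>r powr (- a)\<close> by
  \<open>(2 * p) powr (- a)\<close>.\<close>

lemma AE_not_upper_coverable:
  assumes s: "0 \<le> s" "s < upper_dim_profile \<theta> k X"
  shows "AE V in \<gamma>. \<not> upper_coverable \<theta> s (proj_onto V ` X)"
proof -
  have sk: "s < real k" using s upper.profile_le[OF X \<theta>, of k] by linarith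
  obtain a where a: "s < a" "\<exists>\<^sub>F r in at_right 0. r powr (- a) < phi_capacity r \<theta> s k X"
    using upper_profile_greater[OF X \<theta> s] by blast
  define \<delta> where "\<delta> = (a - s) / 2"
  have \<delta>: "0 < \<delta>" "s + \<delta> = a - \<delta>" using a by (auto simp: \<delta>_def field_simps)
  from AE_good_cover_bound[OF X \<gamma> k \<theta> s(1) sk \<delta>(1)]
  show ?thesis
  proof (rule eventually_mono)
    fix V assume "\<forall>\<^sub>F j in sequentially. \<forall>R \<epsilon>. (1 / 2) ^ j \<le> R \<longrightarrow> R \<le> 2 * (1 / 2) ^ j \<longrightarrow>
      good_cover \<theta> s \<epsilon> (R powr \<theta>) (proj_onto V ` X) \<longrightarrow>
      ((1 / 2) ^ j) powr (s + \<delta>) * phi_capacity ((1 / 2) ^ j) \<theta> s k X \<le> \<epsilon>"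
    then obtain J where J: "\<And>j R \<epsilon>. J \<le> j \<Longrightarrow> (1 / 2) ^ j \<le> R \<Longrightarrow> R \<le> 2 * (1 / 2) ^ j \<Longrightarrow>
      good_cover \<theta> s \<epsilon> (R powr \<theta>) (proj_onto V ` X) \<Longrightarrow>
      ((1 / 2) ^ j) powr (s + \<delta>) * phi_capacity ((1 / 2) ^ j) \<theta> s k X \<le> \<epsilon>"
      unfolding eventually_sequentially by blast
    show "\<not> upper_coverable \<theta> s (proj_onto V ` X)"
    proof
      assume up: "upper_coverable \<theta> s (proj_onto V ` X)"
      \<comment> \<open>The cost at \<open>p\<close> is at least
        \<open>2 powr (- a) * p powr (- \<delta>)\<close>, hence at least
        \<open>2 powr (- a)\<close>; half of that is out of reach.\<close>
      define \<epsilon> :: real where "\<epsilon> = 2 powr (- a) / 2"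
      have \<epsilon>: "0 < \<epsilon>" by (simp add: \<epsilon>_def)
      obtain r0 where r0: "0 < r0" "\<forall>r. 0 < r \<and> r \<le> r0 \<longrightarrow> good_cover \<theta> s \<epsilon> r (proj_onto V ` X)"
        using up[unfolded upper_coverable_def, rule_format, OF \<epsilon>] by (elim exE conjE)
      have "((\<lambda>r::real. r powr \<theta>) \<longlongrightarrow> 0) (at_right 0)" using \<theta>(1) by real_asymp
      from order_tendstoD(2)[OF this r0(1)]
      have "\<forall>\<^sub>F r in at_right 0. r powr \<theta> < r0" .
      moreover have "\<forall>\<^sub>F r in at_right (0::real). r \<in> {0<..<(1 / 2) ^ J}" by (rule eventually_at_right_real) simp
      ultimately have "\<forall>\<^sub>F r in at_right 0. r powr (- a) < phi_capacity r \<theta> s k X \<longrightarrow>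
          r powr \<theta> < r0 \<and> 0 < r \<and> r \<le> (1 / 2) ^ J \<and> r powr (- a) < phi_capacity r \<theta> s k X"
        by eventually_elim auto
      from frequently_ex[OF frequently_mp[OF this a(2)]]
      obtain r where r: "r powr \<theta> < r0" "0 < r" "r \<le> (1 / 2) ^ J" "r powr (- a) < phi_capacity r \<theta> s k X"
        by blast
      obtain j where j: "J \<le> j" "(1 / 2) ^ j \<le> r" "r \<le> 2 * (1 / 2) ^ j"
        using dyadic_scale[OF r(2,3)] by blast
      define p :: real where "p = (1 / 2) ^ j"
      have p: "0 < p" "p \<le> 1" "p \<le> r" "r \<le> 2 * p" using j by (auto simp: p_def power_le_one)
      have r1: "r \<le> 1" using r(3) power_le_one[of "1 / 2 :: real" J] by simp
      have "p powr \<theta> \<le> r powr \<theta>" using p \<theta> by (intro powr_mono2) auto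
      then have "p powr \<theta> \<le> r0" using r(1) by linarith
      then have "good_cover \<theta> s \<epsilon> (p powr \<theta>) (proj_onto V ` X)" using r0(2) p by simp
      then have le: "p powr (s + \<delta>) * phi_capacity p \<theta> s k X \<le> \<epsilon>"
        using J[OF j(1), of p \<epsilon>] p unfolding p_def by simp
      have sk': "s \<le> real k" using sk by simp
      have "phi_capacity r \<theta> s k X \<le> 1 * phi_capacity p \<theta> s k X"
        by (rule phi_capacity_compare[OF X p(1,2) \<theta> s(1) r(2) r1 \<theta> s(1)])
          (use phi_kernel_scale_mono[OF p(1,3) r1 \<theta> s(1) sk'] in auto)
      moreover have "(2 * p) powr (- a) \<le> r powr (- a)"
        using p r a s by (intro powr_mono2') auto
      ultimately have "(2 * p) powr (- a) \<le> phi_capacity p \<theta> s k X" using r(4) by linarith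
      then have "p powr (s + \<delta>) * (2 * p) powr (- a) \<le> p powr (s + \<delta>) * phi_capacity p \<theta> s k X"
        by (rule mult_left_mono) simp
      moreover have "p powr (s + \<delta>) * (2 * p) powr (- a) = 2 powr (- a) * p powr (- \<delta>)"
      proof -
        have e1: "(2 * p) powr (- a) = 2 powr (- a) * p powr (- a)" by (rule powr_mult; use p in simp)
        have "s + \<delta> + - a = - \<delta>" using \<delta>(2) by simp
        then have e2: "p powr (s + \<delta>) * p powr (- a) = p powr (- \<delta>)"
          unfolding powr_add[symmetric] by (simp only:)
        show ?thesis unfolding e1 e2[symmetric] by (simp only: mult_ac)
      qed
      moreover have "2 powr (- a) * 1 \<le> 2 powr (- a) * p powr (- \<delta>)"
      proof (rule mult_left_mono)
        have "p powr 0 \<le> p powr (- \<delta>)" using p \<delta> by (intro powr_mono') auto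
        then show "1 \<le> p powr (- \<delta>)" using p by simp
      qed simp
      ultimately have "2 powr (- a) \<le> \<epsilon>" using le by linarith
      then show False by (simp add: \<epsilon>_def)
    qed
  qed
qed

text \<open>The null set of the preceding results depends on \<open>s\<close>; rational exponents
  need only countably many, and coverability passes to larger exponents.\<close>

lemma AE_rational_not_coverable:
  "AE V in \<gamma>. \<forall>s\<in>\<rat>. 0 \<le> s \<longrightarrow>
    (s < lower_dim_profile \<theta> k X \<longrightarrow> \<not> lower_coverable \<theta> s (proj_onto V ` X)) \<and>
    (s < upper_dim_profile \<theta> k X \<longrightarrow> \<not> upper_coverable \<theta> s (proj_onto V ` X))"
proof (subst AE_ball_countable[OF countable_rat], rule ballI)
  fix s :: real
  show "AE V in \<gamma>. 0 \<le> s \<longrightarrow>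
    (s < lower_dim_profile \<theta> k X \<longrightarrow> \<not> lower_coverable \<theta> s (proj_onto V ` X)) \<and>
    (s < upper_dim_profile \<theta> k X \<longrightarrow> \<not> upper_coverable \<theta> s (proj_onto V ` X))"
    using AE_not_lower_coverable[of s] AE_not_upper_coverable[of s]
    by (cases "0 \<le> s"; cases "s < lower_dim_profile \<theta> k X"; cases "s < upper_dim_profile \<theta> k X") auto
qed

end

section \<open>One exceptional set for all values of \<theta>\<close>

lemma (in limit_functional) profile_left_approx:
  fixes X :: "'a::euclidean_space set"
  assumes X: "bounded X" "X \<noteq> {}" and k: "1 \<le> k" and \<theta>: "0 < \<theta>" "\<theta> \<le> 1"
    and s: "s < profile \<theta> k X"
  shows "\<exists>q\<in>\<rat>. 0 < q \<and> q \<le> \<theta> \<and> s < profile q k X"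
proof -
  define e where "e = profile \<theta> k X - s"
  have e: "0 < e" using s by (simp add: e_def)
  \<comment> \<open>The first bound keeps \<open>q\<close> above \<open>\<theta> / 2\<close>, as the
    comparison of profiles carries a factor \<open>q\<close>. The second gives
    \<open>(\<theta> - q) * k \<le> (\<theta> / 2) * (e / 2) < q * e\<close>, so the profile drops
    by less than \<open>e\<close>.\<close>
  define \<eta> where "\<eta> = max (\<theta> / 2) (\<theta> - \<theta> * e / (4 * real k))"
  have "\<eta> < \<theta>" unfolding \<eta>_def using \<theta> e k by simp
  from Rats_dense_in_real[OF this] obtain q where q: "q \<in> \<rat>" "\<eta> < q" "q < \<theta>" by blast
  have q2: "\<theta> / 2 < q" "\<theta> - \<theta> * e / (4 * real k) < q" using q unfolding \<eta>_def by auto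
  then have q0: "0 < q" using \<theta> by linarith
  have "q * (profile \<theta> k X - profile q k X) \<le> (\<theta> - q) * k"
    using q q0 \<theta> by (intro profile_theta[OF X]) auto
  also have "\<dots> \<le> (\<theta> * e / (4 * real k)) * k" using q2 by (intro mult_right_mono) auto
  also have "\<dots> = (\<theta> / 2) * (e / 2)" using k by simp
  also have "\<dots> < q * e" using q2 e \<theta> by (intro mult_strict_mono) auto
  finally have "profile \<theta> k X - profile q k X < e" using q0 by (simp add: mult_less_cancel_left_pos)
  then show ?thesis using q q0 unfolding e_def by (intro bexI[of _ q]) auto
qed

theorem theorem5p3:
  fixes X :: "'a::euclidean_space set" and k :: nat
  assumes "bounded X" and "X \<noteq> {}" and "1 \<le> k" and "k < DIM('a)"
  shows "(\<forall>V\<in>(grassmannian k :: 'a set set). \<forall>\<theta>. 0 < \<theta> \<and> \<theta> \<le> 1 \<longrightarrow>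
            lower_int_dim \<theta> (proj_onto V ` X) \<le> lower_dim_profile \<theta> k X \<and>
            upper_int_dim \<theta> (proj_onto V ` X) \<le> upper_dim_profile \<theta> k X)
       \<and> (\<forall>\<gamma>. grassmann_measure k \<gamma> \<longrightarrow>
            (AE V in \<gamma>. \<forall>\<theta>. 0 < \<theta> \<and> \<theta> \<le> 1 \<longrightarrow>
               lower_int_dim \<theta> (proj_onto V ` X) = lower_dim_profile \<theta> k X \<and>
               upper_int_dim \<theta> (proj_onto V ` X) = upper_dim_profile \<theta> k X))"
proof (intro conjI ballI allI impI)
  fix V :: "'a set" and \<theta> :: real assume V: "V \<in> grassmannian k" and "0 < \<theta> \<and> \<theta> \<le> 1"
  then have \<theta>: "0 < \<theta>" "\<theta> \<le> 1" by auto
  show "lower_int_dim \<theta> (proj_onto V ` X) \<le> lower_dim_profile \<theta> k X"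
    by (rule lower_int_dim_proj_le[OF assms(1,2) V assms(3) \<theta>])
  show "upper_int_dim \<theta> (proj_onto V ` X) \<le> upper_dim_profile \<theta> k X"
    by (rule upper_int_dim_proj_le[OF assms(1,2) V assms(3) \<theta>])
next
  fix \<gamma> :: "'a set measure" assume \<gamma>: "grassmann_measure k \<gamma>"
  note X = assms(1,2) and k = assms(3)
  have "AE V in \<gamma>. \<forall>q\<in>\<rat>. 0 < q \<and> q \<le> 1 \<longrightarrow> (\<forall>s\<in>\<rat>. 0 \<le> s \<longrightarrow>
    (s < lower_dim_profile q k X \<longrightarrow> \<not> lower_coverable q s (proj_onto V ` X)) \<and>
    (s < upper_dim_profile q k X \<longrightarrow> \<not> upper_coverable q s (proj_onto V ` X)))"
  proof (subst AE_ball_countable[OF countable_rat], rule ballI)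
    fix q :: real
    show "AE V in \<gamma>. 0 < q \<and> q \<le> 1 \<longrightarrow> (\<forall>s\<in>\<rat>. 0 \<le> s \<longrightarrow>
      (s < lower_dim_profile q k X \<longrightarrow> \<not> lower_coverable q s (proj_onto V ` X)) \<and>
      (s < upper_dim_profile q k X \<longrightarrow> \<not> upper_coverable q s (proj_onto V ` X)))"
    proof (cases "0 < q \<and> q \<le> 1")
      case True
      then have "0 < q" "q \<le> 1" by auto
      from AE_rational_not_coverable[OF X k \<gamma> this] show ?thesis
        by (rule eventually_mono) (rule impI)
    next
      case False
      then show ?thesis by (intro AE_I2) (rule impI, rule notE)
    qed
  qed
  moreover have "AE V in \<gamma>. V \<in> space \<gamma>" by (rule AE_space)
  ultimately show "AE V in \<gamma>. \<forall>\<theta>. 0 < \<theta> \<and> \<theta> \<le> 1 \<longrightarrow>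
    lower_int_dim \<theta> (proj_onto V ` X) = lower_dim_profile \<theta> k X \<and>
    upper_int_dim \<theta> (proj_onto V ` X) = upper_dim_profile \<theta> k X"
  proof eventually_elim
    fix V assume N: "\<forall>q\<in>\<rat>. 0 < q \<and> q \<le> 1 \<longrightarrow> (\<forall>s\<in>\<rat>. 0 \<le> s \<longrightarrow>
      (s < lower_dim_profile q k X \<longrightarrow> \<not> lower_coverable q s (proj_onto V ` X)) \<and>
      (s < upper_dim_profile q k X \<longrightarrow> \<not> upper_coverable q s (proj_onto V ` X)))"
      and "V \<in> space \<gamma>"
    then have V: "V \<in> grassmannian k" by (simp add: space_grassmann_measure[OF \<gamma>])
    show "\<forall>\<theta>. 0 < \<theta> \<and> \<theta> \<le> 1 \<longrightarrow>
      lower_int_dim \<theta> (proj_onto V ` X) = lower_dim_profile \<theta> k X \<and>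
      upper_int_dim \<theta> (proj_onto V ` X) = upper_dim_profile \<theta> k X"
    proof (intro allI impI)
      fix \<theta> :: real assume "0 < \<theta> \<and> \<theta> \<le> 1"
      then have \<theta>: "0 < \<theta>" "\<theta> \<le> 1" by auto
      have "lower_dim_profile \<theta> k X \<le> lower_int_dim \<theta> (proj_onto V ` X)"
      proof (rule lower_int_dim_proj_ge[OF X V k \<theta>], rule ccontr)
        fix s assume s: "0 \<le> s" "lower_coverable \<theta> s (proj_onto V ` X)" "\<not> lower_dim_profile \<theta> k X \<le> s"
        then obtain q where q: "q \<in> \<rat>" "0 < q" "q \<le> \<theta>" "s < lower_dim_profile q k X"
          using lower.profile_left_approx[OF X k \<theta>, of s] by (auto simp: not_le)
        \<comment> \<open>Coverability at \<theta> with exponent \<open>s\<close> passes to the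
          smaller parameter \<open>q\<close> and the larger exponent \<open>t\<close>. Both are
          rational, so the exceptional set already excludes it.\<close>
        obtain t where t: "t \<in> \<rat>" "s < t" "t < lower_dim_profile q k X"
          using Rats_dense_in_real[OF q(4)] by blast
        have "q \<le> 1" "0 \<le> t" using q \<theta> t s by auto
        moreover have "lower_coverable q t (proj_onto V ` X)"
          using lower_coverable_mono[OF s(2) _ q(2,3)] t by simp
        ultimately show False using N q t by blast
      qed
      moreover have "upper_dim_profile \<theta> k X \<le> upper_int_dim \<theta> (proj_onto V ` X)"
      proof (rule upper_int_dim_proj_ge[OF X V k \<theta>], rule ccontr)
        fix s assume s: "0 \<le> s" "upper_coverable \<theta> s (proj_onto V ` X)" "\<not> upper_dim_profile \<theta> k X \<le> s"
        then obtain q where q: "q \<in> \<rat>" "0 < q" "q \<le> \<theta>" "s < upper_dim_profile q k X"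
          using upper.profile_left_approx[OF X k \<theta>, of s] by (auto simp: not_le)
        obtain t where t: "t \<in> \<rat>" "s < t" "t < upper_dim_profile q k X"
          using Rats_dense_in_real[OF q(4)] by blast
        have "q \<le> 1" "0 \<le> t" using q \<theta> t s by auto
        moreover have "upper_coverable q t (proj_onto V ` X)"
          using upper_coverable_mono[OF s(2) _ q(2,3)] t by simp
        ultimately show False using N q t by blast
      qed
      ultimately show "lower_int_dim \<theta> (proj_onto V ` X) = lower_dim_profile \<theta> k X \<and>
        upper_int_dim \<theta> (proj_onto V ` X) = upper_dim_profile \<theta> k X"
        using lower_int_dim_proj_le[OF X V k \<theta>] upper_int_dim_proj_le[OF X V k \<theta>] by (intro conjI antisym)
    qed
  qed
qed

end
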